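(* Let $X$ be a scheme, let $\mathscr{O}_Y$ be a quadratic $\mathscr{O}_X$-algebra, and let $\mathscr{I},\mathscr{I}'$ be pseudoregular $\mathscr{O}_Y$-modules. If $\mathscr{I}$ and $\mathscr{I}'$ are coprimitive, then $\mathscr{I}\otimes_{\mathscr{O}_Y}\mathscr{I}'$ is pseudoregular.
   Context: A quadratic $\mathscr{O}_X$-algebra is an $\mathscr{O}_X$-algebra locally free of rank $2$ as an $\mathscr{O}_X$-module. An $\mathscr{O}_Y$-module $\mathscr{I}$ is pseudoregular if it is locally free of rank $2$ as an $\mathscr{O}_X$-module and for every affine open $U\subseteq X$ and $\alpha\in\mathscr{O}_Y(U)$, the characteristic polynomials over $\mathscr{O}_X(U)$ of multiplication by $\alpha$ on $\mathscr{O}_Y(U)$ and on $\mathscr{I}(U)$ are equal. Coprimitive, local case: let $S$ be a free quadratic $R$-algebra and $I,I'$ pseudoregular $S$-modules free of rank $2$ over $R$. A good frame $\alpha,e_1,e_2$ for $S$ and $I$ consists of an $R$-basis $1,\alpha$ of $S$ and an $R$-basis $e_1,e_2$ of $I$ with $\alpha e_2\in Re_1$; then $\alpha e_1=be_1-ae_2$, $\alpha e_2=ce_1$ and $\alpha^2-b\alpha+ac=0$ for some $a,b,c\in R$. Good frames always exist, and one can choose good frames $\alpha,e_1,e_2$ for $S,I$ and $\alpha',e_1',e_2'$ for $S,I'$ with $\alpha'=\alpha+r$ for some $r\in R$ (a unital pair); let $a',b',c'$ be the corresponding elements for $I'$. Then $I,I'$ are coprimitive if $\langle a,b,c,a',b',c',r\rangle=R$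 (independent of the choice of unital pair of good frames). In general $\mathscr{I},\mathscr{I}'$ are coprimitive if there is an affine open cover $X=\bigcup_iU_i$ (with all modules free on each $U_i$) such that $\mathscr{I}(U_i)$ and $\mathscr{I}'(U_i)$ are coprimitive over $\mathscr{O}_Y(U_i)$ for all $i$. *)

theory Defs
  imports
    "HOL-Analysis.Abstract_Topology"
    "HOL-Analysis.Function_Topology"
    "HOL-Algebra.QuotRing"
    "HOL-Algebra.UnivPoly"
    "HOL-Algebra.Free_Abelian_Groups"
begin

section \<open>Sheaves of rings, modules and algebras\<close>

text \<open>
  A presheaf assigns a ring record (which may be extended, for instance to a module record) to
  every open set. For open \<open>V \<subseteq> U\<close>, \<open>restr F U V\<close> is the restriction map from sections over
  \<open>U\<close> to sections over \<open>V\<close>. Values at non-open sets, and values of the restriction maps outside the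
  carriers, are irrelevant. For modules the ring multiplication and unit of the record are junk.
\<close>

record ('x, 'a, 'r) presheaf =
  sections :: "'x set \<Rightarrow> ('a, 'r) ring_scheme"
  restr :: "'x set \<Rightarrow> 'x set \<Rightarrow> 'a \<Rightarrow> 'a"

type_synonym ('x, 'a) ring_presheaf = "('x, 'a, unit) presheaf"
type_synonym ('x, 'a, 'm) module_presheaf = "('x, 'm, ('a, 'm, unit) module_ext) presheaf"

text \<open>
  The empty family of open sets is allowed in locality and gluing, so there is exactly one section
  over the empty set.
\<close>

locale sheaf =
  fixes X :: "'x topology" and F :: "('x, 'a, 'r) presheaf"
  assumes restr_closed:
      "\<lbrakk>openin X U; openin X V; V \<subseteq> U; s \<in> carrier (sections F U)\<rbrakk>
        \<Longrightarrow> restr F U V s \<in> carrier (sections F V)"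
    and restr_id: "\<lbrakk>openin X U; s \<in> carrier (sections F U)\<rbrakk> \<Longrightarrow> restr F U U s = s"
    and restr_comp:
      "\<lbrakk>openin X U; openin X V; openin X W; V \<subseteq> U; W \<subseteq> V; s \<in> carrier (sections F U)\<rbrakk>
        \<Longrightarrow> restr F V W (restr F U V s) = restr F U W s"
    and locality:
      "\<lbrakk>\<And>V. V \<in> \<V> \<Longrightarrow> openin X V; U = \<Union>\<V>;
        s \<in> carrier (sections F U); t \<in> carrier (sections F U);
        \<And>V. V \<in> \<V> \<Longrightarrow> restr F U V s = restr F U V t\<rbrakk> \<Longrightarrow> s = t"
    and gluing:
      "\<lbrakk>\<And>V. V \<in> \<V> \<Longrightarrow> openin X V; U = \<Union>\<V>;
        \<And>V. V \<in> \<V> \<Longrightarrow> \<sigma> V \<in> carrier (sections F V);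
        \<And>V W. \<lbrakk>V \<in> \<V>; W \<in> \<V>\<rbrakk> \<Longrightarrow> restr F V (V \<inter> W) (\<sigma> V) = restr F W (V \<inter> W) (\<sigma> W)\<rbrakk>
        \<Longrightarrow> \<exists>s\<in>carrier (sections F U). \<forall>V\<in>\<V>. restr F U V s = \<sigma> V"

locale ringed_space = sheaf X \<O>
  for X :: "'x topology" and \<O> :: "('x, 'a, 'r) presheaf" +
  assumes cring_sections: "openin X U \<Longrightarrow> cring (sections \<O> U)"
    and restr_hom:
      "\<lbrakk>openin X U; openin X V; V \<subseteq> U\<rbrakk> \<Longrightarrow> restr \<O> U V \<in> ring_hom (sections \<O> U) (sections \<O> V)"

locale module_sheaf = ringed_space X \<O> + M?: sheaf X \<M>
  for X :: "'x topology" and \<O> :: "('x, 'a, 'r) presheaf"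
    and \<M> :: "('x, 'a, 'm) module_presheaf" +
  assumes module_sections: "openin X U \<Longrightarrow> module (sections \<O> U) (sections \<M> U)"
    and restr_add:
      "\<lbrakk>openin X U; openin X V; V \<subseteq> U; m \<in> carrier (sections \<M> U); n \<in> carrier (sections \<M> U)\<rbrakk>
        \<Longrightarrow> restr \<M> U V (m \<oplus>\<^bsub>sections \<M> U\<^esub> n)
            = restr \<M> U V m \<oplus>\<^bsub>sections \<M> V\<^esub> restr \<M> U V n"
    and restr_smult:
      "\<lbrakk>openin X U; openin X V; V \<subseteq> U; r \<in> carrier (sections \<O> U); m \<in> carrier (sections \<M> U)\<rbrakk>
        \<Longrightarrow> restr \<M> U V (r \<odot>\<^bsub>sections \<M> U\<^esub> m)
            = restr \<O> U V r \<odot>\<^bsub>sections \<M> V\<^esub> restr \<M> U V m"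

locale algebra_sheaf = module_sheaf X \<O> \<A> + A?: ringed_space X \<A>
  for X :: "'x topology" and \<O> :: "('x, 'a, 'r) presheaf"
    and \<A> :: "('x, 'a, 's) module_presheaf" +
  assumes algebra_sections: "openin X U \<Longrightarrow> algebra (sections \<O> U) (sections \<A> U)"


section \<open>Affine schemes and schemes\<close>

text \<open>
  \<open>fraction R p a s\<close> is the element \<open>a/s\<close> of the localisation of \<open>R\<close> at the prime \<open>p\<close>, as an equivalence
  class of pairs. In the operations below all sets in the union are equal.
\<close>

definition fraction :: "('a, 'r) ring_scheme \<Rightarrow> 'a set \<Rightarrow> 'a \<Rightarrow> 'a \<Rightarrow> ('a \<times> 'a) set" where
  "fraction R p a s = {(b, t). b \<in> carrier R \<and> t \<in> carrier R - p \<and>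
     (\<exists>u\<in>carrier R - p. u \<otimes>\<^bsub>R\<^esub> (t \<otimes>\<^bsub>R\<^esub> a \<ominus>\<^bsub>R\<^esub> s \<otimes>\<^bsub>R\<^esub> b) = \<zero>\<^bsub>R\<^esub>)}"

definition fraction_add ::
  "('a, 'r) ring_scheme \<Rightarrow> 'a set \<Rightarrow> ('a \<times> 'a) set \<Rightarrow> ('a \<times> 'a) set \<Rightarrow> ('a \<times> 'a) set" where
  "fraction_add R p x y =
     (\<Union>(a, s)\<in>x. \<Union>(b, t)\<in>y. fraction R p (a \<otimes>\<^bsub>R\<^esub> t \<oplus>\<^bsub>R\<^esub> b \<otimes>\<^bsub>R\<^esub> s) (s \<otimes>\<^bsub>R\<^esub> t))"

definition fraction_mult ::
  "('a, 'r) ring_scheme \<Rightarrow> 'a set \<Rightarrow> ('a \<times> 'a) set \<Rightarrow> ('a \<times> 'a) set \<Rightarrow> ('a \<times> 'a) set" where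
  "fraction_mult R p x y = (\<Union>(a, s)\<in>x. \<Union>(b, t)\<in>y. fraction R p (a \<otimes>\<^bsub>R\<^esub> b) (s \<otimes>\<^bsub>R\<^esub> t))"

text \<open>The distinguished open sets form a basis of the Zariski topology.\<close>

definition Spec :: "('a, 'r) ring_scheme \<Rightarrow> 'a set topology" where
  "Spec R = topology_generated_by {{p. primeideal p R \<and> f \<notin> p} | f. f \<in> carrier R}"

definition Spec_sections :: "('a, 'r) ring_scheme \<Rightarrow> 'a set set \<Rightarrow> ('a set \<Rightarrow> ('a \<times> 'a) set) set" where
  "Spec_sections R W = {\<sigma> \<in> extensional W.
     \<forall>p\<in>W. \<exists>V a f. openin (Spec R) V \<and> p \<in> V \<and> V \<subseteq> W \<and> a \<in> carrier R \<and> f \<in> carrier R \<and>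
       (\<forall>q\<in>V. f \<notin> q \<and> \<sigma> q = fraction R q a f)}"

definition Spec_sheaf :: "('a, 'r) ring_scheme \<Rightarrow> ('a set, 'a set \<Rightarrow> ('a \<times> 'a) set) ring_presheaf" where
  "Spec_sheaf R = \<lparr>
     sections = (\<lambda>W. \<lparr>
       carrier = Spec_sections R W,
       monoid.mult = (\<lambda>\<sigma> \<tau>. \<lambda>p\<in>W. fraction_mult R p (\<sigma> p) (\<tau> p)),
       one = (\<lambda>p\<in>W. fraction R p \<one>\<^bsub>R\<^esub> \<one>\<^bsub>R\<^esub>),
       ring.zero = (\<lambda>p\<in>W. fraction R p \<zero>\<^bsub>R\<^esub> \<one>\<^bsub>R\<^esub>),
       ring.add = (\<lambda>\<sigma> \<tau>. \<lambda>p\<in>W. fraction_add R p (\<sigma> p) (\<tau> p))\<rparr>),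
     restr = (\<lambda>W V \<sigma>. restrict \<sigma> V)\<rparr>"

text \<open>
  The open subspace \<open>U\<close> of the ringed space \<open>(X, \<O>)\<close> is isomorphic to some \<open>Spec R\<close>. Letting \<open>R\<close>
  range over rings on the type of sections is no restriction, since \<open>R\<close> is isomorphic to the ring
  of sections over \<open>U\<close>. As \<open>Spec R\<close> is locally ringed and isomorphisms of ringed spaces are
  isomorphisms on stalks, locality need not be mentioned.
\<close>

definition affine_open :: "'x topology \<Rightarrow> ('x, 'a) ring_presheaf \<Rightarrow> 'x set \<Rightarrow> bool" where
  "affine_open X \<O> U \<longleftrightarrow> openin X U \<and>
     (\<exists>(R :: 'a ring) g \<psi>. cring R \<and>
       homeomorphic_map (subtopology X U) (Spec R) g \<and>
       (\<forall>W. openin (Spec R) W \<longrightarrow>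
          \<psi> W \<in> ring_iso (sections (Spec_sheaf R) W) (sections \<O> {x \<in> U. g x \<in> W})) \<and>
       (\<forall>W V. openin (Spec R) W \<and> openin (Spec R) V \<and> V \<subseteq> W \<longrightarrow>
          (\<forall>\<sigma>\<in>carrier (sections (Spec_sheaf R) W).
             \<psi> V (restr (Spec_sheaf R) W V \<sigma>)
             = restr \<O> {x \<in> U. g x \<in> W} {x \<in> U. g x \<in> V} (\<psi> W \<sigma>))))"

locale scheme = ringed_space X \<O>
  for X :: "'x topology" and \<O> :: "('x, 'a) ring_presheaf" +
  assumes affine_nbhd: "x \<in> topspace X \<Longrightarrow> \<exists>U. affine_open X \<O> U \<and> x \<in> U"


section \<open>Modules of rank 2 and characteristic polynomials\<close>

definition basis2 :: "('a, 'r) ring_scheme \<Rightarrow> ('a, 'm, 'z) module_scheme \<Rightarrow> 'm \<Rightarrow> 'm \<Rightarrow> bool" where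
  "basis2 R M e1 e2 \<longleftrightarrow> e1 \<in> carrier M \<and> e2 \<in> carrier M \<and>
     (\<forall>m\<in>carrier M. \<exists>!(r, s). r \<in> carrier R \<and> s \<in> carrier R \<and>
        m = r \<odot>\<^bsub>M\<^esub> e1 \<oplus>\<^bsub>M\<^esub> s \<odot>\<^bsub>M\<^esub> e2)"

text \<open>
  \<open>e1, e2\<close> are sections over \<open>U\<close> defining an isomorphism from the restriction of \<open>\<O>\<^sup>2\<close> to \<open>U\<close> to
  the restriction of \<open>\<M>\<close> to \<open>U\<close>.
\<close>

definition sheaf_basis2 ::
  "'x topology \<Rightarrow> ('x, 'a) ring_presheaf \<Rightarrow> ('x, 'a, 'm) module_presheaf \<Rightarrow> 'x set \<Rightarrow> 'm \<Rightarrow> 'm \<Rightarrow> bool"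
where
  "sheaf_basis2 X \<O> \<M> U e1 e2 \<longleftrightarrow> e1 \<in> carrier (sections \<M> U) \<and> e2 \<in> carrier (sections \<M> U) \<and>
     (\<forall>V. openin X V \<and> V \<subseteq> U \<longrightarrow>
        basis2 (sections \<O> V) (sections \<M> V) (restr \<M> U V e1) (restr \<M> U V e2))"

definition free_rank2_on ::
  "'x topology \<Rightarrow> ('x, 'a) ring_presheaf \<Rightarrow> ('x, 'a, 'm) module_presheaf \<Rightarrow> 'x set \<Rightarrow> bool" where
  "free_rank2_on X \<O> \<M> U \<longleftrightarrow> (\<exists>e1 e2. sheaf_basis2 X \<O> \<M> U e1 e2)"

definition locally_free_rank2 ::
  "'x topology \<Rightarrow> ('x, 'a) ring_presheaf \<Rightarrow> ('x, 'a, 'm) module_presheaf \<Rightarrow> bool" where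
  "locally_free_rank2 X \<O> \<M> \<longleftrightarrow>
     (\<forall>x\<in>topspace X. \<exists>U. openin X U \<and> x \<in> U \<and> free_rank2_on X \<O> \<M> U)"

text \<open>The determinant of \<open>T - A\<close>, where \<open>A\<close> has rows \<open>a, b\<close> and \<open>c, d\<close>.\<close>

definition charpoly_matrix2 :: "('a, 'r) ring_scheme \<Rightarrow> 'a \<Rightarrow> 'a \<Rightarrow> 'a \<Rightarrow> 'a \<Rightarrow> nat \<Rightarrow> 'a" where
  "charpoly_matrix2 R a b c d =
     (let P = UP R; T = monom P \<one>\<^bsub>R\<^esub> 1; C = (\<lambda>r. monom P r 0)
      in (T \<ominus>\<^bsub>P\<^esub> C a) \<otimes>\<^bsub>P\<^esub> (T \<ominus>\<^bsub>P\<^esub> C d) \<ominus>\<^bsub>P\<^esub> C b \<otimes>\<^bsub>P\<^esub> C c)"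

definition is_charpoly_wrt ::
  "('a, 'r) ring_scheme \<Rightarrow> ('a, 'm, 'z) module_scheme \<Rightarrow> 'm \<Rightarrow> 'm \<Rightarrow> ('m \<Rightarrow> 'm) \<Rightarrow> (nat \<Rightarrow> 'a) \<Rightarrow> bool"
where
  "is_charpoly_wrt R M e1 e2 \<phi> p \<longleftrightarrow>
     (\<exists>a\<in>carrier R. \<exists>b\<in>carrier R. \<exists>c\<in>carrier R. \<exists>d\<in>carrier R.
        \<phi> e1 = a \<odot>\<^bsub>M\<^esub> e1 \<oplus>\<^bsub>M\<^esub> c \<odot>\<^bsub>M\<^esub> e2 \<and>
        \<phi> e2 = b \<odot>\<^bsub>M\<^esub> e1 \<oplus>\<^bsub>M\<^esub> d \<odot>\<^bsub>M\<^esub> e2 \<and>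
        p = charpoly_matrix2 R a b c d)"

text \<open>
  The characteristic polynomial over \<open>\<O>(U)\<close> of an endomorphism of a module that is only locally free
  of rank 2: the unique polynomial whose restriction to every open \<open>V \<subseteq> U\<close> on which \<open>\<M>\<close> is free is
  the characteristic polynomial of the matrix of \<open>\<phi>\<close> over \<open>V\<close>. The endomorphism is given by its
  components \<open>\<phi> V\<close> for open \<open>V \<subseteq> U\<close>. Elements of \<open>UP\<close> are their own coefficient functions, so
  composition with a restriction map is coefficientwise restriction.
\<close>

definition charpoly ::
  "'x topology \<Rightarrow> ('x, 'a) ring_presheaf \<Rightarrow> ('x, 'a, 'm) module_presheaf \<Rightarrow> 'x set
    \<Rightarrow> ('x set \<Rightarrow> 'm \<Rightarrow> 'm) \<Rightarrow> nat \<Rightarrow> 'a" where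
  "charpoly X \<O> \<M> U \<phi> =
     (THE p. p \<in> carrier (UP (sections \<O> U)) \<and>
        (\<forall>V e1 e2. openin X V \<and> V \<subseteq> U \<and> sheaf_basis2 X \<O> \<M> V e1 e2 \<longrightarrow>
           is_charpoly_wrt (sections \<O> V) (sections \<M> V) e1 e2 (\<phi> V) (restr \<O> U V \<circ> p)))"


section \<open>Quadratic algebras, pseudoregular modules, coprimitivity\<close>

definition quadratic_algebra ::
  "'x topology \<Rightarrow> ('x, 'a) ring_presheaf \<Rightarrow> ('x, 'a, 's) module_presheaf \<Rightarrow> bool" where
  "quadratic_algebra X \<O>X \<O>Y \<longleftrightarrow> algebra_sheaf X \<O>X \<O>Y \<and> locally_free_rank2 X \<O>X \<O>Y"

definition restrict_scalars :: "('a, 's) module \<Rightarrow> ('s, 'm) module \<Rightarrow> ('a, 'm) module" where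
  "restrict_scalars S M =
     \<lparr>carrier = carrier M, monoid.mult = monoid.mult M, one = one M, ring.zero = ring.zero M, ring.add = ring.add M,
      smult = (\<lambda>r m. (r \<odot>\<^bsub>S\<^esub> \<one>\<^bsub>S\<^esub>) \<odot>\<^bsub>M\<^esub> m)\<rparr>"

definition restrict_scalars_sheaf ::
  "('x, 'a, 's) module_presheaf \<Rightarrow> ('x, 's, 'm) module_presheaf \<Rightarrow> ('x, 'a, 'm) module_presheaf" where
  "restrict_scalars_sheaf \<O>Y \<M> =
     \<lparr>sections = (\<lambda>U. restrict_scalars (sections \<O>Y U) (sections \<M> U)), restr = restr \<M>\<rparr>"

definition pseudoregular ::
  "'x topology \<Rightarrow> ('x, 'a) ring_presheaf \<Rightarrow> ('x, 'a, 's) module_presheaf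
    \<Rightarrow> ('x, 's, 'm) module_presheaf \<Rightarrow> bool" where
  "pseudoregular X \<O>X \<O>Y \<I> \<longleftrightarrow>
     module_sheaf X \<O>Y \<I> \<and>
     locally_free_rank2 X \<O>X (restrict_scalars_sheaf \<O>Y \<I>) \<and>
     (\<forall>U \<alpha>. affine_open X \<O>X U \<and> \<alpha> \<in> carrier (sections \<O>Y U) \<longrightarrow>
        charpoly X \<O>X \<O>Y U (\<lambda>V s. restr \<O>Y U V \<alpha> \<otimes>\<^bsub>sections \<O>Y V\<^esub> s) =
        charpoly X \<O>X (restrict_scalars_sheaf \<O>Y \<I>) U
          (\<lambda>V m. restr \<O>Y U V \<alpha> \<odot>\<^bsub>sections \<I> V\<^esub> m))"

text \<open>
  \<open>\<alpha>, e1, e2\<close> is a good frame for the \<open>R\<close>-algebra \<open>S\<close> and the \<open>S\<close>-module \<open>I\<close>, with corresponding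
  ring elements \<open>a, b, c\<close>. The equation \<open>\<alpha>\<^sup>2 - b\<alpha> + ac = 0\<close> is not part of the definition: it
  follows when \<open>I\<close> is pseudoregular.
\<close>

definition good_frame ::
  "('a, 'r) ring_scheme \<Rightarrow> ('a, 's) module \<Rightarrow> ('s, 'm) module
    \<Rightarrow> 's \<Rightarrow> 'm \<Rightarrow> 'm \<Rightarrow> 'a \<Rightarrow> 'a \<Rightarrow> 'a \<Rightarrow> bool" where
  "good_frame R S I \<alpha> e1 e2 a b c \<longleftrightarrow>
     basis2 R S \<one>\<^bsub>S\<^esub> \<alpha> \<and> basis2 R (restrict_scalars S I) e1 e2 \<and>
     a \<in> carrier R \<and> b \<in> carrier R \<and> c \<in> carrier R \<and>
     (let I\<^sub>R = restrict_scalars S I in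
        \<alpha> \<odot>\<^bsub>I\<^esub> e1 = b \<odot>\<^bsub>I\<^sub>R\<^esub> e1 \<ominus>\<^bsub>I\<^esub> a \<odot>\<^bsub>I\<^sub>R\<^esub> e2 \<and>
        \<alpha> \<odot>\<^bsub>I\<^esub> e2 = c \<odot>\<^bsub>I\<^sub>R\<^esub> e1)"

definition coprimitive_modules ::
  "('a, 'r) ring_scheme \<Rightarrow> ('a, 's) module \<Rightarrow> ('s, 'm) module \<Rightarrow> ('s, 'n) module \<Rightarrow> bool" where
  "coprimitive_modules R S I I' \<longleftrightarrow>
     (\<exists>\<alpha> e1 e2 a b c \<alpha>' e1' e2' a' b' c' r.
        good_frame R S I \<alpha> e1 e2 a b c \<and> good_frame R S I' \<alpha>' e1' e2' a' b' c' \<and>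
        r \<in> carrier R \<and> \<alpha>' = \<alpha> \<oplus>\<^bsub>S\<^esub> r \<odot>\<^bsub>S\<^esub> \<one>\<^bsub>S\<^esub> \<and>
        genideal R {a, b, c, a', b', c', r} = carrier R)"

definition coprimitive ::
  "'x topology \<Rightarrow> ('x, 'a) ring_presheaf \<Rightarrow> ('x, 'a, 's) module_presheaf
    \<Rightarrow> ('x, 's, 'm) module_presheaf \<Rightarrow> ('x, 's, 'n) module_presheaf \<Rightarrow> bool" where
  "coprimitive X \<O>X \<O>Y \<I> \<I>' \<longleftrightarrow>
     (\<exists>\<U>. \<Union>\<U> = topspace X \<and>
        (\<forall>U\<in>\<U>. affine_open X \<O>X U \<and>
           free_rank2_on X \<O>X \<O>Y U \<and>
           free_rank2_on X \<O>X (restrict_scalars_sheaf \<O>Y \<I>) U \<and>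
           free_rank2_on X \<O>X (restrict_scalars_sheaf \<O>Y \<I>') U \<and>
           coprimitive_modules (sections \<O>X U) (sections \<O>Y U) (sections \<I> U) (sections \<I>' U)))"


section \<open>Tensor products\<close>

text \<open>
  The tensor product of two \<open>S\<close>-modules is the quotient of the free abelian group on the product of
  the carriers by the subgroup of bilinearity relations; its elements are cosets.
\<close>

definition tensor_relations ::
  "('s, 'r) ring_scheme \<Rightarrow> ('s, 'm) module \<Rightarrow> ('s, 'n) module \<Rightarrow> ('m \<times> 'n \<Rightarrow>\<^sub>0 int) set" where
  "tensor_relations S M N = generate (free_Abelian_group (carrier M \<times> carrier N))
     ({frag_of (m \<oplus>\<^bsub>M\<^esub> m', n) - frag_of (m, n) - frag_of (m', n) | m m' n.
         m \<in> carrier M \<and> m' \<in> carrier M \<and> n \<in> carrier N} \<union>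
      {frag_of (m, n \<oplus>\<^bsub>N\<^esub> n') - frag_of (m, n) - frag_of (m, n') | m n n'.
         m \<in> carrier M \<and> n \<in> carrier N \<and> n' \<in> carrier N} \<union>
      {frag_of (s \<odot>\<^bsub>M\<^esub> m, n) - frag_of (m, s \<odot>\<^bsub>N\<^esub> n) | s m n.
         s \<in> carrier S \<and> m \<in> carrier M \<and> n \<in> carrier N})"

definition tensor_class ::
  "('s, 'r) ring_scheme \<Rightarrow> ('s, 'm) module \<Rightarrow> ('s, 'n) module
    \<Rightarrow> ('m \<times> 'n \<Rightarrow>\<^sub>0 int) \<Rightarrow> ('m \<times> 'n \<Rightarrow>\<^sub>0 int) set" where
  "tensor_class S M N z =
     tensor_relations S M N #>\<^bsub>free_Abelian_group (carrier M \<times> carrier N)\<^esub> z"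

text \<open>
  In the scalar multiplication, and in the restriction maps of the tensor product presheaf, all
  cosets in the union are equal.
\<close>

definition tensor_module ::
  "('s, 'r) ring_scheme \<Rightarrow> ('s, 'm) module \<Rightarrow> ('s, 'n) module
    \<Rightarrow> ('s, ('m \<times> 'n \<Rightarrow>\<^sub>0 int) set) module" where
  "tensor_module S M N =
     (let Q = free_Abelian_group (carrier M \<times> carrier N) Mod tensor_relations S M N in
      \<lparr>carrier = carrier Q, monoid.mult = undefined, one = undefined,
       ring.zero = one Q, ring.add = monoid.mult Q,
       smult = (\<lambda>s A. \<Union>z\<in>A. tensor_class S M N
         (frag_extend (\<lambda>(m, n). frag_of (s \<odot>\<^bsub>M\<^esub> m, n)) z))\<rparr>)"

definition tensor_presheaf ::
  "('x, 's, 'r) presheaf \<Rightarrow> ('x, 's, 'm) module_presheaf \<Rightarrow> ('x, 's, 'n) module_presheaf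
    \<Rightarrow> ('x, 's, ('m \<times> 'n \<Rightarrow>\<^sub>0 int) set) module_presheaf" where
  "tensor_presheaf \<O> \<M> \<N> = \<lparr>
     sections = (\<lambda>U. tensor_module (sections \<O> U) (sections \<M> U) (sections \<N> U)),
     restr = (\<lambda>U V A. \<Union>z\<in>A. tensor_class (sections \<O> V) (sections \<M> V) (sections \<N> V)
       (frag_extend (\<lambda>(m, n). frag_of (restr \<M> U V m, restr \<N> U V n)) z))\<rparr>"

text \<open>
  Sheafification of a presheaf of modules: sections over \<open>U\<close> are families of germs at the points of
  \<open>U\<close> which locally come from sections of the presheaf. The germ at \<open>x\<close> of a section \<open>s\<close> over \<open>U\<close> is
  an equivalence class of pairs of an open neighbourhood of \<open>x\<close> and a section over it.
\<close>

definition germ ::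
  "'x topology \<Rightarrow> ('x, 'a, 'r) presheaf \<Rightarrow> 'x \<Rightarrow> 'x set \<Rightarrow> 'a \<Rightarrow> ('x set \<times> 'a) set" where
  "germ X F x U s = {(V, t). openin X V \<and> x \<in> V \<and> t \<in> carrier (sections F V) \<and>
     (\<exists>W. openin X W \<and> x \<in> W \<and> W \<subseteq> U \<inter> V \<and> restr F U W s = restr F V W t)}"

definition germ_add ::
  "'x topology \<Rightarrow> ('x, 'a, 'r) presheaf \<Rightarrow> 'x
    \<Rightarrow> ('x set \<times> 'a) set \<Rightarrow> ('x set \<times> 'a) set \<Rightarrow> ('x set \<times> 'a) set" where
  "germ_add X F x g h = (\<Union>(U, s)\<in>g. \<Union>(V, t)\<in>h.
     germ X F x (U \<inter> V) (restr F U (U \<inter> V) s \<oplus>\<^bsub>sections F (U \<inter> V)\<^esub> restr F V (U \<inter> V) t))"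

definition germ_smult ::
  "'x topology \<Rightarrow> ('x, 's, 'r) presheaf \<Rightarrow> ('x, 's, 'm) module_presheaf \<Rightarrow> 'x
    \<Rightarrow> 'x set \<Rightarrow> 's \<Rightarrow> ('x set \<times> 'm) set \<Rightarrow> ('x set \<times> 'm) set" where
  "germ_smult X \<O> \<M> x U r g = (\<Union>(V, s)\<in>g.
     germ X \<M> x (U \<inter> V) (restr \<O> U (U \<inter> V) r \<odot>\<^bsub>sections \<M> (U \<inter> V)\<^esub> restr \<M> V (U \<inter> V) s))"

definition sheafification ::
  "'x topology \<Rightarrow> ('x, 's, 'r) presheaf \<Rightarrow> ('x, 's, 'm) module_presheaf
    \<Rightarrow> ('x, 's, 'x \<Rightarrow> ('x set \<times> 'm) set) module_presheaf" where
  "sheafification X \<O> \<M> = \<lparr>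
     sections = (\<lambda>U. \<lparr>
       carrier = {\<sigma> \<in> extensional U. \<forall>x\<in>U. \<exists>V s. openin X V \<and> x \<in> V \<and> V \<subseteq> U \<and>
         s \<in> carrier (sections \<M> V) \<and> (\<forall>y\<in>V. \<sigma> y = germ X \<M> y V s)},
       monoid.mult = undefined, one = undefined,
       ring.zero = (\<lambda>x\<in>U. germ X \<M> x U \<zero>\<^bsub>sections \<M> U\<^esub>),
       ring.add = (\<lambda>\<sigma> \<tau>. \<lambda>x\<in>U. germ_add X \<M> x (\<sigma> x) (\<tau> x)),
       smult = (\<lambda>r \<sigma>. \<lambda>x\<in>U. germ_smult X \<O> \<M> x U r (\<sigma> x))\<rparr>),
     restr = (\<lambda>U V \<sigma>. restrict \<sigma> V)\<rparr>"

definition tensor_sheaf ::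
  "'x topology \<Rightarrow> ('x, 's, 'r) presheaf \<Rightarrow> ('x, 's, 'm) module_presheaf \<Rightarrow> ('x, 's, 'n) module_presheaf
    \<Rightarrow> ('x, 's, 'x \<Rightarrow> ('x set \<times> ('m \<times> 'n \<Rightarrow>\<^sub>0 int) set) set) module_presheaf" where
  "tensor_sheaf X \<O> \<M> \<N> = sheafification X \<O> (tensor_presheaf \<O> \<M> \<N>)"

end

theory Submission
  imports Defs
begin

text \<open>
  By pseudoregularity, a good frame satisfies \<open>\<alpha>\<^sup>2 = b\<alpha> - ac\<close>. For a unital pair this gives
  \<open>r\<^sup>2 = ac + b'r - a'c'\<close>, so a prime ideal containing \<open>a, b, c, a', b', c'\<close> also contains \<open>r\<close>.
  Coprimitivity therefore means that at every point \<open>x\<close> the coefficients of one of the two frames, say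
  \<open>a, b, c\<close>, do not all vanish. Then the quadratic form \<open>ay\<^sup>2 + byz + cz\<^sup>2\<close> takes a value that is
  invertible near \<open>x\<close>, and as it is up to sign the determinant of \<open>e, \<alpha>e\<close> for \<open>e = ye\<^sub>1 + ze\<^sub>2\<close>,
  the module \<open>\<I>\<close> is freely generated by \<open>e\<close> over \<open>\<O>\<^sub>Y\<close> near \<open>x\<close>. Hence \<open>\<I> \<otimes> \<I>'\<close> is isomorphic to
  \<open>\<I>'\<close> near \<open>x\<close>. So the tensor product is everywhere locally isomorphic to one of its two factors,
  and pseudoregularity is a local property, characteristic polynomials being independent of the basis.
\<close>

section \<open>Bases and characteristic polynomials of modules of rank 2\<close>

text \<open>Pseudoregularity is tested on all affine opens, whereas the frames live on one cover.
  The bridge is that trace and determinant of an endomorphism do not depend on the basis: they glue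
  to sections over any open set, so the definite description \<open>charpoly\<close> denotes a
  polynomial that can be verified on small opens. The polynomial on the tensor product is never
  computed; near each point the polynomial of \<alpha> on \<O>Y is carried over from \<I> or \<I>',
  for which the equality is an assumption. The argument at a point needs a prime of the ring of
  sections over U whose complement becomes invertible near the point. It is built from the
  isomorphism of U with a spectrum, as the sections whose value at the point has a numerator in the
  prime of that point. The tensor product is the sheafification of a presheaf of cosets. Where one
  factor is free on e, the map n to e \<otimes> n is an isomorphism from a sheaf onto that presheaf,
  so sheafifying changes nothing there. Every point has such a neighbourhood, so sections of the
  sheafification need no further description.\<close>

abbreviation (input) "\<Gamma> F U \<equiv> carrier (sections F U)"

abbreviation (input) "lin_comb M r x s y \<equiv> r \<odot>\<^bsub>M\<^esub> x \<oplus>\<^bsub>M\<^esub> s \<odot>\<^bsub>M\<^esub> y"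

abbreviation (input) "free_generator S M e \<equiv> bij_betw (\<lambda>s. s \<odot>\<^bsub>M\<^esub> e) (carrier S) (carrier M)"

abbreviation (input) "mult_endo \<A> U \<alpha> \<equiv> \<lambda>V s. restr \<A> U V \<alpha> \<otimes>\<^bsub>sections \<A> V\<^esub> s"

abbreviation (input) "smult_endo \<A> \<M> U \<alpha> \<equiv> \<lambda>V m. restr \<A> U V \<alpha> \<odot>\<^bsub>sections \<M> V\<^esub> m"

section \<open>Identities with subtraction, and traces and determinants of 2 by 2 matrices\<close>

lemma (in ring) diff_add_eq:
  "\<lbrakk>a \<in> carrier R; b \<in> carrier R; c \<in> carrier R\<rbrakk> \<Longrightarrow> (a \<ominus> b) \<oplus> c = (a \<oplus> c) \<ominus> b"
  "\<lbrakk>a \<in> carrier R; b \<in> carrier R; c \<in> carrier R\<rbrakk> \<Longrightarrow> c \<oplus> (a \<ominus> b) = (c \<oplus> a) \<ominus> b"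
  "\<lbrakk>a \<in> carrier R; b \<in> carrier R; c \<in> carrier R\<rbrakk> \<Longrightarrow> (a \<ominus> b) \<ominus> c = a \<ominus> (b \<oplus> c)"
  "\<lbrakk>a \<in> carrier R; b \<in> carrier R; c \<in> carrier R\<rbrakk> \<Longrightarrow> a \<ominus> (b \<ominus> c) = (a \<oplus> c) \<ominus> b"
  by (simp_all add: a_minus_def minus_add a_ac)

lemma (in ring) mult_diff_distrib:
  "\<lbrakk>a \<in> carrier R; b \<in> carrier R; c \<in> carrier R\<rbrakk> \<Longrightarrow> (a \<ominus> b) \<otimes> c = a \<otimes> c \<ominus> b \<otimes> c"
  "\<lbrakk>a \<in> carrier R; b \<in> carrier R; c \<in> carrier R\<rbrakk> \<Longrightarrow> c \<otimes> (a \<ominus> b) = c \<otimes> a \<ominus> c \<otimes> b"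
  by (simp_all add: a_minus_def l_distr r_distr l_minus r_minus)

lemma (in ring) minus_eq_diff:
  "\<lbrakk>a \<in> carrier R; b \<in> carrier R\<rbrakk> \<Longrightarrow> (\<ominus> a) \<oplus> b = b \<ominus> a"
  "\<lbrakk>a \<in> carrier R; b \<in> carrier R\<rbrakk> \<Longrightarrow> b \<oplus> (\<ominus> a) = b \<ominus> a"
  "\<lbrakk>a \<in> carrier R; b \<in> carrier R\<rbrakk> \<Longrightarrow> \<ominus> (a \<ominus> b) = b \<ominus> a"
  "\<lbrakk>a \<in> carrier R; b \<in> carrier R\<rbrakk> \<Longrightarrow> b \<ominus> (\<ominus> a) = b \<oplus> a"
  "\<lbrakk>a \<in> carrier R; b \<in> carrier R\<rbrakk> \<Longrightarrow> (\<ominus> a) \<ominus> b = \<ominus> (a \<oplus> b)"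
  by (simp_all add: a_minus_def minus_add a_ac)

lemma (in ring) diff_eq_iff:
  assumes "a \<in> carrier R" "b \<in> carrier R" "c \<in> carrier R"
  shows "a \<ominus> b = c \<longleftrightarrow> a = c \<oplus> b" and "c = a \<ominus> b \<longleftrightarrow> c \<oplus> b = a"
  using assms by (auto simp: a_minus_def a_assoc l_neg r_neg)

lemma (in ring) minus_eq_iff:
  assumes "a \<in> carrier R" "c \<in> carrier R"
  shows "\<ominus> a = c \<longleftrightarrow> \<zero> = c \<oplus> a" and "c = \<ominus> a \<longleftrightarrow> c \<oplus> a = \<zero>"
  using assms by (auto simp: l_neg minus_equality)

context cring begin

text \<open>These rules collect the negative terms of an identity and move them across the equation, so that
  a semiring identity remains, which rewriting modulo associativity and commutativity decides.\<close>

lemmas ring_diff_simps = diff_add_eq mult_diff_distrib minus_eq_diff diff_eq_iff minus_eq_iff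
  l_distr r_distr l_minus r_minus m_ac a_ac

end

text \<open>Let \<open>A\<close> have rows a, b and c, d, and let \<open>P\<close> have columns (x,
  y) and (z, w). The right side is the trace of \<open>A P adj(P)\<close>, and
  \<open>P adj(P)\<close> is the scalar det P. Multiplying by det P instead of inverting
  \<open>P\<close> keeps the identity polynomial.\<close>

lemma (in cring) trace_conjugate:
  assumes [simp]: "a \<in> carrier R" "b \<in> carrier R" "c \<in> carrier R" "d \<in> carrier R"
    "x \<in> carrier R" "y \<in> carrier R" "z \<in> carrier R" "w \<in> carrier R"
  shows "(a \<oplus> d) \<otimes> (x \<otimes> w \<ominus> y \<otimes> z) =
    (w \<otimes> (a \<otimes> x \<oplus> b \<otimes> y) \<oplus> x \<otimes> (c \<otimes> z \<oplus> d \<otimes> w)) \<ominus>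
    (z \<otimes> (c \<otimes> x \<oplus> d \<otimes> y) \<oplus> y \<otimes> (a \<otimes> z \<oplus> b \<otimes> w))"
  by (simp add: ring_diff_simps)

text \<open>The same with the matrices in the other order: the right side is the trace of
  \<open>adj(P) P A\<close>, so that the entries of \<open>P A\<close> occur.\<close>

lemma (in cring) trace_conjugate':
  assumes [simp]: "a \<in> carrier R" "b \<in> carrier R" "c \<in> carrier R" "d \<in> carrier R"
    "x \<in> carrier R" "y \<in> carrier R" "z \<in> carrier R" "w \<in> carrier R"
  shows "(a \<oplus> d) \<otimes> (x \<otimes> w \<ominus> y \<otimes> z) =
    (w \<otimes> (a \<otimes> x \<oplus> c \<otimes> z) \<oplus> x \<otimes> (b \<otimes> y \<oplus> d \<otimes> w)) \<ominus>
    (z \<otimes> (a \<otimes> y \<oplus> c \<otimes> w) \<oplus> y \<otimes> (b \<otimes> x \<oplus> d \<otimes> z))"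
  by (simp add: ring_diff_simps)

text \<open>Multiplicativity of the determinant for the product \<open>A P\<close>; the primed
  version that follows is written with the entries of \<open>P A\<close>.\<close>

lemma (in cring) det_mult:
  assumes [simp]: "a \<in> carrier R" "b \<in> carrier R" "c \<in> carrier R" "d \<in> carrier R"
    "x \<in> carrier R" "y \<in> carrier R" "z \<in> carrier R" "w \<in> carrier R"
  shows "(a \<otimes> d \<ominus> b \<otimes> c) \<otimes> (x \<otimes> w \<ominus> y \<otimes> z) =
    (a \<otimes> x \<oplus> b \<otimes> y) \<otimes> (c \<otimes> z \<oplus> d \<otimes> w) \<ominus> (a \<otimes> z \<oplus> b \<otimes> w) \<otimes> (c \<otimes> x \<oplus> d \<otimes> y)"
  by (simp add: ring_diff_simps)

lemma (in cring) det_mult':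
  assumes [simp]: "a \<in> carrier R" "b \<in> carrier R" "c \<in> carrier R" "d \<in> carrier R"
    "x \<in> carrier R" "y \<in> carrier R" "z \<in> carrier R" "w \<in> carrier R"
  shows "(a \<otimes> d \<ominus> b \<otimes> c) \<otimes> (x \<otimes> w \<ominus> y \<otimes> z) =
    (a \<otimes> x \<oplus> c \<otimes> z) \<otimes> (b \<otimes> y \<oplus> d \<otimes> w) \<ominus> (b \<otimes> x \<oplus> d \<otimes> z) \<otimes> (a \<otimes> y \<oplus> c \<otimes> w)"
  by (simp add: ring_diff_simps)

lemma (in cring) unit_cancel:
  assumes "u \<in> Units R" "a \<in> carrier R" "b \<in> carrier R" "a \<otimes> u = b \<otimes> u"
  shows "a = b"
  using assms by (metis Units_closed Units_l_cancel m_comm)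

text \<open>The assumption \<open>eq\<close> is \<open>A P = P A'\<close>, entry by entry. Trace and
  determinant times det P can both be computed from this common product, and the unit det P cancels;
  the inverse of \<open>P\<close> is never formed.\<close>

lemma (in cring) conjugate_trace_det_eq:
  assumes [simp]: "a \<in> carrier R" "b \<in> carrier R" "c \<in> carrier R" "d \<in> carrier R"
    "a' \<in> carrier R" "b' \<in> carrier R" "c' \<in> carrier R" "d' \<in> carrier R"
    "x \<in> carrier R" "y \<in> carrier R" "z \<in> carrier R" "w \<in> carrier R"
    and eq: "a \<otimes> x \<oplus> b \<otimes> y = a' \<otimes> x \<oplus> c' \<otimes> z" "c \<otimes> x \<oplus> d \<otimes> y = a' \<otimes> y \<oplus> c' \<otimes> w"
      "a \<otimes> z \<oplus> b \<otimes> w = b' \<otimes> x \<oplus> d' \<otimes> z" "c \<otimes> z \<oplus> d \<otimes> w = b' \<otimes> y \<oplus> d' \<otimes> w"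
    and unit: "x \<otimes> w \<ominus> y \<otimes> z \<in> Units R"
  shows "a \<oplus> d = a' \<oplus> d'" "a \<otimes> d \<ominus> b \<otimes> c = a' \<otimes> d' \<ominus> b' \<otimes> c'"
proof -
  have "(a \<oplus> d) \<otimes> (x \<otimes> w \<ominus> y \<otimes> z) = (a' \<oplus> d') \<otimes> (x \<otimes> w \<ominus> y \<otimes> z)"
    using trace_conjugate[of a b c d x y z w] trace_conjugate'[of a' b' c' d' x y z w] eq by simp
  then show "a \<oplus> d = a' \<oplus> d'"
    using unit_cancel[OF unit] by simp
  have "(a \<otimes> d \<ominus> b \<otimes> c) \<otimes> (x \<otimes> w \<ominus> y \<otimes> z) = (a' \<otimes> d' \<ominus> b' \<otimes> c') \<otimes> (x \<otimes> w \<ominus> y \<otimes> z)"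
    using det_mult[of a b c d x y z w] det_mult'[of a' b' c' d' x y z w] eq by simp
  then show "a \<otimes> d \<ominus> b \<otimes> c = a' \<otimes> d' \<ominus> b' \<otimes> c'"
    using unit_cancel[OF unit] by simp
qed

section \<open>The polynomial T^2 - tT + n as a coefficient function\<close>

definition quad_poly :: "('a, 'r) ring_scheme \<Rightarrow> 'a \<Rightarrow> 'a \<Rightarrow> nat \<Rightarrow> 'a" where
  "quad_poly R t n = (\<lambda>k. if k = 0 then n else if k = 1 then \<ominus>\<^bsub>R\<^esub> t else if k = 2 then \<one>\<^bsub>R\<^esub> else \<zero>\<^bsub>R\<^esub>)"

lemma (in ring) quad_poly_inject:
  assumes "quad_poly R t n = quad_poly R t' n'" "t \<in> carrier R" "t' \<in> carrier R"
  shows "t = t'" "n = n'"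
proof -
  show "n = n'" using fun_cong[OF assms(1), of 0] by (simp add: quad_poly_def)
  have "\<ominus> t = \<ominus> t'" using fun_cong[OF assms(1), of 1] by (simp add: quad_poly_def)
  then show "t = t'" using assms by (metis minus_minus)
qed

lemma (in ring) quad_poly_closed:
  "\<lbrakk>t \<in> carrier R; n \<in> carrier R\<rbrakk> \<Longrightarrow> quad_poly R t n \<in> carrier (UP R)"
  unfolding UP_def quad_poly_def up_def by (auto intro!: exI[of _ 2] bound.intro)

lemma quad_poly_hom:
  assumes "ring R" "ring S" "h \<in> ring_hom R S" "t \<in> carrier R"
  shows "h \<circ> quad_poly R t n = quad_poly S (h t) (h n)"
proof -
  interpret ring_hom_ring R S h
    using assms by (intro ring_hom_ringI2)
  show ?thesis using assms(4) by (auto simp: quad_poly_def fun_eq_iff)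
qed

text \<open>Expanding (T - a)(T - d) - bc in \<open>UP R\<close> leaves monomials of degrees 2, 1
  and 0. As an element of the carrier of \<open>UP R\<close> is its own coefficient function, the
  coefficients can be read off argument by argument.\<close>

lemma (in cring) charpoly_matrix2_eq:
  assumes [simp]: "a \<in> carrier R" "b \<in> carrier R" "c \<in> carrier R" "d \<in> carrier R"
  shows "charpoly_matrix2 R a b c d = quad_poly R (a \<oplus> d) (a \<otimes> d \<ominus> b \<otimes> c)"
proof -
  interpret P: UP_cring R "UP R" by unfold_locales simp
  let ?m = "monom (UP R)"
  have "charpoly_matrix2 R a b c d =
      (?m \<one> 2 \<oplus>\<^bsub>UP R\<^esub> ?m (a \<otimes> d) 0) \<ominus>\<^bsub>UP R\<^esub> (?m (a \<oplus> d) 1 \<oplus>\<^bsub>UP R\<^esub> ?m (b \<otimes> c) 0)"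
    unfolding charpoly_matrix2_def Let_def
    by (simp add: P.P.ring_diff_simps flip: P.monom_mult) (simp add: numeral_2_eq_2)
  moreover have "p = coeff (UP R) p" if "p \<in> carrier (UP R)" for p
    using that by (simp add: UP_def)
  ultimately have "charpoly_matrix2 R a b c d = coeff (UP R)
      ((?m \<one> 2 \<oplus>\<^bsub>UP R\<^esub> ?m (a \<otimes> d) 0) \<ominus>\<^bsub>UP R\<^esub> (?m (a \<oplus> d) 1 \<oplus>\<^bsub>UP R\<^esub> ?m (b \<otimes> c) 0))"
    by auto
  also have "\<dots> = quad_poly R (a \<oplus> d) (a \<otimes> d \<ominus> b \<otimes> c)"
    by (auto simp: quad_poly_def fun_eq_iff) (simp_all add: a_minus_def minus_add)
  finally show ?thesis .
qed

text \<open>Keeps trace and determinant as two ring elements, because over a cover it is these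
  sections, rather than polynomials, that are glued.\<close>

definition trace_det ::
  "('a, 'r) ring_scheme \<Rightarrow> ('a, 'm, 'z) module_scheme \<Rightarrow> 'm \<Rightarrow> 'm \<Rightarrow> ('m \<Rightarrow> 'm) \<Rightarrow> 'a \<Rightarrow> 'a \<Rightarrow> bool"
where
  "trace_det R M e1 e2 \<phi> t n \<longleftrightarrow>
     (\<exists>a\<in>carrier R. \<exists>b\<in>carrier R. \<exists>c\<in>carrier R. \<exists>d\<in>carrier R.
        \<phi> e1 = lin_comb M a e1 c e2 \<and>
        \<phi> e2 = lin_comb M b e1 d e2 \<and>
        t = a \<oplus>\<^bsub>R\<^esub> d \<and> n = a \<otimes>\<^bsub>R\<^esub> d \<ominus>\<^bsub>R\<^esub> b \<otimes>\<^bsub>R\<^esub> c)"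

lemma (in cring) is_charpoly_wrt_iff:
  "is_charpoly_wrt R M e1 e2 \<phi> p \<longleftrightarrow> (\<exists>t n. trace_det R M e1 e2 \<phi> t n \<and> p = quad_poly R t n)"
proof
  assume "is_charpoly_wrt R M e1 e2 \<phi> p"
  then obtain a b c d where *: "a \<in> carrier R" "b \<in> carrier R" "c \<in> carrier R" "d \<in> carrier R"
      "\<phi> e1 = lin_comb M a e1 c e2" "\<phi> e2 = lin_comb M b e1 d e2"
      "p = charpoly_matrix2 R a b c d"
    unfolding is_charpoly_wrt_def by blast
  then have "trace_det R M e1 e2 \<phi> (a \<oplus> d) (a \<otimes> d \<ominus> b \<otimes> c)"
    unfolding trace_det_def by blast
  with * show "\<exists>t n. trace_det R M e1 e2 \<phi> t n \<and> p = quad_poly R t n"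
    using charpoly_matrix2_eq by blast
next
  assume "\<exists>t n. trace_det R M e1 e2 \<phi> t n \<and> p = quad_poly R t n"
  then obtain a b c d where *: "a \<in> carrier R" "b \<in> carrier R" "c \<in> carrier R" "d \<in> carrier R"
      "\<phi> e1 = lin_comb M a e1 c e2" "\<phi> e2 = lin_comb M b e1 d e2"
      "p = quad_poly R (a \<oplus> d) (a \<otimes> d \<ominus> b \<otimes> c)"
    unfolding trace_det_def by blast
  then show "is_charpoly_wrt R M e1 e2 \<phi> p"
    unfolding is_charpoly_wrt_def using charpoly_matrix2_eq[of a b c d] by metis
qed

lemma (in cring) trace_det_closed:
  "trace_det R M e1 e2 \<phi> t n \<Longrightarrow> t \<in> carrier R" "trace_det R M e1 e2 \<phi> t n \<Longrightarrow> n \<in> carrier R"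
  unfolding trace_det_def by auto

section \<open>Change of basis in a module of rank 2\<close>

context module
begin

lemma basis2_closed:
  "basis2 R M e1 e2 \<Longrightarrow> e1 \<in> carrier M" "basis2 R M e1 e2 \<Longrightarrow> e2 \<in> carrier M"
  by (simp_all add: basis2_def)

lemma basis2_obtain:
  assumes "basis2 R M e1 e2" "m \<in> carrier M"
  obtains r s where "r \<in> carrier R" "s \<in> carrier R" "m = lin_comb M r e1 s e2"
  using assms unfolding basis2_def by blast

lemma basis2_unique:
  assumes "basis2 R M e1 e2" "r \<in> carrier R" "s \<in> carrier R" "r' \<in> carrier R" "s' \<in> carrier R"
    "lin_comb M r e1 s e2 = lin_comb M r' e1 s' e2"
  shows "r = r'" "s = s'"
proof -
  have "lin_comb M r e1 s e2 \<in> carrier M"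
    using assms by (simp add: basis2_def)
  then have "\<exists>!(u, v). u \<in> carrier R \<and> v \<in> carrier R \<and>
      r \<odot>\<^bsub>M\<^esub> e1 \<oplus>\<^bsub>M\<^esub> s \<odot>\<^bsub>M\<^esub> e2 = lin_comb M u e1 v e2"
    using assms(1) by (simp add: basis2_def)
  from ex1E[OF this] obtain p where
    "\<And>q. (case q of (u, v) \<Rightarrow> u \<in> carrier R \<and> v \<in> carrier R \<and>
      r \<odot>\<^bsub>M\<^esub> e1 \<oplus>\<^bsub>M\<^esub> s \<odot>\<^bsub>M\<^esub> e2 = lin_comb M u e1 v e2) \<Longrightarrow> q = p"
    by blast
  from this[of "(r, s)"] this[of "(r', s')"] have "(r, s) = (r', s')"
    using assms(2-6) by simp
  then show "r = r'" "s = s'" by auto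
qed

lemma basis2I:
  assumes "e1 \<in> carrier M" "e2 \<in> carrier M"
    and "\<And>m. m \<in> carrier M \<Longrightarrow> \<exists>r s. r \<in> carrier R \<and> s \<in> carrier R \<and> m = lin_comb M r e1 s e2"
    and "\<And>r s r' s'. \<lbrakk>r \<in> carrier R; s \<in> carrier R; r' \<in> carrier R; s' \<in> carrier R;
        r \<odot>\<^bsub>M\<^esub> e1 \<oplus>\<^bsub>M\<^esub> s \<odot>\<^bsub>M\<^esub> e2 = lin_comb M r' e1 s' e2\<rbrakk> \<Longrightarrow> r = r' \<and> s = s'"
  shows "basis2 R M e1 e2"
  unfolding basis2_def
proof (intro conjI ballI)
  fix m assume "m \<in> carrier M"
  then obtain r s where rs: "r \<in> carrier R" "s \<in> carrier R" "m = lin_comb M r e1 s e2"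
    using assms(3) by blast
  show "\<exists>!(r, s). r \<in> carrier R \<and> s \<in> carrier R \<and> m = lin_comb M r e1 s e2"
  proof (rule ex1I[of _ "(r, s)"])
    fix p assume "case p of (r, s) \<Rightarrow> r \<in> carrier R \<and> s \<in> carrier R \<and> m = lin_comb M r e1 s e2"
    then show "p = (r, s)" using assms(4) rs by (cases p) auto
  qed (use rs in simp)
qed (use assms in auto)

lemma lin_comb_add:
  assumes "e1 \<in> carrier M" "e2 \<in> carrier M"
    "r \<in> carrier R" "s \<in> carrier R" "r' \<in> carrier R" "s' \<in> carrier R"
  shows "(lin_comb M r e1 s e2) \<oplus>\<^bsub>M\<^esub> (lin_comb M r' e1 s' e2) =
    lin_comb M (r \<oplus> r') e1 (s \<oplus> s') e2"
  using assms by (simp add: smult_l_distr M.a_ac)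

lemma lin_comb_lin_comb:
  assumes "e1 \<in> carrier M" "e2 \<in> carrier M" "x \<in> carrier R" "y \<in> carrier R" "z \<in> carrier R"
    "w \<in> carrier R" "r \<in> carrier R" "s \<in> carrier R"
  shows "lin_comb M r (lin_comb M x e1 y e2) s (lin_comb M z e1 w e2) =
    lin_comb M (r \<otimes> x \<oplus> s \<otimes> z) e1 (r \<otimes> y \<oplus> s \<otimes> w) e2"
  using assms by (simp add: smult_l_distr smult_r_distr smult_assoc1 M.a_ac)

text \<open>Cramer's rule: coordinates in the new pair are given by the adjugate of the transition
  matrix divided by its determinant, which is a unit.\<close>

lemma basis2_change:
  assumes e: "basis2 R M e1 e2"
    and [simp]: "x \<in> carrier R" "y \<in> carrier R" "z \<in> carrier R" "w \<in> carrier R"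
    and unit: "x \<otimes> w \<ominus> y \<otimes> z \<in> Units R"
  shows "basis2 R M (lin_comb M x e1 y e2) (lin_comb M z e1 w e2)"
proof (rule basis2I)
  note [simp] = basis2_closed[OF e]
  define D where "D = x \<otimes> w \<ominus> y \<otimes> z"
  have D[simp]: "D \<in> carrier R" "inv D \<in> carrier R" "inv D \<otimes> D = \<one>"
    using unit by (auto simp: D_def)
  fix m assume "m \<in> carrier M"
  then obtain r s where rs[simp]: "r \<in> carrier R" "s \<in> carrier R" and m: "m = lin_comb M r e1 s e2"
    using basis2_obtain[OF e] by blast
  \<comment> \<open>The adjugate applied to the old coordinates r, s of m, followed by the
    transition matrix itself, multiplies r and s by the determinant.\<close>
  have 1: "(w \<otimes> r \<ominus> z \<otimes> s) \<otimes> x \<oplus> (x \<otimes> s \<ominus> y \<otimes> r) \<otimes> z = D \<otimes> r"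
    "(w \<otimes> r \<ominus> z \<otimes> s) \<otimes> y \<oplus> (x \<otimes> s \<ominus> y \<otimes> r) \<otimes> w = D \<otimes> s"
    by (simp_all add: D_def ring_diff_simps)
  have "(inv D \<otimes> (w \<otimes> r \<ominus> z \<otimes> s)) \<otimes> x \<oplus> (inv D \<otimes> (x \<otimes> s \<ominus> y \<otimes> r)) \<otimes> z = inv D \<otimes> (D \<otimes> r)"
    "(inv D \<otimes> (w \<otimes> r \<ominus> z \<otimes> s)) \<otimes> y \<oplus> (inv D \<otimes> (x \<otimes> s \<ominus> y \<otimes> r)) \<otimes> w = inv D \<otimes> (D \<otimes> s)"
    unfolding 1[symmetric] by (simp_all add: m_assoc r_distr del: mult_diff_distrib)
  then show "\<exists>r s. r \<in> carrier R \<and> s \<in> carrier R \<and>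
      m = lin_comb M r (lin_comb M x e1 y e2) s (lin_comb M z e1 w e2)"
    by (intro exI[of _ "inv D \<otimes> (w \<otimes> r \<ominus> z \<otimes> s)"] exI[of _ "inv D \<otimes> (x \<otimes> s \<ominus> y \<otimes> r)"])
      (simp add: lin_comb_lin_comb m flip: m_assoc)
next
  note [simp] = basis2_closed[OF e]
  fix r s r' s' assume [simp]: "r \<in> carrier R" "s \<in> carrier R" "r' \<in> carrier R" "s' \<in> carrier R"
    and eq: "lin_comb M r (lin_comb M x e1 y e2) s (lin_comb M z e1 w e2) =
      lin_comb M r' (lin_comb M x e1 y e2) s' (lin_comb M z e1 w e2)"
  have eqs: "r \<otimes> x \<oplus> s \<otimes> z = r' \<otimes> x \<oplus> s' \<otimes> z" "r \<otimes> y \<oplus> s \<otimes> w = r' \<otimes> y \<oplus> s' \<otimes> w"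
    using eq basis2_unique[OF e, of "r \<otimes> x \<oplus> s \<otimes> z" "r \<otimes> y \<oplus> s \<otimes> w" "r' \<otimes> x \<oplus> s' \<otimes> z" "r' \<otimes> y \<oplus> s' \<otimes> w"]
    by (simp_all add: lin_comb_lin_comb)
  \<comment> \<open>Conversely, the adjugate recovers u and v, up to the determinant, from the old
    coordinates of the combination; cancelling the unit gives uniqueness.\<close>
  have *: "u \<otimes> (x \<otimes> w \<ominus> y \<otimes> z) = w \<otimes> (u \<otimes> x \<oplus> v \<otimes> z) \<ominus> z \<otimes> (u \<otimes> y \<oplus> v \<otimes> w)"
    "v \<otimes> (x \<otimes> w \<ominus> y \<otimes> z) = x \<otimes> (u \<otimes> y \<oplus> v \<otimes> w) \<ominus> y \<otimes> (u \<otimes> x \<oplus> v \<otimes> z)"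
    if [simp]: "u \<in> carrier R" "v \<in> carrier R" for u v
    by (simp_all add: ring_diff_simps)
  have "r \<otimes> (x \<otimes> w \<ominus> y \<otimes> z) = r' \<otimes> (x \<otimes> w \<ominus> y \<otimes> z)"
    "s \<otimes> (x \<otimes> w \<ominus> y \<otimes> z) = s' \<otimes> (x \<otimes> w \<ominus> y \<otimes> z)"
    using *[of r s] *[of r' s'] eqs by simp_all
  then show "r = r' \<and> s = s'"
    using unit_cancel[OF unit] by simp
qed (use basis2_closed[OF e] in auto)

text \<open>Expanding each basis in the other and comparing with the coordinates (1, 0) and (0, 1)
  shows that the two transition matrices multiply to the identity. Their determinants then multiply
  to 1.\<close>

lemma basis2_obtain_change:
  assumes e: "basis2 R M e1 e2" and f: "basis2 R M f1 f2"
  obtains x y z w where "x \<in> carrier R" "y \<in> carrier R" "z \<in> carrier R" "w \<in> carrier R"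
    "f1 = lin_comb M x e1 y e2" "f2 = lin_comb M z e1 w e2"
    "x \<otimes> w \<ominus> y \<otimes> z \<in> Units R"
proof -
  note [simp] = basis2_closed[OF e] basis2_closed[OF f]
  obtain x y where [simp]: "x \<in> carrier R" "y \<in> carrier R" and f1: "f1 = lin_comb M x e1 y e2"
    using basis2_obtain[OF e, of f1] by auto
  obtain z w where [simp]: "z \<in> carrier R" "w \<in> carrier R" and f2: "f2 = lin_comb M z e1 w e2"
    using basis2_obtain[OF e, of f2] by auto
  obtain x' y' where [simp]: "x' \<in> carrier R" "y' \<in> carrier R" and e1: "e1 = lin_comb M x' f1 y' f2"
    using basis2_obtain[OF f, of e1] by auto
  obtain z' w' where [simp]: "z' \<in> carrier R" "w' \<in> carrier R" and e2: "e2 = lin_comb M z' f1 w' f2"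
    using basis2_obtain[OF f, of e2] by auto
  have "lin_comb M (x' \<otimes> x \<oplus> y' \<otimes> z) e1 (x' \<otimes> y \<oplus> y' \<otimes> w) e2 = lin_comb M \<one> e1 \<zero> e2"
    using e1 unfolding f1 f2 by (simp add: lin_comb_lin_comb)
  then have 1: "x' \<otimes> x \<oplus> y' \<otimes> z = \<one>" "x' \<otimes> y \<oplus> y' \<otimes> w = \<zero>"
    using basis2_unique[OF e, of "x' \<otimes> x \<oplus> y' \<otimes> z" "x' \<otimes> y \<oplus> y' \<otimes> w" \<one> \<zero>] by auto
  have "lin_comb M (z' \<otimes> x \<oplus> w' \<otimes> z) e1 (z' \<otimes> y \<oplus> w' \<otimes> w) e2 = lin_comb M \<zero> e1 \<one> e2"
    using e2 unfolding f1 f2 by (simp add: lin_comb_lin_comb)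
  then have 2: "z' \<otimes> x \<oplus> w' \<otimes> z = \<zero>" "z' \<otimes> y \<oplus> w' \<otimes> w = \<one>"
    using basis2_unique[OF e, of "z' \<otimes> x \<oplus> w' \<otimes> z" "z' \<otimes> y \<oplus> w' \<otimes> w" \<zero> \<one>] by auto
  have "(x' \<otimes> w' \<ominus> y' \<otimes> z') \<otimes> (x \<otimes> w \<ominus> y \<otimes> z) =
    (x' \<otimes> x \<oplus> y' \<otimes> z) \<otimes> (z' \<otimes> y \<oplus> w' \<otimes> w) \<ominus> (x' \<otimes> y \<oplus> y' \<otimes> w) \<otimes> (z' \<otimes> x \<oplus> w' \<otimes> z)"
    by (simp add: ring_diff_simps)
  also have "\<dots> = \<one>" by (simp add: 1 2 a_minus_def)
  finally have "x \<otimes> w \<ominus> y \<otimes> z \<in> Units R"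
    unfolding Units_def by (auto simp: m_comm intro!: bexI[of _ "x' \<otimes> w' \<ominus> y' \<otimes> z'"])
  from that[OF _ _ _ _ f1 f2 this] show ?thesis by simp
qed

lemma trace_det_exists:
  assumes "basis2 R M e1 e2" "\<phi> e1 \<in> carrier M" "\<phi> e2 \<in> carrier M"
  shows "\<exists>t n. trace_det R M e1 e2 \<phi> t n"
  using basis2_obtain[OF assms(1,2)] basis2_obtain[OF assms(1,3)] unfolding trace_det_def by metis

text \<open>Expressing \<phi> f1 and \<phi> f2 in the basis e1, e2 in two ways gives
  \<open>A P = P A'\<close> for the transition matrix \<open>P\<close>. With both bases equal, the
  lemma also yields uniqueness for a single basis.\<close>

lemma trace_det_unique:
  assumes e: "basis2 R M e1 e2" and f: "basis2 R M f1 f2"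
    and add: "\<And>m m'. \<lbrakk>m \<in> carrier M; m' \<in> carrier M\<rbrakk> \<Longrightarrow> \<phi> (m \<oplus>\<^bsub>M\<^esub> m') = \<phi> m \<oplus>\<^bsub>M\<^esub> \<phi> m'"
    and smult: "\<And>r m. \<lbrakk>r \<in> carrier R; m \<in> carrier M\<rbrakk> \<Longrightarrow> \<phi> (r \<odot>\<^bsub>M\<^esub> m) = r \<odot>\<^bsub>M\<^esub> \<phi> m"
    and tde: "trace_det R M e1 e2 \<phi> t n" and tdf: "trace_det R M f1 f2 \<phi> t' n'"
  shows "t = t'" "n = n'"
proof -
  note [simp] = basis2_closed[OF e] basis2_closed[OF f]
  obtain a b c d where [simp]: "a \<in> carrier R" "b \<in> carrier R" "c \<in> carrier R" "d \<in> carrier R"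
    and \<phi>e: "\<phi> e1 = lin_comb M a e1 c e2" "\<phi> e2 = lin_comb M b e1 d e2"
    and tn: "t = a \<oplus> d" "n = a \<otimes> d \<ominus> b \<otimes> c"
    using tde unfolding trace_det_def by blast
  obtain a' b' c' d' where [simp]: "a' \<in> carrier R" "b' \<in> carrier R" "c' \<in> carrier R" "d' \<in> carrier R"
    and \<phi>f: "\<phi> f1 = lin_comb M a' f1 c' f2" "\<phi> f2 = lin_comb M b' f1 d' f2"
    and tn': "t' = a' \<oplus> d'" "n' = a' \<otimes> d' \<ominus> b' \<otimes> c'"
    using tdf unfolding trace_det_def by blast
  obtain x y z w where [simp]: "x \<in> carrier R" "y \<in> carrier R" "z \<in> carrier R" "w \<in> carrier R"
    and f1: "f1 = lin_comb M x e1 y e2" and f2: "f2 = lin_comb M z e1 w e2"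
    and unit: "x \<otimes> w \<ominus> y \<otimes> z \<in> Units R"
    using basis2_obtain_change[OF e f] by metis
  have \<phi>lin: "\<phi> (lin_comb M r e1 s e2) = lin_comb M (a \<otimes> r \<oplus> b \<otimes> s) e1 (c \<otimes> r \<oplus> d \<otimes> s) e2"
    if "r \<in> carrier R" "s \<in> carrier R" for r s
    using that by (simp add: add smult \<phi>e lin_comb_lin_comb m_comm)
  have "lin_comb M (a \<otimes> x \<oplus> b \<otimes> y) e1 (c \<otimes> x \<oplus> d \<otimes> y) e2 =
      lin_comb M (a' \<otimes> x \<oplus> c' \<otimes> z) e1 (a' \<otimes> y \<oplus> c' \<otimes> w) e2"
    using \<phi>f(1) unfolding f1 f2 by (simp add: \<phi>lin lin_comb_lin_comb)
  note 1 = basis2_unique[OF e _ _ _ _ this]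
  have "lin_comb M (a \<otimes> z \<oplus> b \<otimes> w) e1 (c \<otimes> z \<oplus> d \<otimes> w) e2 =
      lin_comb M (b' \<otimes> x \<oplus> d' \<otimes> z) e1 (b' \<otimes> y \<oplus> d' \<otimes> w) e2"
    using \<phi>f(2) unfolding f1 f2 by (simp add: \<phi>lin lin_comb_lin_comb)
  note 2 = basis2_unique[OF e _ _ _ _ this]
  show "t = t'" "n = n'" unfolding tn tn'
    using conjugate_trace_det_eq[of a b c d a' b' c' d' x y z w] 1 2 unit by auto
qed

end

section \<open>Characteristic polynomials on sheaves of modules\<close>

lemma ring_hom_Units:
  assumes "ring R" "ring S" "h \<in> ring_hom R S" "u \<in> Units R"
  shows "h u \<in> Units S"
proof -
  interpret ring_hom_ring R S h
    using assms by (intro ring_hom_ringI2)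
  have [simp]: "u \<in> carrier R" "inv\<^bsub>R\<^esub> u \<in> carrier R" using assms(4) by auto
  have "h u \<otimes>\<^bsub>S\<^esub> h (inv\<^bsub>R\<^esub> u) = \<one>\<^bsub>S\<^esub>" "h (inv\<^bsub>R\<^esub> u) \<otimes>\<^bsub>S\<^esub> h u = \<one>\<^bsub>S\<^esub>"
    using assms(4) hom_mult[of u "inv\<^bsub>R\<^esub> u"] hom_mult[of "inv\<^bsub>R\<^esub> u" u] by simp_all
  then show ?thesis
    unfolding Units_def by (intro CollectI conjI bexI[of _ "h (inv\<^bsub>R\<^esub> u)"]) simp_all
qed

text \<open>Locality in pointwise form: the cover consists of all open subsets of U on which s and t
  agree.\<close>

lemma (in sheaf) section_eqI:
  assumes "openin X U" "s \<in> \<Gamma> F U" "t \<in> \<Gamma> F U"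
    and loc: "\<And>x. x \<in> U \<Longrightarrow> \<exists>W. openin X W \<and> x \<in> W \<and> W \<subseteq> U \<and> restr F U W s = restr F U W t"
  shows "s = t"
proof (rule locality[of "{W. openin X W \<and> W \<subseteq> U \<and> restr F U W s = restr F U W t}" U])
  show "U = \<Union>{W. openin X W \<and> W \<subseteq> U \<and> restr F U W s = restr F U W t}"
    using loc by blast
qed (use assms in auto)

lemma (in ringed_space) ring_sections: "openin X U \<Longrightarrow> ring (sections \<O> U)"
  using cring_sections cring.axioms(1) by blast

lemma (in ringed_space) restr_ring_hom_ring:
  assumes "openin X U" "openin X V" "V \<subseteq> U"
  shows "ring_hom_ring (sections \<O> U) (sections \<O> V) (restr \<O> U V)"
  using assms by (intro ring_hom_ringI2 ring_sections restr_hom)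

lemma (in ringed_space) restr_Units:
  assumes "openin X U" "openin X V" "V \<subseteq> U" "u \<in> Units (sections \<O> U)"
  shows "restr \<O> U V u \<in> Units (sections \<O> V)"
  using assms by (intro ring_hom_Units[OF ring_sections ring_sections restr_hom])

lemmas (in ringed_space) ring_restr_closed = restr_closed
lemmas (in ringed_space) ring_restr_id = restr_id
lemmas (in ringed_space) ring_restr_comp = restr_comp
lemmas (in ringed_space) ring_gluing = gluing
lemmas (in ringed_space) ring_section_eqI = section_eqI

context module_sheaf
begin

lemmas mod_restr_closed = M.restr_closed
lemmas mod_restr_id = M.restr_id
lemmas mod_restr_comp = M.restr_comp
lemmas mod_gluing = M.gluing
lemmas mod_section_eqI = M.section_eqI

lemma restr_lin_comb:
  assumes "openin X U" "openin X V" "V \<subseteq> U" "a \<in> \<Gamma> \<O> U" "b \<in> \<Gamma> \<O> U"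
    "m \<in> \<Gamma> \<M> U" "n \<in> \<Gamma> \<M> U"
  shows "restr \<M> U V (a \<odot>\<^bsub>sections \<M> U\<^esub> m \<oplus>\<^bsub>sections \<M> U\<^esub> b \<odot>\<^bsub>sections \<M> U\<^esub> n) =
    restr \<O> U V a \<odot>\<^bsub>sections \<M> V\<^esub> restr \<M> U V m \<oplus>\<^bsub>sections \<M> V\<^esub>
    restr \<O> U V b \<odot>\<^bsub>sections \<M> V\<^esub> restr \<M> U V n"
proof -
  interpret U: module "sections \<O> U" "sections \<M> U" using assms module_sections by blast
  show ?thesis using assms by (simp add: restr_add restr_smult)
qed

end

text \<open>Fixes the base to the type that \<open>sheaf_basis2\<close> and \<open>charpoly\<close>
  ask for. The instances will be the algebra itself and modules over it with restricted
  scalars.\<close>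

locale base_module_sheaf = module_sheaf X \<O> \<M>
  for X :: "'x topology" and \<O> :: "('x, 'a) ring_presheaf" and \<M> :: "('x, 'a, 'm) module_presheaf"
begin

lemma sheaf_basis2_basis2:
  "\<lbrakk>openin X V; sheaf_basis2 X \<O> \<M> V e1 e2\<rbrakk> \<Longrightarrow> basis2 (sections \<O> V) (sections \<M> V) e1 e2"
  unfolding sheaf_basis2_def by (metis mod_restr_id order_refl)

lemma sheaf_basis2_restr:
  assumes "openin X V" "openin X W" "W \<subseteq> V" "sheaf_basis2 X \<O> \<M> V e1 e2"
  shows "sheaf_basis2 X \<O> \<M> W (restr \<M> V W e1) (restr \<M> V W e2)"
  unfolding sheaf_basis2_def
proof (intro conjI allI impI)
  fix W' assume W': "openin X W' \<and> W' \<subseteq> W"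
  then have "basis2 (sections \<O> W') (sections \<M> W') (restr \<M> V W' e1) (restr \<M> V W' e2)"
    using assms unfolding sheaf_basis2_def by (meson order_trans)
  moreover have "restr \<M> W W' (restr \<M> V W e1) = restr \<M> V W' e1" "restr \<M> W W' (restr \<M> V W e2) = restr \<M> V W' e2"
    using assms W' by (auto intro!: mod_restr_comp simp: sheaf_basis2_def)
  ultimately show "basis2 (sections \<O> W') (sections \<M> W')
      (restr \<M> W W' (restr \<M> V W e1)) (restr \<M> W W' (restr \<M> V W e2))" by simp
qed (use assms in \<open>auto intro: mod_restr_closed simp: sheaf_basis2_def\<close>)

text \<open>A good frame is only known to be a basis over U itself. If some pair is a basis over U
  and over all smaller opens, the transition matrix from it to the frame has a unit as determinant
  over U. Units restrict to units, so the frame is a basis over every smaller open as well.\<close>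

lemma sheaf_basis2_change:
  assumes U: "openin X U" and e: "sheaf_basis2 X \<O> \<M> U e1 e2"
    and f: "basis2 (sections \<O> U) (sections \<M> U) f1 f2"
  shows "sheaf_basis2 X \<O> \<M> U f1 f2"
  unfolding sheaf_basis2_def
proof (intro conjI allI impI)
  interpret U: module "sections \<O> U" "sections \<M> U" using U module_sections by blast
  note e_basis = sheaf_basis2_basis2[OF U e]
  note [simp] = U.basis2_closed[OF f] U.basis2_closed[OF e_basis]
  show "f1 \<in> \<Gamma> \<M> U" "f2 \<in> \<Gamma> \<M> U" by simp_all
  fix V assume V: "openin X V \<and> V \<subseteq> U"
  interpret V: module "sections \<O> V" "sections \<M> V" using V module_sections by blast
  interpret h: ring_hom_ring "sections \<O> U" "sections \<O> V" "restr \<O> U V"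
    using U V restr_ring_hom_ring by blast
  let ?r = "restr \<O> U V"
  obtain x y z w where [simp]: "x \<in> \<Gamma> \<O> U" "y \<in> \<Gamma> \<O> U"
      "z \<in> \<Gamma> \<O> U" "w \<in> \<Gamma> \<O> U"
    and f12: "f1 = x \<odot>\<^bsub>sections \<M> U\<^esub> e1 \<oplus>\<^bsub>sections \<M> U\<^esub> y \<odot>\<^bsub>sections \<M> U\<^esub> e2"
      "f2 = z \<odot>\<^bsub>sections \<M> U\<^esub> e1 \<oplus>\<^bsub>sections \<M> U\<^esub> w \<odot>\<^bsub>sections \<M> U\<^esub> e2"
    and unit: "x \<otimes>\<^bsub>sections \<O> U\<^esub> w \<ominus>\<^bsub>sections \<O> U\<^esub> y \<otimes>\<^bsub>sections \<O> U\<^esub> z \<in> Units (sections \<O> U)"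
    using U.basis2_obtain_change[OF e_basis f] by metis
  have "?r (x \<otimes>\<^bsub>sections \<O> U\<^esub> w \<ominus>\<^bsub>sections \<O> U\<^esub> y \<otimes>\<^bsub>sections \<O> U\<^esub> z) =
      ?r x \<otimes>\<^bsub>sections \<O> V\<^esub> ?r w \<ominus>\<^bsub>sections \<O> V\<^esub> ?r y \<otimes>\<^bsub>sections \<O> V\<^esub> ?r z"
    by (simp add: a_minus_def)
  then have "?r x \<otimes>\<^bsub>sections \<O> V\<^esub> ?r w \<ominus>\<^bsub>sections \<O> V\<^esub> ?r y \<otimes>\<^bsub>sections \<O> V\<^esub> ?r z \<in> Units (sections \<O> V)"
    using restr_Units[OF U _ _ unit, of V] V by simp
  moreover have "basis2 (sections \<O> V) (sections \<M> V) (restr \<M> U V e1) (restr \<M> U V e2)"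
    using e V unfolding sheaf_basis2_def by blast
  ultimately show "basis2 (sections \<O> V) (sections \<M> V) (restr \<M> U V f1) (restr \<M> U V f2)"
    using U V unfolding f12 by (simp add: restr_lin_comb V.basis2_change)
qed

end

lemma UP_coeff_closed: "p \<in> carrier (UP R) \<Longrightarrow> p k \<in> carrier R"
  by (auto simp: UP_def up_def)

section \<open>Trace and determinant of an endomorphism over an open set\<close>

locale sheaf_endo = base_module_sheaf X \<O> \<M>
  for X :: "'x topology" and \<O> :: "('x, 'a) ring_presheaf" and \<M> :: "('x, 'a, 'm) module_presheaf" +
  fixes U :: "'x set" and \<phi> :: "'x set \<Rightarrow> 'm \<Rightarrow> 'm"
  assumes open_U: "openin X U"
    and endo_closed: "\<lbrakk>openin X V; V \<subseteq> U; m \<in> \<Gamma> \<M> V\<rbrakk> \<Longrightarrow> \<phi> V m \<in> \<Gamma> \<M> V"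
    and endo_add: "\<lbrakk>openin X V; V \<subseteq> U; m \<in> \<Gamma> \<M> V; m' \<in> \<Gamma> \<M> V\<rbrakk> \<Longrightarrow>
      \<phi> V (m \<oplus>\<^bsub>sections \<M> V\<^esub> m') = \<phi> V m \<oplus>\<^bsub>sections \<M> V\<^esub> \<phi> V m'"
    and endo_smult: "\<lbrakk>openin X V; V \<subseteq> U; r \<in> \<Gamma> \<O> V; m \<in> \<Gamma> \<M> V\<rbrakk> \<Longrightarrow>
      \<phi> V (r \<odot>\<^bsub>sections \<M> V\<^esub> m) = r \<odot>\<^bsub>sections \<M> V\<^esub> \<phi> V m"
    and endo_restr: "\<lbrakk>openin X V; V \<subseteq> U; openin X W; W \<subseteq> V; m \<in> \<Gamma> \<M> V\<rbrakk> \<Longrightarrow>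
      restr \<M> V W (\<phi> V m) = \<phi> W (restr \<M> V W m)"
begin

definition td :: "'x set \<Rightarrow> 'm \<Rightarrow> 'm \<Rightarrow> 'a \<Rightarrow> 'a \<Rightarrow> bool" where
  "td V e1 e2 t n \<longleftrightarrow> trace_det (sections \<O> V) (sections \<M> V) e1 e2 (\<phi> V) t n"

definition charpoly_on :: "'x set \<Rightarrow> 'm \<Rightarrow> 'm \<Rightarrow> (nat \<Rightarrow> 'a) \<Rightarrow> bool" where
  "charpoly_on V e1 e2 p \<longleftrightarrow> is_charpoly_wrt (sections \<O> V) (sections \<M> V) e1 e2 (\<phi> V) p"

lemma charpoly_on_iff:
  "openin X V \<Longrightarrow> charpoly_on V e1 e2 p \<longleftrightarrow> (\<exists>t n. td V e1 e2 t n \<and> p = quad_poly (sections \<O> V) t n)"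
  unfolding td_def charpoly_on_def by (rule cring.is_charpoly_wrt_iff[OF cring_sections])

lemma td_closed:
  assumes "openin X V" "td V e1 e2 t n"
  shows "t \<in> \<Gamma> \<O> V" "n \<in> \<Gamma> \<O> V"
  using cring.trace_det_closed[OF cring_sections[OF assms(1)] assms(2)[unfolded td_def]] by auto

lemma td_exists:
  assumes "openin X V" "V \<subseteq> U" "sheaf_basis2 X \<O> \<M> V e1 e2"
  shows "\<exists>t n. td V e1 e2 t n"
  unfolding td_def using assms by (intro module.trace_det_exists module_sections sheaf_basis2_basis2 endo_closed)
    (auto simp: sheaf_basis2_def)

text \<open>Compatibility of \<phi> with restriction makes the matrix over W the entrywise
  restriction of the matrix over V, and restriction of scalars is a ring homomorphism.\<close>

lemma td_restr:
  assumes "openin X V" "V \<subseteq> U" "openin X W" "W \<subseteq> V"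
    and e: "e1 \<in> \<Gamma> \<M> V" "e2 \<in> \<Gamma> \<M> V" and "td V e1 e2 t n"
  shows "td W (restr \<M> V W e1) (restr \<M> V W e2) (restr \<O> V W t) (restr \<O> V W n)"
proof -
  interpret h: ring_hom_ring "sections \<O> V" "sections \<O> W" "restr \<O> V W"
    using assms restr_ring_hom_ring by blast
  obtain a b c d where abcd [simp]: "a \<in> \<Gamma> \<O> V" "b \<in> \<Gamma> \<O> V"
      "c \<in> \<Gamma> \<O> V" "d \<in> \<Gamma> \<O> V"
    and \<phi>: "\<phi> V e1 = a \<odot>\<^bsub>sections \<M> V\<^esub> e1 \<oplus>\<^bsub>sections \<M> V\<^esub> c \<odot>\<^bsub>sections \<M> V\<^esub> e2"
      "\<phi> V e2 = b \<odot>\<^bsub>sections \<M> V\<^esub> e1 \<oplus>\<^bsub>sections \<M> V\<^esub> d \<odot>\<^bsub>sections \<M> V\<^esub> e2"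
    and tn: "t = a \<oplus>\<^bsub>sections \<O> V\<^esub> d"
      "n = a \<otimes>\<^bsub>sections \<O> V\<^esub> d \<ominus>\<^bsub>sections \<O> V\<^esub> b \<otimes>\<^bsub>sections \<O> V\<^esub> c"
    using assms(7) unfolding td_def trace_det_def by blast
  show ?thesis
    unfolding td_def trace_det_def
    using assms(1-6) endo_restr[of V W e1] endo_restr[of V W e2] unfolding \<phi> tn
    by (intro bexI[of _ "restr \<O> V W a"] bexI[of _ "restr \<O> V W b"]
        bexI[of _ "restr \<O> V W c"] bexI[of _ "restr \<O> V W d"])
      (simp_all add: restr_lin_comb a_minus_def)
qed

lemma td_unique:
  assumes "openin X V" "V \<subseteq> U" "sheaf_basis2 X \<O> \<M> V e1 e2" "sheaf_basis2 X \<O> \<M> V f1 f2"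
    "td V e1 e2 t n" "td V f1 f2 t' n'"
  shows "t = t'" "n = n'"
  using module.trace_det_unique[OF module_sections[of V]
      sheaf_basis2_basis2[of V e1 e2] sheaf_basis2_basis2[of V f1 f2],
      of "\<phi> V" t n t' n'] assms endo_add endo_smult unfolding td_def by auto

text \<open>Unrelated bases over V and W become comparable once both are restricted to V', where
  independence of the basis applies. These equalities are the compatibility condition for
  gluing.\<close>

lemma td_overlap:
  assumes "openin X V" "V \<subseteq> U" "openin X W" "W \<subseteq> U" "openin X V'" "V' \<subseteq> V" "V' \<subseteq> W"
    "sheaf_basis2 X \<O> \<M> V e1 e2" "sheaf_basis2 X \<O> \<M> W f1 f2" "td V e1 e2 t n" "td W f1 f2 t' n'"
  shows "restr \<O> V V' t = restr \<O> W V' t'" "restr \<O> V V' n = restr \<O> W V' n'"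
proof -
  have "sheaf_basis2 X \<O> \<M> V' (restr \<M> V V' e1) (restr \<M> V V' e2)"
    "sheaf_basis2 X \<O> \<M> V' (restr \<M> W V' f1) (restr \<M> W V' f2)"
    using assms by (auto intro!: sheaf_basis2_restr)
  moreover have "td V' (restr \<M> V V' e1) (restr \<M> V V' e2) (restr \<O> V V' t) (restr \<O> V V' n)"
    "td V' (restr \<M> W V' f1) (restr \<M> W V' f2) (restr \<O> W V' t') (restr \<O> W V' n')"
    using assms by (auto intro!: td_restr simp: sheaf_basis2_def)
  ultimately show "restr \<O> V V' t = restr \<O> W V' t'" "restr \<O> V V' n = restr \<O> W V' n'"
    using td_unique[of V'] assms by (meson order_trans)+
qed

lemma restr_quad_poly:
  assumes "openin X V" "openin X W" "W \<subseteq> V" "t \<in> \<Gamma> \<O> V"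
  shows "restr \<O> V W \<circ> quad_poly (sections \<O> V) t n =
    quad_poly (sections \<O> W) (restr \<O> V W t) (restr \<O> V W n)"
  using assms by (intro quad_poly_hom ring_sections restr_hom)

text \<open>Over V, which carries a basis, the polynomial of \<phi> exists and has to be identified
  with the restriction of p. Each coefficient is a section of \<O>, so the comparison may be made on
  the pieces V \<inter> W, where p is known to be correct for another basis.\<close>

lemma charpoly_on_local:
  assumes p: "p \<in> carrier (UP (sections \<O> U))"
    and loc: "\<And>x. x \<in> U \<Longrightarrow> \<exists>W e1 e2. openin X W \<and> x \<in> W \<and> W \<subseteq> U \<and> sheaf_basis2 X \<O> \<M> W e1 e2 \<and>
      charpoly_on W e1 e2 (restr \<O> U W \<circ> p)"
    and V: "openin X V" "V \<subseteq> U" "sheaf_basis2 X \<O> \<M> V e1 e2"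
  shows "charpoly_on V e1 e2 (restr \<O> U V \<circ> p)"
proof -
  obtain t n where tn: "td V e1 e2 t n" using td_exists[OF V] by blast
  note tn_closed = td_closed[OF V(1) tn]
  have "restr \<O> U V (p k) = quad_poly (sections \<O> V) t n k" for k
  proof (rule ring_section_eqI[OF V(1)])
    show "restr \<O> U V (p k) \<in> \<Gamma> \<O> V"
      by (rule ring_restr_closed[OF open_U V(1,2) UP_coeff_closed[OF p]])
    show "quad_poly (sections \<O> V) t n k \<in> \<Gamma> \<O> V"
      by (rule UP_coeff_closed[OF ring.quad_poly_closed[OF ring_sections[OF V(1)] tn_closed]])
    fix x assume x: "x \<in> V"
    with V(2) have "x \<in> U" by blast
    from loc[OF this] obtain W f1 f2 where W: "openin X W" "x \<in> W" "W \<subseteq> U" "sheaf_basis2 X \<O> \<M> W f1 f2"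
      and "charpoly_on W f1 f2 (restr \<O> U W \<circ> p)"
      by blast
    then obtain t' n' where tn': "td W f1 f2 t' n'"
      and eq: "restr \<O> U W \<circ> p = quad_poly (sections \<O> W) t' n'"
      using charpoly_on_iff[OF W(1)] by blast
    have VW: "openin X (V \<inter> W)" using V W by blast
    have "restr \<O> V (V \<inter> W) (restr \<O> U V (p k)) = restr \<O> W (V \<inter> W) (restr \<O> U W (p k))"
      using V W VW open_U by (simp add: ring_restr_comp UP_coeff_closed[OF p])
    also have "\<dots> = (restr \<O> W (V \<inter> W) \<circ> quad_poly (sections \<O> W) t' n') k"
      using eq[symmetric] by simp
    also have "\<dots> = (restr \<O> V (V \<inter> W) \<circ> quad_poly (sections \<O> V) t n) k"
      using td_overlap[OF V(1,2) W(1,3) VW _ _ V(3) W(4) tn tn'] V W VW td_closed[OF W(1) tn'] tn_closed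
      by (simp add: restr_quad_poly)
    finally show "\<exists>W. openin X W \<and> x \<in> W \<and> W \<subseteq> V \<and>
        restr \<O> V W (restr \<O> U V (p k)) = restr \<O> V W (quad_poly (sections \<O> V) t n k)"
      using VW x W by (intro exI[of _ "V \<inter> W"]) auto
  qed
  then have "restr \<O> U V \<circ> p = quad_poly (sections \<O> V) t n" by auto
  then show ?thesis using tn charpoly_on_iff[OF V(1)] by blast
qed

text \<open>Evaluates the definite description in \<open>charpoly\<close>. A polynomial that is
  correct for one basis near each point is correct for every basis, and two correct polynomials have
  the same coefficients near each point, hence everywhere.\<close>

lemma charpoly_eqI:
  assumes p: "p \<in> carrier (UP (sections \<O> U))"
    and loc: "\<And>x. x \<in> U \<Longrightarrow> \<exists>W e1 e2. openin X W \<and> x \<in> W \<and> W \<subseteq> U \<and> sheaf_basis2 X \<O> \<M> W e1 e2 \<and>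
      charpoly_on W e1 e2 (restr \<O> U W \<circ> p)"
  shows "charpoly X \<O> \<M> U \<phi> = p"
  unfolding charpoly_def charpoly_on_def[symmetric]
proof (rule the_equality)
  show "p \<in> carrier (UP (sections \<O> U)) \<and> (\<forall>V e1 e2. openin X V \<and> V \<subseteq> U \<and> sheaf_basis2 X \<O> \<M> V e1 e2 \<longrightarrow>
      charpoly_on V e1 e2 (restr \<O> U V \<circ> p))"
    by (intro conjI allI impI p) (rule charpoly_on_local[OF p loc], auto)
next
  fix q
  assume q: "q \<in> carrier (UP (sections \<O> U)) \<and> (\<forall>V e1 e2. openin X V \<and> V \<subseteq> U \<and> sheaf_basis2 X \<O> \<M> V e1 e2 \<longrightarrow>
      charpoly_on V e1 e2 (restr \<O> U V \<circ> q))"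
  show "q = p"
  proof
    fix k
    show "q k = p k"
    proof (rule ring_section_eqI[OF open_U])
      fix x assume "x \<in> U"
      from loc[OF this] obtain W e1 e2 where W: "openin X W" "x \<in> W" "W \<subseteq> U" "sheaf_basis2 X \<O> \<M> W e1 e2"
        and pW: "charpoly_on W e1 e2 (restr \<O> U W \<circ> p)"
        by blast
      have qW: "charpoly_on W e1 e2 (restr \<O> U W \<circ> q)"
        using q W by simp
      have "restr \<O> U W \<circ> p = restr \<O> U W \<circ> q"
        using pW qW td_unique[OF W(1,3,4,4)] unfolding charpoly_on_iff[OF W(1)] by metis
      from fun_cong[OF this, of k] show "\<exists>W. openin X W \<and> x \<in> W \<and> W \<subseteq> U \<and> restr \<O> U W (q k) = restr \<O> U W (p k)"
        using W by (intro exI[of _ W]) auto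
    qed (use UP_coeff_closed[of p] UP_coeff_closed[of q] p q in auto)
  qed
qed

text \<open>Traces and determinants over the open subsets of U on which \<M> is free agree on
  overlaps and glue to sections T and N over U. The polynomial with these coefficients satisfies the
  criterion of \<open>charpoly_eqI\<close>, so the description denotes it.\<close>

lemma charpoly_spec:
  assumes lf: "locally_free_rank2 X \<O> \<M>"
  shows "charpoly X \<O> \<M> U \<phi> \<in> carrier (UP (sections \<O> U))"
    and "\<lbrakk>openin X V; V \<subseteq> U; sheaf_basis2 X \<O> \<M> V e1 e2\<rbrakk> \<Longrightarrow>
      charpoly_on V e1 e2 (restr \<O> U V \<circ> charpoly X \<O> \<M> U \<phi>)"
proof -
  define \<V> where "\<V> = {V. openin X V \<and> V \<subseteq> U \<and> free_rank2_on X \<O> \<M> V}"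
  have cover: "\<exists>V\<in>\<V>. x \<in> V" if "x \<in> U" for x
  proof -
    have "x \<in> topspace X" using that open_U openin_subset by blast
    then obtain V where V: "openin X V" "x \<in> V" "free_rank2_on X \<O> \<M> V"
      using lf unfolding locally_free_rank2_def by blast
    \<comment> \<open>A neighbourhood on which \<M> is free need not lie in U; the basis is
      restricted to the intersection.\<close>
    then have "V \<inter> U \<in> \<V>"
      unfolding \<V>_def free_rank2_on_def using sheaf_basis2_restr[of V "V \<inter> U"] open_U by blast
    then show ?thesis using that V by blast
  qed
  have "\<forall>V\<in>\<V>. \<exists>e1 e2 t n. sheaf_basis2 X \<O> \<M> V e1 e2 \<and> td V e1 e2 t n"
    using td_exists unfolding \<V>_def free_rank2_on_def by blast
  \<comment> \<open>One basis is chosen over each member of the cover. The choices are unrelated,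
    but t and n do not depend on them.\<close>
  then obtain e1 e2 t n where etn: "\<And>V. V \<in> \<V> \<Longrightarrow> sheaf_basis2 X \<O> \<M> V (e1 V) (e2 V)"
      "\<And>V. V \<in> \<V> \<Longrightarrow> td V (e1 V) (e2 V) (t V) (n V)"
    by metis
  have op: "openin X V" "V \<subseteq> U" if "V \<in> \<V>" for V using that unfolding \<V>_def by auto
  have U_eq: "U = \<Union>\<V>" using cover op by blast
  have overlap: "restr \<O> V (V \<inter> W) (t V) = restr \<O> W (V \<inter> W) (t W)"
    "restr \<O> V (V \<inter> W) (n V) = restr \<O> W (V \<inter> W) (n W)" if "V \<in> \<V>" "W \<in> \<V>" for V W
    using td_overlap[OF op[OF that(1)] op[OF that(2)] _ _ _ etn(1)[OF that(1)] etn(1)[OF that(2)]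
      etn(2)[OF that(1)] etn(2)[OF that(2)], of "V \<inter> W"] op that by auto
  have closed: "t V \<in> \<Gamma> \<O> V" "n V \<in> \<Gamma> \<O> V" if "V \<in> \<V>" for V
    using td_closed[OF op(1)[OF that] etn(2)[OF that]] by auto
  obtain T where T: "T \<in> \<Gamma> \<O> U" "\<And>V. V \<in> \<V> \<Longrightarrow> restr \<O> U V T = t V"
    using ring_gluing[of \<V> U t, OF op(1) U_eq closed(1) overlap(1)] by blast
  obtain N where N: "N \<in> \<Gamma> \<O> U" "\<And>V. V \<in> \<V> \<Longrightarrow> restr \<O> U V N = n V"
    using ring_gluing[of \<V> U n, OF op(1) U_eq closed(2) overlap(2)] by blast
  define p where "p = quad_poly (sections \<O> U) T N"
  have p: "p \<in> carrier (UP (sections \<O> U))"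
    unfolding p_def by (rule ring.quad_poly_closed[OF ring_sections[OF open_U] T(1) N(1)])
  have loc: "\<exists>W e1 e2. openin X W \<and> x \<in> W \<and> W \<subseteq> U \<and> sheaf_basis2 X \<O> \<M> W e1 e2 \<and>
      charpoly_on W e1 e2 (restr \<O> U W \<circ> p)" if x: "x \<in> U" for x
  proof -
    obtain V where V: "V \<in> \<V>" "x \<in> V" using cover x by blast
    then have "restr \<O> U V \<circ> p = quad_poly (sections \<O> V) (t V) (n V)"
      unfolding p_def using restr_quad_poly[OF open_U] op T N by simp
    then have "charpoly_on V (e1 V) (e2 V) (restr \<O> U V \<circ> p)"
      using charpoly_on_iff[OF op(1)] V etn(2) by blast
    then show ?thesis using V op etn(1) by blast
  qed
  have eq: "charpoly X \<O> \<M> U \<phi> = p" by (rule charpoly_eqI[OF p loc])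
  show "charpoly X \<O> \<M> U \<phi> \<in> carrier (UP (sections \<O> U))" using eq p by simp
  show "charpoly_on V e1 e2 (restr \<O> U V \<circ> charpoly X \<O> \<M> U \<phi>)"
    if "openin X V" "V \<subseteq> U" "sheaf_basis2 X \<O> \<M> V e1 e2" for V e1 e2
    unfolding eq by (rule charpoly_on_local[OF p loc that])
qed

end

section \<open>Tensor products of modules\<close>

text \<open>The functorial map between free abelian groups. It covers both operations that are
  defined as unions over a coset: scalar multiplication, where p multiplies by a scalar and q is the
  identity, and restriction, where p and q are the restriction maps of the factors.\<close>

definition frag_map2 :: "('m \<Rightarrow> 'm2) \<Rightarrow> ('n \<Rightarrow> 'n2) \<Rightarrow> ('m \<times> 'n \<Rightarrow>\<^sub>0 int) \<Rightarrow> ('m2 \<times> 'n2 \<Rightarrow>\<^sub>0 int)" where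
  "frag_map2 p q = frag_extend (\<lambda>(m, n). frag_of (p m, q n))"

lemma frag_map2_simps [simp]:
  "frag_map2 p q 0 = 0" "frag_map2 p q (frag_of (m, n)) = frag_of (p m, q n)"
  "frag_map2 p q (x + y) = frag_map2 p q x + frag_map2 p q y"
  "frag_map2 p q (x - y) = frag_map2 p q x - frag_map2 p q y"
  "frag_map2 p q (- x) = - frag_map2 p q x"
  by (simp_all add: frag_map2_def frag_extend_add frag_extend_diff frag_extend_minus)

lemma frag_pair_induct [consumes 1, case_names zero diff pair]:
  assumes "Poly_Mapping.keys z \<subseteq> A \<times> B" "P 0"
    and "\<And>x y. \<lbrakk>Poly_Mapping.keys x \<subseteq> A \<times> B; Poly_Mapping.keys y \<subseteq> A \<times> B; P x; P y\<rbrakk> \<Longrightarrow> P (x - y)"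
    and "\<And>m n. \<lbrakk>m \<in> A; n \<in> B\<rbrakk> \<Longrightarrow> P (frag_of (m, n))"
  shows "P z"
  by (rule free_Abelian_group_induct[where S = "A \<times> B"]) (use assms in auto)

lemma keys_frag_map2:
  assumes "Poly_Mapping.keys z \<subseteq> A \<times> B" "\<And>m. m \<in> A \<Longrightarrow> p m \<in> C" "\<And>n. n \<in> B \<Longrightarrow> q n \<in> D"
  shows "Poly_Mapping.keys (frag_map2 p q z) \<subseteq> C \<times> D"
  using assms(1)
proof (induction z rule: frag_pair_induct)
  case (diff x y)
  then show ?case using keys_diff[of "frag_map2 p q x" "frag_map2 p q y"] by auto
qed (use assms(2,3) in auto)

lemma keys_minus_subset:
  "Poly_Mapping.keys x \<subseteq> A \<Longrightarrow> Poly_Mapping.keys y \<subseteq> A \<Longrightarrow> Poly_Mapping.keys (x - y) \<subseteq> A"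
  using keys_diff[of x y] by blast

locale module_pair = M: module S M + N: module S N
  for S :: "('s, 'r) ring_scheme" and M :: "('s, 'm) module" and N :: "('s, 'n) module"
begin

abbreviation F where "F \<equiv> free_Abelian_group (carrier M \<times> carrier N)"

abbreviation K where "K \<equiv> tensor_relations S M N"

abbreviation cls where "cls \<equiv> tensor_class S M N"

abbreviation T where "T \<equiv> tensor_module S M N"

definition tensor_gens where "tensor_gens =
  {frag_of (m \<oplus>\<^bsub>M\<^esub> m', n) - frag_of (m, n) - frag_of (m', n) | m m' n.
     m \<in> carrier M \<and> m' \<in> carrier M \<and> n \<in> carrier N} \<union>
  {frag_of (m, n \<oplus>\<^bsub>N\<^esub> n') - frag_of (m, n) - frag_of (m, n') | m n n'.
     m \<in> carrier M \<and> n \<in> carrier N \<and> n' \<in> carrier N} \<union>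
  {frag_of (s \<odot>\<^bsub>M\<^esub> m, n) - frag_of (m, s \<odot>\<^bsub>N\<^esub> n) | s m n.
     s \<in> carrier S \<and> m \<in> carrier M \<and> n \<in> carrier N}"

lemma K_eq: "K = generate F tensor_gens"
  by (simp add: tensor_relations_def tensor_gens_def)

lemma tensor_gens_subset: "tensor_gens \<subseteq> carrier F"
proof
  fix x assume "x \<in> tensor_gens"
  then have "Poly_Mapping.keys x \<subseteq> carrier M \<times> carrier N"
    unfolding tensor_gens_def by (elim UnE CollectE exE conjE) (simp_all add: keys_minus_subset)
  then show "x \<in> carrier F" by simp
qed

lemma subgroup_K: "subgroup K F"
  unfolding K_eq by (rule group.generate_is_subgroup[OF group_free_Abelian_group tensor_gens_subset])

lemma normal_K: "K \<lhd> F"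
  by (rule comm_group.subgroup_imp_normal[OF abelian_free_Abelian_group subgroup_K])

lemma K_keys: "x \<in> K \<Longrightarrow> Poly_Mapping.keys x \<subseteq> carrier M \<times> carrier N"
  using subgroup.mem_carrier[OF subgroup_K, of x] by (simp only: carrier_free_Abelian_group_iff)

lemma K_zero [simp]: "0 \<in> K"
  using subgroup.one_closed[OF subgroup_K] by simp

lemma K_add: "x \<in> K \<Longrightarrow> y \<in> K \<Longrightarrow> x + y \<in> K"
  using subgroup.m_closed[OF subgroup_K, of x y] by simp

lemma K_minus: "x \<in> K \<Longrightarrow> - x \<in> K"
  using subgroup.m_inv_closed[OF subgroup_K, of x] K_keys[of x] by simp

lemma K_diff: "x \<in> K \<Longrightarrow> y \<in> K \<Longrightarrow> x - y \<in> K"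
  using K_add[OF _ K_minus, of x y] by simp

lemma K_gens: "x \<in> tensor_gens \<Longrightarrow> x \<in> K"
  unfolding K_eq by (rule generate.incl)

lemma K_addL: "\<lbrakk>m \<in> carrier M; m' \<in> carrier M; n \<in> carrier N\<rbrakk> \<Longrightarrow>
    frag_of (m \<oplus>\<^bsub>M\<^esub> m', n) - frag_of (m, n) - frag_of (m', n) \<in> K"
  and K_addR: "\<lbrakk>m \<in> carrier M; n \<in> carrier N; n' \<in> carrier N\<rbrakk> \<Longrightarrow>
    frag_of (m, n \<oplus>\<^bsub>N\<^esub> n') - frag_of (m, n) - frag_of (m, n') \<in> K"
  and K_balanced: "\<lbrakk>s \<in> carrier S; m \<in> carrier M; n \<in> carrier N\<rbrakk> \<Longrightarrow>
    frag_of (s \<odot>\<^bsub>M\<^esub> m, n) - frag_of (m, s \<odot>\<^bsub>N\<^esub> n) \<in> K"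
  by (rule K_gens, unfold tensor_gens_def, blast)+

text \<open>Induction over the generated subgroup, with group inverses replaced by negatives; the
  two agree because the generators lie in the free group on the product of the carriers.\<close>

lemma K_induct [consumes 1, case_names addL addR balanced zero add minus]:
  assumes "x \<in> K"
    and "\<And>m m' n. \<lbrakk>m \<in> carrier M; m' \<in> carrier M; n \<in> carrier N\<rbrakk> \<Longrightarrow>
      P (frag_of (m \<oplus>\<^bsub>M\<^esub> m', n) - frag_of (m, n) - frag_of (m', n))"
    and "\<And>m n n'. \<lbrakk>m \<in> carrier M; n \<in> carrier N; n' \<in> carrier N\<rbrakk> \<Longrightarrow>
      P (frag_of (m, n \<oplus>\<^bsub>N\<^esub> n') - frag_of (m, n) - frag_of (m, n'))"
    and "\<And>s m n. \<lbrakk>s \<in> carrier S; m \<in> carrier M; n \<in> carrier N\<rbrakk> \<Longrightarrow>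
      P (frag_of (s \<odot>\<^bsub>M\<^esub> m, n) - frag_of (m, s \<odot>\<^bsub>N\<^esub> n))"
    and "P 0"
    and "\<And>x y. \<lbrakk>x \<in> K; y \<in> K; P x; P y\<rbrakk> \<Longrightarrow> P (x + y)"
    and "\<And>x. \<lbrakk>x \<in> K; P x\<rbrakk> \<Longrightarrow> P (- x)"
  shows "P x"
proof -
  have gens: "P g" if "g \<in> tensor_gens" for g
    using that unfolding tensor_gens_def by (elim UnE CollectE exE conjE) (simp_all add: assms(2-4))
  from \<open>x \<in> K\<close>[unfolded K_eq] show ?thesis
  proof (induction rule: generate.induct)
    case (inv h)
    then show ?case using gens[of h] assms(7)[OF K_gens[of h]] tensor_gens_subset by auto
  next
    case (eng h1 h2)
    then show ?case using assms(6) by (simp add: K_eq)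
  qed (use gens assms(5) in auto)
qed

lemma cls_eq: "cls z = (\<lambda>h. h + z) ` K"
  by (auto simp: tensor_class_def r_coset_def)

lemma mem_cls: "y \<in> cls z \<longleftrightarrow> y - z \<in> K"
proof
  assume "y - z \<in> K"
  then show "y \<in> cls z" unfolding cls_eq by (intro image_eqI[of _ _ "y - z"]) auto
qed (auto simp: cls_eq)

lemma self_mem_cls [simp]: "z \<in> cls z"
  by (simp add: mem_cls)

lemma cls_eq_iff: "cls z = cls z' \<longleftrightarrow> z - z' \<in> K"
proof
  assume "cls z = cls z'"
  then show "z - z' \<in> K" using self_mem_cls[of z] by (simp add: mem_cls)
next
  assume *: "z - z' \<in> K"
  have "y - z \<in> K \<longleftrightarrow> y - z' \<in> K" for y
    using K_add[OF _ *, of "y - z"] K_diff[OF _ *, of "y - z'"] by auto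
  then show "cls z = cls z'" by (auto simp: mem_cls)
qed

lemma tensor_carrier: "carrier T = {cls z | z. Poly_Mapping.keys z \<subseteq> carrier M \<times> carrier N}"
  by (auto simp: tensor_module_def Let_def FactGroup_def RCOSETS_def tensor_class_def)

lemma tensor_carrierE:
  assumes "A \<in> carrier T"
  obtains z where "Poly_Mapping.keys z \<subseteq> carrier M \<times> carrier N" "A = cls z"
  using assms tensor_carrier by auto

lemma cls_closed [simp]: "Poly_Mapping.keys z \<subseteq> carrier M \<times> carrier N \<Longrightarrow> cls z \<in> carrier T"
  using tensor_carrier by auto

lemma tensor_zero: "\<zero>\<^bsub>T\<^esub> = cls 0"
  by (simp add: tensor_module_def Let_def FactGroup_def cls_eq)

lemma tensor_add:
  assumes "Poly_Mapping.keys x \<subseteq> carrier M \<times> carrier N" "Poly_Mapping.keys y \<subseteq> carrier M \<times> carrier N"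
  shows "cls x \<oplus>\<^bsub>T\<^esub> cls y = cls (x + y)"
  using normal.rcos_sum[OF normal_K, of x y] assms
  by (simp add: tensor_module_def Let_def FactGroup_def tensor_class_def)

lemma abelian_group_tensor: "abelian_group T"
proof (rule abelian_groupI)
  have keys_add: "Poly_Mapping.keys (x + y) \<subseteq> carrier M \<times> carrier N"
    if "Poly_Mapping.keys x \<subseteq> carrier M \<times> carrier N" "Poly_Mapping.keys y \<subseteq> carrier M \<times> carrier N" for x y
    using Poly_Mapping.keys_add[of x y] that by blast
  show "\<zero>\<^bsub>T\<^esub> \<in> carrier T" by (simp add: tensor_zero)
  fix x assume "x \<in> carrier T"
  then obtain x' where x': "Poly_Mapping.keys x' \<subseteq> carrier M \<times> carrier N" and x: "x = cls x'"
    by (auto elim: tensor_carrierE)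
  show "\<zero>\<^bsub>T\<^esub> \<oplus>\<^bsub>T\<^esub> x = x" using x' by (simp add: x tensor_zero tensor_add)
  have "cls (- x') \<oplus>\<^bsub>T\<^esub> x = \<zero>\<^bsub>T\<^esub>" using x' by (simp add: x tensor_zero tensor_add)
  then show "\<exists>y\<in>carrier T. y \<oplus>\<^bsub>T\<^esub> x = \<zero>\<^bsub>T\<^esub>" using x' by (intro bexI[of _ "cls (- x')"]) auto
  fix y assume "y \<in> carrier T"
  then obtain y' where y': "Poly_Mapping.keys y' \<subseteq> carrier M \<times> carrier N" and y: "y = cls y'"
    by (auto elim: tensor_carrierE)
  show "x \<oplus>\<^bsub>T\<^esub> y \<in> carrier T" using x' y' by (simp add: x y tensor_add keys_add)
  show "x \<oplus>\<^bsub>T\<^esub> y = y \<oplus>\<^bsub>T\<^esub> x" using x' y' by (simp add: x y tensor_add add.commute)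
  fix z assume "z \<in> carrier T"
  then obtain z' where z': "Poly_Mapping.keys z' \<subseteq> carrier M \<times> carrier N" and z: "z = cls z'"
    by (auto elim: tensor_carrierE)
  show "x \<oplus>\<^bsub>T\<^esub> y \<oplus>\<^bsub>T\<^esub> z = x \<oplus>\<^bsub>T\<^esub> (y \<oplus>\<^bsub>T\<^esub> z)"
    using x' y' z' by (simp add: x y z tensor_add keys_add add.assoc)
qed

text \<open>If p and q are additive and semilinear over the same map \<rho> of scalars,
  \<open>frag_map2 p q\<close> sends each kind of relation to a relation of the same kind.
  Representatives of one coset then have images in one coset, so all members of the union coincide.
  Scalar multiplication and restriction are both instances.\<close>

lemma UN_cls:
  assumes "module_pair S2 M2 N2"
    and "\<And>m n. m \<in> carrier M \<Longrightarrow> p m \<in> carrier M2" "\<And>n. n \<in> carrier N \<Longrightarrow> q n \<in> carrier N2"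
    and "\<And>s. s \<in> carrier S \<Longrightarrow> \<rho> s \<in> carrier S2"
    and "\<And>m m'. \<lbrakk>m \<in> carrier M; m' \<in> carrier M\<rbrakk> \<Longrightarrow> p (m \<oplus>\<^bsub>M\<^esub> m') = p m \<oplus>\<^bsub>M2\<^esub> p m'"
    and "\<And>n n'. \<lbrakk>n \<in> carrier N; n' \<in> carrier N\<rbrakk> \<Longrightarrow> q (n \<oplus>\<^bsub>N\<^esub> n') = q n \<oplus>\<^bsub>N2\<^esub> q n'"
    and "\<And>s m. \<lbrakk>s \<in> carrier S; m \<in> carrier M\<rbrakk> \<Longrightarrow> p (s \<odot>\<^bsub>M\<^esub> m) = \<rho> s \<odot>\<^bsub>M2\<^esub> p m"
    and "\<And>s n. \<lbrakk>s \<in> carrier S; n \<in> carrier N\<rbrakk> \<Longrightarrow> q (s \<odot>\<^bsub>N\<^esub> n) = \<rho> s \<odot>\<^bsub>N2\<^esub> q n"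
  shows "(\<Union>z\<in>cls x. tensor_class S2 M2 N2 (frag_map2 p q z)) = tensor_class S2 M2 N2 (frag_map2 p q x)"
proof -
  interpret P2: module_pair S2 M2 N2 by fact
  have K: "frag_map2 p q z \<in> P2.K" if "z \<in> K" for z
    using that
  proof (induction rule: K_induct)
    case (addL m m' n)
    then show ?case using P2.K_addL[of "p m" "p m'" "q n"] assms by simp
  next
    case (addR m n n')
    then show ?case using P2.K_addR[of "p m" "q n" "q n'"] assms by simp
  next
    case (balanced s m n)
    then show ?case using P2.K_balanced[of "\<rho> s" "p m" "q n"] assms by simp
  qed (auto intro: P2.K_add P2.K_minus)
  have "P2.cls (frag_map2 p q z) = P2.cls (frag_map2 p q x)" if "z \<in> cls x" for z
    using K[of "z - x"] that by (simp add: mem_cls P2.cls_eq_iff)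
  then show ?thesis using self_mem_cls[of x] by blast
qed

lemma smult_cls:
  assumes "s \<in> carrier S"
  shows "s \<odot>\<^bsub>T\<^esub> cls x = cls (frag_map2 (\<lambda>m. s \<odot>\<^bsub>M\<^esub> m) (\<lambda>n. n) x)"
proof -
  have "module_pair S M N" by unfold_locales
  \<comment> \<open>Here \<rho> is the identity: multiplication by s is linear over S because S is
    commutative.\<close>
  then have "(\<Union>z\<in>cls x. cls (frag_map2 (\<lambda>m. s \<odot>\<^bsub>M\<^esub> m) (\<lambda>n. n) z)) = cls (frag_map2 (\<lambda>m. s \<odot>\<^bsub>M\<^esub> m) (\<lambda>n. n) x)"
    using assms M.m_comm
    by (intro UN_cls[where \<rho> = "\<lambda>s. s"]) (auto simp: M.smult_r_distr simp flip: M.smult_assoc1)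
  then show ?thesis by (simp add: tensor_module_def Let_def frag_map2_def)
qed

lemma keys_smult_map:
  "\<lbrakk>s \<in> carrier S; Poly_Mapping.keys z \<subseteq> carrier M \<times> carrier N\<rbrakk> \<Longrightarrow>
    Poly_Mapping.keys (frag_map2 (\<lambda>m. s \<odot>\<^bsub>M\<^esub> m) (\<lambda>n. n) z) \<subseteq> carrier M \<times> carrier N"
  by (rule keys_frag_map2) auto

lemma module_tensor: "module S T"
proof (rule moduleI)
  show "cring S" by (rule M.R.is_cring)
  show "abelian_group T" by (rule abelian_group_tensor)
next
  fix a x assume "a \<in> carrier S" "x \<in> carrier T"
  then show "a \<odot>\<^bsub>T\<^esub> x \<in> carrier T"
    by (auto elim!: tensor_carrierE simp: smult_cls keys_smult_map)
next
  fix a b x assume ab [simp]: "a \<in> carrier S" "b \<in> carrier S" and "x \<in> carrier T"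
  then obtain z where z: "Poly_Mapping.keys z \<subseteq> carrier M \<times> carrier N" and x: "x = cls z"
    by (auto elim: tensor_carrierE)
  let ?f = "\<lambda>s. frag_map2 (\<lambda>m. s \<odot>\<^bsub>M\<^esub> m) (\<lambda>n. n)"
  \<comment> \<open>Additivity in the scalar holds only modulo the relations for sums in the left
    argument; the other laws of the scalar action hold already for representatives.\<close>
  have "?f (a \<oplus>\<^bsub>S\<^esub> b) z - (?f a z + ?f b z) \<in> K"
    using z
  proof (induction z rule: frag_pair_induct)
    case (diff x y)
    then show ?case using K_diff[of "?f (a \<oplus>\<^bsub>S\<^esub> b) x - (?f a x + ?f b x)" "?f (a \<oplus>\<^bsub>S\<^esub> b) y - (?f a y + ?f b y)"]
      by (simp add: algebra_simps)
  next
    case (pair m n)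
    then show ?case using K_addL[of "a \<odot>\<^bsub>M\<^esub> m" "b \<odot>\<^bsub>M\<^esub> m" n] by (simp add: M.smult_l_distr algebra_simps)
  qed simp
  then show "(a \<oplus>\<^bsub>S\<^esub> b) \<odot>\<^bsub>T\<^esub> x = a \<odot>\<^bsub>T\<^esub> x \<oplus>\<^bsub>T\<^esub> b \<odot>\<^bsub>T\<^esub> x"
    using z by (simp add: x smult_cls tensor_add keys_smult_map cls_eq_iff)
  have "?f (a \<otimes>\<^bsub>S\<^esub> b) z = ?f a (?f b z)"
    using z by (induction z rule: frag_pair_induct) (auto simp: M.smult_assoc1)
  then show "(a \<otimes>\<^bsub>S\<^esub> b) \<odot>\<^bsub>T\<^esub> x = a \<odot>\<^bsub>T\<^esub> (b \<odot>\<^bsub>T\<^esub> x)"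
    by (simp add: x smult_cls)
next
  fix a x y assume "a \<in> carrier S" "x \<in> carrier T" "y \<in> carrier T"
  then show "a \<odot>\<^bsub>T\<^esub> (x \<oplus>\<^bsub>T\<^esub> y) = a \<odot>\<^bsub>T\<^esub> x \<oplus>\<^bsub>T\<^esub> a \<odot>\<^bsub>T\<^esub> y"
    by (auto elim!: tensor_carrierE simp: smult_cls tensor_add keys_smult_map)
next
  fix x assume "x \<in> carrier T"
  then obtain z where z: "Poly_Mapping.keys z \<subseteq> carrier M \<times> carrier N" and x: "x = cls z"
    by (auto elim: tensor_carrierE)
  have "frag_map2 (\<lambda>m. \<one>\<^bsub>S\<^esub> \<odot>\<^bsub>M\<^esub> m) (\<lambda>n. n) z = z"
    using z by (induction z rule: frag_pair_induct) auto
  then show "\<one>\<^bsub>S\<^esub> \<odot>\<^bsub>T\<^esub> x = x" by (simp add: x smult_cls)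
qed

section \<open>Pure tensors, and tensoring with a free module of rank one\<close>

definition pure :: "'m \<Rightarrow> 'n \<Rightarrow> ('m \<times> 'n \<Rightarrow>\<^sub>0 int) set" where "pure m n = cls (frag_of (m, n))"

lemma pure_closed [simp]: "\<lbrakk>m \<in> carrier M; n \<in> carrier N\<rbrakk> \<Longrightarrow> pure m n \<in> carrier T"
  by (simp add: pure_def)

lemma pure_addL:
  "\<lbrakk>m \<in> carrier M; m' \<in> carrier M; n \<in> carrier N\<rbrakk> \<Longrightarrow> pure (m \<oplus>\<^bsub>M\<^esub> m') n = pure m n \<oplus>\<^bsub>T\<^esub> pure m' n"
  using K_addL[of m m' n] by (simp add: pure_def tensor_add cls_eq_iff algebra_simps)

lemma pure_addR:
  "\<lbrakk>m \<in> carrier M; n \<in> carrier N; n' \<in> carrier N\<rbrakk> \<Longrightarrow> pure m (n \<oplus>\<^bsub>N\<^esub> n') = pure m n \<oplus>\<^bsub>T\<^esub> pure m n'"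
  using K_addR[of m n n'] by (simp add: pure_def tensor_add cls_eq_iff algebra_simps)

lemma pure_smultL:
  "\<lbrakk>s \<in> carrier S; m \<in> carrier M; n \<in> carrier N\<rbrakk> \<Longrightarrow> pure (s \<odot>\<^bsub>M\<^esub> m) n = s \<odot>\<^bsub>T\<^esub> pure m n"
  by (simp add: pure_def smult_cls)

lemma pure_smultR:
  "\<lbrakk>s \<in> carrier S; m \<in> carrier M; n \<in> carrier N\<rbrakk> \<Longrightarrow> pure m (s \<odot>\<^bsub>N\<^esub> n) = s \<odot>\<^bsub>T\<^esub> pure m n"
  using K_balanced[of s m n] pure_smultL[of s m n] by (simp add: pure_def flip: cls_eq_iff)

text \<open>Representatives are built from pairs by differences. Negation is replaced by the scalar
  -1, so closure under sums and scalar multiples takes the place of closure under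
  differences.\<close>

lemma tensor_induct [consumes 1, case_names pure add smult]:
  assumes "A \<in> carrier T"
    and pure: "\<And>m n. \<lbrakk>m \<in> carrier M; n \<in> carrier N\<rbrakk> \<Longrightarrow> P (pure m n)"
    and add: "\<And>x y. \<lbrakk>x \<in> carrier T; y \<in> carrier T; P x; P y\<rbrakk> \<Longrightarrow> P (x \<oplus>\<^bsub>T\<^esub> y)"
    and smult: "\<And>s x. \<lbrakk>s \<in> carrier S; x \<in> carrier T; P x\<rbrakk> \<Longrightarrow> P (s \<odot>\<^bsub>T\<^esub> x)"
  shows "P A"
proof -
  interpret T: module S T by (rule module_tensor)
  obtain z where z: "Poly_Mapping.keys z \<subseteq> carrier M \<times> carrier N" and A: "A = cls z"
    using assms(1) by (auto elim: tensor_carrierE)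
  from z have "P (cls z)"
  proof (induction z rule: frag_pair_induct)
    case zero
    \<comment> \<open>Zero is obtained as the scalar 0 times a pure tensor, so it needs no case of
      its own in the induction rule.\<close>
    have "P (\<zero>\<^bsub>S\<^esub> \<odot>\<^bsub>T\<^esub> pure \<zero>\<^bsub>M\<^esub> \<zero>\<^bsub>N\<^esub>)" by (intro smult pure pure_closed) auto
    then show ?case by (simp add: tensor_zero)
  next
    case (diff x y)
    have "cls y \<oplus>\<^bsub>T\<^esub> cls (- y) = \<zero>\<^bsub>T\<^esub>" using diff by (simp add: tensor_add tensor_zero)
    then have "cls (- y) = \<ominus>\<^bsub>T\<^esub> cls y"
      using diff by (intro T.M.minus_equality[symmetric]) (auto simp: T.M.a_comm)
    also have "\<dots> = (\<ominus>\<^bsub>S\<^esub> \<one>\<^bsub>S\<^esub>) \<odot>\<^bsub>T\<^esub> cls y" using diff by (simp add: T.smult_l_minus)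
    finally have "P (cls (- y))" using diff smult[of "\<ominus>\<^bsub>S\<^esub> \<one>\<^bsub>S\<^esub>" "cls y"] by simp
    moreover have "cls (x - y) = cls x \<oplus>\<^bsub>T\<^esub> cls (- y)" using diff by (simp add: tensor_add)
    ultimately show ?case using diff add by simp
  qed (use pure in \<open>simp add: pure_def\<close>)
  then show ?thesis by (simp add: A)
qed

text \<open>The universal property, stated only in the weak form that suffices to separate pure tensors.\<close>

lemma balanced_map_eqI:
  assumes "abelian_group L"
    and closed: "\<And>m n. \<lbrakk>m \<in> carrier M; n \<in> carrier N\<rbrakk> \<Longrightarrow> \<beta> m n \<in> carrier L"
    and addL: "\<And>m m' n. \<lbrakk>m \<in> carrier M; m' \<in> carrier M; n \<in> carrier N\<rbrakk> \<Longrightarrow> \<beta> (m \<oplus>\<^bsub>M\<^esub> m') n = \<beta> m n \<oplus>\<^bsub>L\<^esub> \<beta> m' n"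
    and addR: "\<And>m n n'. \<lbrakk>m \<in> carrier M; n \<in> carrier N; n' \<in> carrier N\<rbrakk> \<Longrightarrow> \<beta> m (n \<oplus>\<^bsub>N\<^esub> n') = \<beta> m n \<oplus>\<^bsub>L\<^esub> \<beta> m n'"
    and balanced: "\<And>s m n. \<lbrakk>s \<in> carrier S; m \<in> carrier M; n \<in> carrier N\<rbrakk> \<Longrightarrow> \<beta> (s \<odot>\<^bsub>M\<^esub> m) n = \<beta> m (s \<odot>\<^bsub>N\<^esub> n)"
    and eq: "pure m n = pure m' n'"
    and [simp]: "m \<in> carrier M" "m' \<in> carrier M" "n \<in> carrier N" "n' \<in> carrier N"
  shows "\<beta> m n = \<beta> m' n'"
proof -
  interpret L: abelian_group L by fact
  have "(\<lambda>(m, n). \<beta> m n) ` (carrier M \<times> carrier N) \<subseteq> carrier (add_monoid L)"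
    using closed by auto
  from comm_group.free_Abelian_group_universal[OF L.a_comm_group this]
  obtain h where h: "h \<in> hom F (add_monoid L)"
    and h_of': "\<And>x. x \<in> carrier M \<times> carrier N \<Longrightarrow> h (frag_of x) = (\<lambda>(m, n). \<beta> m n) x"
    by blast
  have h_of: "h (frag_of (m, n)) = \<beta> m n" if "m \<in> carrier M" "n \<in> carrier N" for m n
    using h_of'[of "(m, n)"] that by simp
  interpret h: group_hom F "add_monoid L" h
    by (intro group_hom.intro group_hom_axioms.intro h L.a_group) simp
  have h_closed: "h x \<in> carrier L" if "Poly_Mapping.keys x \<subseteq> carrier M \<times> carrier N" for x
    using h.hom_closed[of x] that by simp
  have h_add: "h (x + y) = h x \<oplus>\<^bsub>L\<^esub> h y"
    if "Poly_Mapping.keys x \<subseteq> carrier M \<times> carrier N" "Poly_Mapping.keys y \<subseteq> carrier M \<times> carrier N" for x y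
    using h.hom_mult[of x y] that by simp
  have h_minus: "h (- x) = \<ominus>\<^bsub>L\<^esub> h x" if "Poly_Mapping.keys x \<subseteq> carrier M \<times> carrier N" for x
    using h.hom_inv[of x] that by (simp add: a_inv_def)
  have h_diff: "h (x - y) = h x \<ominus>\<^bsub>L\<^esub> h y"
    if "Poly_Mapping.keys x \<subseteq> carrier M \<times> carrier N" "Poly_Mapping.keys y \<subseteq> carrier M \<times> carrier N" for x y
    using h_add[of x "- y"] h_minus[of y] that by (simp add: a_minus_def)
  \<comment> \<open>The three kinds of generators vanish under h because \<beta> is additive in each
    argument and balanced; this is what makes h constant on cosets.\<close>
  have h_K: "h x = \<zero>\<^bsub>L\<^esub>" if "x \<in> K" for x
    using that
  proof (induction rule: K_induct)
    case (addL m m' n)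
    then show ?case
      using assms(3)[of m m' n] closed[of m n] closed[of m' n]
      by (simp add: h_diff h_of keys_minus_subset a_minus_def L.minus_add L.a_ac L.r_neg)
  next
    case (addR m n n')
    then show ?case
      using assms(4)[of m n n'] closed[of m n] closed[of m n']
      by (simp add: h_diff h_of keys_minus_subset a_minus_def L.minus_add L.a_ac L.r_neg)
  next
    case (balanced s m n)
    then show ?case
      using assms(5)[of s m n] closed[of m "s \<odot>\<^bsub>N\<^esub> n"] by (simp add: h_diff h_of a_minus_def L.r_neg)
  next
    case zero
    then show ?case using h.hom_one by simp
  next
    case (add x y)
    then show ?case using h_add[of x y] K_keys by simp
  next
    case (minus x)
    then show ?case using h_minus[of x] K_keys by simp
  qed
  have "frag_of (m, n) - frag_of (m', n') \<in> K"
    using eq by (simp add: pure_def cls_eq_iff)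
  then have "\<beta> m n \<ominus>\<^bsub>L\<^esub> \<beta> m' n' = \<zero>\<^bsub>L\<^esub>"
    using h_K[of "frag_of (m, n) - frag_of (m', n')"] by (simp add: h_diff h_of)
  then have "\<ominus>\<^bsub>L\<^esub> (\<ominus>\<^bsub>L\<^esub> \<beta> m' n') = \<beta> m n"
    using closed by (intro L.minus_equality) (simp_all add: a_minus_def)
  then show ?thesis using closed by simp
qed

text \<open>The coordinate with respect to the free generator e, inverse to the map s to s e. Each
  law is checked after acting on e, where injectivity of that map applies.\<close>

lemma cyclic_inverse:
  assumes e: "e \<in> carrier M" and bij: "free_generator S M e"
  obtains \<kappa> where "\<And>m. m \<in> carrier M \<Longrightarrow> \<kappa> m \<in> carrier S" "\<kappa> e = \<one>\<^bsub>S\<^esub>"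
    "\<And>m m'. \<lbrakk>m \<in> carrier M; m' \<in> carrier M\<rbrakk> \<Longrightarrow> \<kappa> (m \<oplus>\<^bsub>M\<^esub> m') = \<kappa> m \<oplus>\<^bsub>S\<^esub> \<kappa> m'"
    "\<And>s m. \<lbrakk>s \<in> carrier S; m \<in> carrier M\<rbrakk> \<Longrightarrow> \<kappa> (s \<odot>\<^bsub>M\<^esub> m) = s \<otimes>\<^bsub>S\<^esub> \<kappa> m"
proof
  let ?\<kappa> = "inv_into (carrier S) (\<lambda>s. s \<odot>\<^bsub>M\<^esub> e)"
  have closed: "?\<kappa> m \<in> carrier S" and \<kappa>: "?\<kappa> m \<odot>\<^bsub>M\<^esub> e = m" if "m \<in> carrier M" for m
    using bij that by (metis bij_betw_def inv_into_into, metis bij_betw_inv_into_right)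
  have inj: "s = t" if "s \<odot>\<^bsub>M\<^esub> e = t \<odot>\<^bsub>M\<^esub> e" "s \<in> carrier S" "t \<in> carrier S" for s t
    using bij that unfolding bij_betw_def inj_on_def by blast
  show "?\<kappa> m \<in> carrier S" if "m \<in> carrier M" for m by (rule closed[OF that])
  show "?\<kappa> e = \<one>\<^bsub>S\<^esub>" by (rule inj) (use e \<kappa> closed in auto)
  show "?\<kappa> (m \<oplus>\<^bsub>M\<^esub> m') = ?\<kappa> m \<oplus>\<^bsub>S\<^esub> ?\<kappa> m'" if "m \<in> carrier M" "m' \<in> carrier M" for m m'
    by (rule inj) (use that e in \<open>simp_all add: \<kappa> closed M.smult_l_distr\<close>)
  show "?\<kappa> (s \<odot>\<^bsub>M\<^esub> m) = s \<otimes>\<^bsub>S\<^esub> ?\<kappa> m" if "s \<in> carrier S" "m \<in> carrier M" for s m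
    by (rule inj) (use that e in \<open>simp_all add: \<kappa> closed M.smult_assoc1\<close>)
qed

text \<open>Surjectivity holds because (s e) \<otimes> n = e \<otimes> (s n). For injectivity, the
  balanced map that sends (m, n) to the coordinate of m acting on n separates e \<otimes> n from e
  \<otimes> n', since the coordinate of e is 1.\<close>

lemma cyclic_tensor_bij:
  assumes e: "e \<in> carrier M" and bij: "free_generator S M e"
  shows "bij_betw (pure e) (carrier N) (carrier T)"
  unfolding bij_betw_def
proof (intro conjI inj_onI)
  fix n n' assume n: "n \<in> carrier N" "n' \<in> carrier N" "pure e n = pure e n'"
  obtain \<kappa> where \<kappa>: "\<And>m. m \<in> carrier M \<Longrightarrow> \<kappa> m \<in> carrier S" "\<kappa> e = \<one>\<^bsub>S\<^esub>"
    "\<And>m m'. \<lbrakk>m \<in> carrier M; m' \<in> carrier M\<rbrakk> \<Longrightarrow> \<kappa> (m \<oplus>\<^bsub>M\<^esub> m') = \<kappa> m \<oplus>\<^bsub>S\<^esub> \<kappa> m'"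
    "\<And>s m. \<lbrakk>s \<in> carrier S; m \<in> carrier M\<rbrakk> \<Longrightarrow> \<kappa> (s \<odot>\<^bsub>M\<^esub> m) = s \<otimes>\<^bsub>S\<^esub> \<kappa> m"
    using cyclic_inverse[OF e bij] by metis
  have "\<kappa> e \<odot>\<^bsub>N\<^esub> n = \<kappa> e \<odot>\<^bsub>N\<^esub> n'"
    by (rule balanced_map_eqI[where \<beta> = "\<lambda>m n. \<kappa> m \<odot>\<^bsub>N\<^esub> n", OF N.abelian_group_axioms])
      (use e n \<kappa> in \<open>auto simp: N.smult_l_distr N.smult_r_distr M.m_comm simp flip: N.smult_assoc1\<close>)
  then show "n = n'" using n \<kappa>(2) by simp
next
  have "A \<in> pure e ` carrier N" if "A \<in> carrier T" for A
    using that
  proof (induction rule: tensor_induct)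
    case (pure m n)
    then obtain s where "s \<in> carrier S" "m = s \<odot>\<^bsub>M\<^esub> e"
      using bij unfolding bij_betw_def by blast
    then show ?case using pure e pure_smultL pure_smultR[symmetric] by auto
  next
    case (add x y)
    then show ?case using e by (auto simp flip: pure_addR)
  next
    case (smult s x)
    then show ?case using e by (auto simp flip: pure_smultR)
  qed
  then show "pure e ` carrier N = carrier T" using e by auto
qed

end

text \<open>The mirror image, with coordinates taken in the right factor. The argument is repeated
  directly, since the tensor products in the two orders live on different types; only the coordinate
  function is borrowed from the swapped pair.\<close>

lemma cyclic_tensor_bij':
  assumes "module_pair S M N"
    and e: "e \<in> carrier N" and bij: "free_generator S N e"
  shows "bij_betw (\<lambda>m. module_pair.pure S M N m e) (carrier M) (carrier (tensor_module S M N))"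
  unfolding bij_betw_def
proof (intro conjI inj_onI)
  interpret module_pair S M N by fact
  interpret NM: module_pair S N M by unfold_locales
  fix n n' assume n: "n \<in> carrier M" "n' \<in> carrier M" "pure n e = pure n' e"
  obtain \<kappa> where \<kappa>: "\<And>m. m \<in> carrier N \<Longrightarrow> \<kappa> m \<in> carrier S" "\<kappa> e = \<one>\<^bsub>S\<^esub>"
    "\<And>m m'. \<lbrakk>m \<in> carrier N; m' \<in> carrier N\<rbrakk> \<Longrightarrow> \<kappa> (m \<oplus>\<^bsub>N\<^esub> m') = \<kappa> m \<oplus>\<^bsub>S\<^esub> \<kappa> m'"
    "\<And>s m. \<lbrakk>s \<in> carrier S; m \<in> carrier N\<rbrakk> \<Longrightarrow> \<kappa> (s \<odot>\<^bsub>N\<^esub> m) = s \<otimes>\<^bsub>S\<^esub> \<kappa> m"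
    using NM.cyclic_inverse[OF e bij] by metis
  have "\<kappa> e \<odot>\<^bsub>M\<^esub> n = \<kappa> e \<odot>\<^bsub>M\<^esub> n'"
    by (rule balanced_map_eqI[where \<beta> = "\<lambda>m n. \<kappa> n \<odot>\<^bsub>M\<^esub> m", OF M.abelian_group_axioms])
      (use e n \<kappa> in \<open>auto simp: M.smult_l_distr M.smult_r_distr M.m_comm simp flip: M.smult_assoc1\<close>)
  then show "n = n'" using n \<kappa>(2) by simp
next
  interpret module_pair S M N by fact
  have "A \<in> (\<lambda>m. pure m e) ` carrier M" if "A \<in> carrier T" for A
    using that
  proof (induction rule: tensor_induct)
    case (pure m n)
    then obtain s where "s \<in> carrier S" "n = s \<odot>\<^bsub>N\<^esub> e"
      using bij unfolding bij_betw_def by blast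
    then show ?case using pure e pure_smultR pure_smultL[symmetric] by auto
  next
    case (add x y)
    then show ?case using e by (auto simp flip: pure_addL)
  next
    case (smult s x)
    then show ?case using e by (auto simp flip: pure_smultL)
  qed
  then show "(\<lambda>m. pure m e) ` carrier M = carrier T" using e by auto
qed

section \<open>Sheafification of presheaves of modules\<close>

lemma UN_const_eq: "A \<noteq> {} \<Longrightarrow> (\<And>a. a \<in> A \<Longrightarrow> f a = c) \<Longrightarrow> \<Union> (f ` A) = c"
  by auto

locale presheaf_of_modules = ringed_space X \<O>
  for X :: "'x topology" and \<O> :: "('x, 's, 'r) presheaf" +
  fixes P :: "('x, 's, 'm) module_presheaf"
  assumes p_closed: "\<lbrakk>openin X U; openin X V; V \<subseteq> U; s \<in> \<Gamma> P U\<rbrakk> \<Longrightarrow>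
      restr P U V s \<in> \<Gamma> P V"
    and p_id: "\<lbrakk>openin X U; s \<in> \<Gamma> P U\<rbrakk> \<Longrightarrow> restr P U U s = s"
    and p_comp: "\<lbrakk>openin X U; openin X V; openin X W; V \<subseteq> U; W \<subseteq> V; s \<in> \<Gamma> P U\<rbrakk> \<Longrightarrow>
      restr P V W (restr P U V s) = restr P U W s"
    and p_module: "openin X U \<Longrightarrow> module (sections \<O> U) (sections P U)"
    and p_add: "\<lbrakk>openin X U; openin X V; V \<subseteq> U; s \<in> \<Gamma> P U; t \<in> \<Gamma> P U\<rbrakk> \<Longrightarrow>
      restr P U V (s \<oplus>\<^bsub>sections P U\<^esub> t) = restr P U V s \<oplus>\<^bsub>sections P V\<^esub> restr P U V t"
    and p_smult: "\<lbrakk>openin X U; openin X V; V \<subseteq> U; r \<in> \<Gamma> \<O> U; s \<in> \<Gamma> P U\<rbrakk> \<Longrightarrow>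
      restr P U V (r \<odot>\<^bsub>sections P U\<^esub> s) = restr \<O> U V r \<odot>\<^bsub>sections P V\<^esub> restr P U V s"
begin

abbreviation G where "G \<equiv> germ X P"

lemma mem_germ: "(V, t) \<in> G x U s \<longleftrightarrow> openin X V \<and> x \<in> V \<and> t \<in> \<Gamma> P V \<and>
     (\<exists>W. openin X W \<and> x \<in> W \<and> W \<subseteq> U \<inter> V \<and> restr P U W s = restr P V W t)"
  by (simp add: germ_def)

lemma self_mem_germ: "\<lbrakk>openin X U; x \<in> U; s \<in> \<Gamma> P U\<rbrakk> \<Longrightarrow> (U, s) \<in> G x U s"
  unfolding mem_germ by blast

lemma restr_eq_smaller:
  assumes "openin X U" "openin X V" "openin X W" "openin X W'" "W' \<subseteq> W" "W \<subseteq> U" "W \<subseteq> V"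
    "s \<in> \<Gamma> P U" "t \<in> \<Gamma> P V" "restr P U W s = restr P V W t"
  shows "restr P U W' s = restr P V W' t"
  using p_comp[of U W W' s] p_comp[of V W W' t] assms by simp

text \<open>A germ is given as a set of representatives, with no equivalence relation in sight.
  Agreement on some neighbourhood of x is transitive, by intersecting neighbourhoods, and this makes
  the sets behave as equivalence classes.\<close>

lemma germ_eqI:
  assumes U: "openin X U" "s \<in> \<Gamma> P U" and V: "openin X V" "t \<in> \<Gamma> P V"
    and W: "openin X W" "x \<in> W" "W \<subseteq> U" "W \<subseteq> V" "restr P U W s = restr P V W t"
  shows "G x U s = G x V t"
proof -
  have *: "p \<in> G x U s \<Longrightarrow> p \<in> G x V t" if U: "openin X U" "s \<in> \<Gamma> P U"
    and V: "openin X V" "t \<in> \<Gamma> P V"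
    and W: "openin X W" "x \<in> W" "W \<subseteq> U" "W \<subseteq> V" "restr P U W s = restr P V W t" for U V s t p
  proof -
    assume "p \<in> G x U s"
    then obtain V' t' W' where p: "p = (V', t')" and V': "openin X V'" "x \<in> V'" "t' \<in> \<Gamma> P V'"
      and W': "openin X W'" "x \<in> W'" "W' \<subseteq> U" "W' \<subseteq> V'" "restr P U W' s = restr P V' W' t'"
      by (cases p) (auto simp: mem_germ)
    have WW': "openin X (W \<inter> W')" using W W' by blast
    have "restr P V (W \<inter> W') t = restr P U (W \<inter> W') s"
      by (rule restr_eq_smaller[of V U W]) (use U V W WW' in auto)
    also have "\<dots> = restr P V' (W \<inter> W') t'"
      by (rule restr_eq_smaller[of U V' W']) (use U V' W' WW' in auto)
    finally have "restr P V (W \<inter> W') t = restr P V' (W \<inter> W') t'" .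
    then show ?thesis unfolding p mem_germ using V' WW' W W'
      by (intro conjI exI[of _ "W \<inter> W'"]) auto
  qed
  show ?thesis
    using *[OF U V W] *[OF V U W(1,2,4,3) W(5)[symmetric]] by blast
qed

lemma germ_eqD:
  assumes "openin X V" "x \<in> V" "t \<in> \<Gamma> P V" "G x U s = G x V t"
  obtains W where "openin X W" "x \<in> W" "W \<subseteq> U" "W \<subseteq> V" "restr P U W s = restr P V W t"
proof -
  have "(V, t) \<in> G x U s" using self_mem_germ assms by simp
  then show ?thesis using that unfolding mem_germ by auto
qed

lemma germ_restr:
  assumes "openin X U" "openin X W" "W \<subseteq> U" "x \<in> W" "s \<in> \<Gamma> P U"
  shows "G x W (restr P U W s) = G x U s"
  by (rule germ_eqI[where W = W]) (use assms p_closed p_id in auto)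

text \<open>All members of the union in \<open>germ_add\<close> are the germ of the sum: any other
  representatives agree with s and t on a common neighbourhood of x, and restriction is additive.
  Adding germs thus reduces to adding sections over one open set.\<close>

lemma germ_add_germ:
  assumes U: "openin X U" "x \<in> U" and s: "s \<in> \<Gamma> P U" and t: "t \<in> \<Gamma> P U"
  shows "germ_add X P x (G x U s) (G x U t) = G x U (s \<oplus>\<^bsub>sections P U\<^esub> t)"
proof -
  interpret U: module "sections \<O> U" "sections P U" using p_module U by blast
  have "G x (U' \<inter> V') (restr P U' (U' \<inter> V') s' \<oplus>\<^bsub>sections P (U' \<inter> V')\<^esub> restr P V' (U' \<inter> V') t') =
      G x U (s \<oplus>\<^bsub>sections P U\<^esub> t)" if 1: "(U', s') \<in> G x U s" and 2: "(V', t') \<in> G x U t" for U' s' V' t'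
  proof -
    obtain W1 where U': "openin X U'" "x \<in> U'" "s' \<in> \<Gamma> P U'"
      and W1: "openin X W1" "x \<in> W1" "W1 \<subseteq> U" "W1 \<subseteq> U'" "restr P U W1 s = restr P U' W1 s'"
      using 1 unfolding mem_germ by auto
    obtain W2 where V': "openin X V'" "x \<in> V'" "t' \<in> \<Gamma> P V'"
      and W2: "openin X W2" "x \<in> W2" "W2 \<subseteq> U" "W2 \<subseteq> V'" "restr P U W2 t = restr P V' W2 t'"
      using 2 unfolding mem_germ by auto
    define W where "W = W1 \<inter> W2"
    have W: "openin X W" "x \<in> W" "W \<subseteq> U" "W \<subseteq> U'" "W \<subseteq> V'" using W1 W2 by (auto simp: W_def)
    have UV: "openin X (U' \<inter> V')" using U' V' by blast
    interpret UV: module "sections \<O> (U' \<inter> V')" "sections P (U' \<inter> V')" using p_module UV by blast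
    have "restr P U W s = restr P U' W s'"
      by (rule restr_eq_smaller[of U U' W1]) (use U s U' W1 W in \<open>auto simp: W_def\<close>)
    moreover have "restr P U W t = restr P V' W t'"
      by (rule restr_eq_smaller[of U V' W2]) (use U t V' W2 W in \<open>auto simp: W_def\<close>)
    ultimately have "restr P (U' \<inter> V') W (restr P U' (U' \<inter> V') s' \<oplus>\<^bsub>sections P (U' \<inter> V')\<^esub> restr P V' (U' \<inter> V') t') =
        restr P U W (s \<oplus>\<^bsub>sections P U\<^esub> t)"
      using U U' V' W UV s t by (simp add: p_add p_comp p_closed)
    then show ?thesis
      by (intro germ_eqI[where W = W]) (use U U' V' W UV s t p_closed in auto)
  qed
  then show ?thesis
    unfolding germ_add_def using self_mem_germ[OF U s] self_mem_germ[OF U t]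
    by (intro UN_const_eq) (auto intro!: UN_const_eq)
qed

text \<open>The scalar lives on U and the representative on the smaller V. This is the situation
  when a section over U acts on a family of germs that is represented only locally.\<close>

lemma germ_smult_germ:
  assumes U: "openin X U" "openin X V" "V \<subseteq> U" "x \<in> V" and r: "r \<in> \<Gamma> \<O> U"
    and s: "s \<in> \<Gamma> P V"
  shows "germ_smult X \<O> P x U r (G x V s) = G x V (restr \<O> U V r \<odot>\<^bsub>sections P V\<^esub> s)"
proof -
  interpret V: module "sections \<O> V" "sections P V" using p_module U by blast
  have "G x (U \<inter> V') (restr \<O> U (U \<inter> V') r \<odot>\<^bsub>sections P (U \<inter> V')\<^esub> restr P V' (U \<inter> V') s') =
      G x V (restr \<O> U V r \<odot>\<^bsub>sections P V\<^esub> s)" if "(V', s') \<in> G x V s" for V' s'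
  proof -
    obtain W where V': "openin X V'" "x \<in> V'" "s' \<in> \<Gamma> P V'"
      and W: "openin X W" "x \<in> W" "W \<subseteq> V" "W \<subseteq> V'" "restr P V W s = restr P V' W s'"
      using \<open>(V', s') \<in> G x V s\<close> unfolding mem_germ by auto
    have UV: "openin X (U \<inter> V')" using U V' by blast
    interpret UV: module "sections \<O> (U \<inter> V')" "sections P (U \<inter> V')" using p_module UV by blast
    have "W \<subseteq> U" using U W by blast
    then have "restr P (U \<inter> V') W (restr \<O> U (U \<inter> V') r \<odot>\<^bsub>sections P (U \<inter> V')\<^esub> restr P V' (U \<inter> V') s') =
        restr P V W (restr \<O> U V r \<odot>\<^bsub>sections P V\<^esub> s)"
      using U V' W UV r s by (simp add: p_smult p_comp p_closed ring_restr_closed ring_restr_comp)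
    then show ?thesis
      by (intro germ_eqI[where W = W]) (use U V' W UV \<open>W \<subseteq> U\<close> r s p_closed ring_restr_closed in auto)
  qed
  then show ?thesis
    unfolding germ_smult_def using self_mem_germ[OF U(2,4) s]
    by (intro UN_const_eq) auto
qed

section \<open>The sheafification as a sheaf of modules\<close>

abbreviation Sh where "Sh \<equiv> sheafification X \<O> P"

text \<open>The domain of \<sigma> is deliberately absent, so that the same s can represent a family
  of germs and its restrictions.\<close>

definition rep :: "('x \<Rightarrow> ('x set \<times> 'm) set) \<Rightarrow> 'x set \<Rightarrow> 'm \<Rightarrow> bool" where
  "rep \<sigma> V s \<longleftrightarrow> openin X V \<and> s \<in> \<Gamma> P V \<and> (\<forall>y\<in>V. \<sigma> y = G y V s)"

lemma Sh_carrier: "\<sigma> \<in> \<Gamma> Sh U \<longleftrightarrow>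
    \<sigma> \<in> extensional U \<and> (\<forall>x\<in>U. \<exists>V s. x \<in> V \<and> V \<subseteq> U \<and> rep \<sigma> V s)"
  by (simp add: sheafification_def rep_def conj_ac)

lemma Sh_simps:
  "\<zero>\<^bsub>sections Sh U\<^esub> = (\<lambda>x\<in>U. G x U \<zero>\<^bsub>sections P U\<^esub>)"
  "\<sigma> \<oplus>\<^bsub>sections Sh U\<^esub> \<tau> = (\<lambda>x\<in>U. germ_add X P x (\<sigma> x) (\<tau> x))"
  "r \<odot>\<^bsub>sections Sh U\<^esub> \<sigma> = (\<lambda>x\<in>U. germ_smult X \<O> P x U r (\<sigma> x))"
  "restr Sh U V \<sigma> = restrict \<sigma> V"
  by (simp_all add: sheafification_def)

lemma rep_restr:
  assumes "rep \<sigma> V s" "openin X W" "W \<subseteq> V"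
  shows "rep \<sigma> W (restr P V W s)"
  using assms unfolding rep_def by (auto simp: germ_restr p_closed)

lemma rep_restrict: "\<lbrakk>rep \<sigma> V s; V \<subseteq> W\<rbrakk> \<Longrightarrow> rep (restrict \<sigma> W) V s"
  unfolding rep_def by auto

lemma rep_add:
  assumes "rep \<sigma> V s" "rep \<tau> V t" "V \<subseteq> U"
  shows "rep (\<sigma> \<oplus>\<^bsub>sections Sh U\<^esub> \<tau>) V (s \<oplus>\<^bsub>sections P V\<^esub> t)"
proof -
  interpret V: module "sections \<O> V" "sections P V" using p_module assms by (auto simp: rep_def)
  show ?thesis using assms unfolding rep_def by (auto simp: Sh_simps germ_add_germ)
qed

lemma rep_smult:
  assumes "rep \<sigma> V s" "V \<subseteq> U" "openin X U" "r \<in> \<Gamma> \<O> U"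
  shows "rep (r \<odot>\<^bsub>sections Sh U\<^esub> \<sigma>) V (restr \<O> U V r \<odot>\<^bsub>sections P V\<^esub> s)"
proof -
  interpret V: module "sections \<O> V" "sections P V" using p_module assms by (auto simp: rep_def)
  show ?thesis using assms unfolding rep_def by (auto simp: Sh_simps germ_smult_germ ring_restr_closed)
qed

text \<open>Zero is 0 times 0, so compatibility with the scalar action yields compatibility with
  zero.\<close>

lemma p_zero:
  assumes "openin X U" "openin X V" "V \<subseteq> U"
  shows "restr P U V \<zero>\<^bsub>sections P U\<^esub> = \<zero>\<^bsub>sections P V\<^esub>"
proof -
  interpret U: module "sections \<O> U" "sections P U" using p_module assms by blast
  interpret V: module "sections \<O> V" "sections P V" using p_module assms by blast
  interpret h: ring_hom_ring "sections \<O> U" "sections \<O> V" "restr \<O> U V"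
    using assms restr_ring_hom_ring by blast
  show ?thesis using p_smult[OF assms, of "\<zero>\<^bsub>sections \<O> U\<^esub>" "\<zero>\<^bsub>sections P U\<^esub>"] p_closed[OF assms] by simp
qed

lemma rep_zero:
  assumes "openin X V" "V \<subseteq> U" "openin X U"
  shows "rep \<zero>\<^bsub>sections Sh U\<^esub> V \<zero>\<^bsub>sections P V\<^esub>"
proof -
  interpret U: module "sections \<O> U" "sections P U" using p_module assms by blast
  interpret V: module "sections \<O> V" "sections P V" using p_module assms by blast
  show ?thesis using assms germ_restr[of U V _ "\<zero>\<^bsub>sections P U\<^esub>"] unfolding rep_def
    by (auto simp: Sh_simps p_zero)
qed

lemma obtain_rep:
  assumes "\<sigma> \<in> \<Gamma> Sh U" "x \<in> U"
  obtains V s where "x \<in> V" "V \<subseteq> U" "rep \<sigma> V s"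
proof -
  have "\<exists>V s. x \<in> V \<and> V \<subseteq> U \<and> rep \<sigma> V s"
    by (rule assms(1)[unfolded Sh_carrier, THEN conjunct2, rule_format, OF assms(2)])
  then show ?thesis by (elim exE conjE) (rule that)
qed

lemma rep_open: "rep \<sigma> V s \<Longrightarrow> openin X V"
  by (simp add: rep_def)

lemma rep_eq: "\<lbrakk>rep \<sigma> V s; rep \<tau> V s; x \<in> V\<rbrakk> \<Longrightarrow> \<sigma> x = \<tau> x"
  by (simp add: rep_def)

text \<open>Three families are what associativity of addition requires; laws in fewer variables
  repeat an argument.\<close>

lemma common_rep:
  assumes "\<sigma> \<in> \<Gamma> Sh U" "\<tau> \<in> \<Gamma> Sh U" "\<rho> \<in> \<Gamma> Sh U" "x \<in> U"
  obtains V s t r where "x \<in> V" "V \<subseteq> U" "rep \<sigma> V s" "rep \<tau> V t" "rep \<rho> V r"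
proof -
  obtain V1 s where 1: "x \<in> V1" "V1 \<subseteq> U" "rep \<sigma> V1 s" by (rule obtain_rep[OF assms(1,4)])
  obtain V2 t where 2: "x \<in> V2" "V2 \<subseteq> U" "rep \<tau> V2 t" by (rule obtain_rep[OF assms(2,4)])
  obtain V3 r where 3: "x \<in> V3" "V3 \<subseteq> U" "rep \<rho> V3 r" by (rule obtain_rep[OF assms(3,4)])
  have V: "openin X (V1 \<inter> V2 \<inter> V3)" using rep_open[OF 1(3)] rep_open[OF 2(3)] rep_open[OF 3(3)] by blast
  show ?thesis
    using 1 2 3 by (intro that[OF _ _ rep_restr[OF 1(3) V] rep_restr[OF 2(3) V] rep_restr[OF 3(3) V]]) auto
qed

lemma Sh_closed:
  "\<lbrakk>\<sigma> \<in> \<Gamma> Sh U; \<tau> \<in> \<Gamma> Sh U\<rbrakk> \<Longrightarrow> \<sigma> \<oplus>\<^bsub>sections Sh U\<^esub> \<tau> \<in> \<Gamma> Sh U"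
  "\<lbrakk>openin X U; r \<in> \<Gamma> \<O> U; \<sigma> \<in> \<Gamma> Sh U\<rbrakk> \<Longrightarrow> r \<odot>\<^bsub>sections Sh U\<^esub> \<sigma> \<in> \<Gamma> Sh U"
  "openin X U \<Longrightarrow> \<zero>\<^bsub>sections Sh U\<^esub> \<in> \<Gamma> Sh U"
proof -
  let ?S = "sections Sh U"
  show "\<sigma> \<oplus>\<^bsub>?S\<^esub> \<tau> \<in> carrier ?S" if 1: "\<sigma> \<in> carrier ?S" "\<tau> \<in> carrier ?S"
    unfolding Sh_carrier
  proof (intro conjI ballI)
    fix x assume "x \<in> U"
    from common_rep[OF 1 1(2) this] obtain V s t r where V: "x \<in> V" "V \<subseteq> U" "rep \<sigma> V s" "rep \<tau> V t" "rep \<tau> V r" .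
    then show "\<exists>V s. x \<in> V \<and> V \<subseteq> U \<and> rep (\<sigma> \<oplus>\<^bsub>?S\<^esub> \<tau>) V s"
      by (intro exI conjI) (rule V(1,2) rep_add[OF V(3,4,2)])+
  qed (simp add: Sh_simps)
  show "r \<odot>\<^bsub>?S\<^esub> \<sigma> \<in> carrier ?S" if 1: "openin X U" "r \<in> \<Gamma> \<O> U" "\<sigma> \<in> carrier ?S"
    unfolding Sh_carrier
  proof (intro conjI ballI)
    fix x assume "x \<in> U"
    from obtain_rep[OF 1(3) this] obtain V s where V: "x \<in> V" "V \<subseteq> U" "rep \<sigma> V s" .
    then show "\<exists>V s. x \<in> V \<and> V \<subseteq> U \<and> rep (r \<odot>\<^bsub>?S\<^esub> \<sigma>) V s"
      by (intro exI conjI) (rule V(1,2) rep_smult[OF V(3,2) 1(1,2)])+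
  qed (simp add: Sh_simps)
  show "\<zero>\<^bsub>?S\<^esub> \<in> carrier ?S" if U: "openin X U"
    unfolding Sh_carrier
  proof (intro conjI ballI)
    fix x assume "x \<in> U"
    then show "\<exists>V s. x \<in> V \<and> V \<subseteq> U \<and> rep \<zero>\<^bsub>?S\<^esub> V s"
      by (intro exI[of _ U] exI[of _ "\<zero>\<^bsub>sections P U\<^esub>"] conjI rep_zero U) auto
  qed (simp add: Sh_simps)
qed

lemma Sh_eqI:
  assumes "\<sigma> \<in> \<Gamma> Sh U" "\<tau> \<in> \<Gamma> Sh U"
    and "\<And>x. x \<in> U \<Longrightarrow> \<exists>V s. x \<in> V \<and> rep \<sigma> V s \<and> rep \<tau> V s"
  shows "\<sigma> = \<tau>"
proof (rule extensionalityI)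
  show "\<sigma> \<in> extensional U" "\<tau> \<in> extensional U"
    using assms(1,2)[unfolded Sh_carrier] by simp_all
  show "\<sigma> x = \<tau> x" if "x \<in> U" for x using assms(3)[OF that] by (elim exE conjE) (rule rep_eq)
qed

text \<open>An identity between at most three sections can be checked on common representatives, where it
  is an identity in a module of sections of \<open>P\<close>.\<close>

lemma Sh_eq_by_rep:
  assumes "\<upsilon> \<in> \<Gamma> Sh U" "\<upsilon>' \<in> \<Gamma> Sh U"
    and "\<sigma> \<in> \<Gamma> Sh U" "\<tau> \<in> \<Gamma> Sh U" "\<rho> \<in> \<Gamma> Sh U"
    and eq: "\<And>V s t r. \<lbrakk>V \<subseteq> U; rep \<sigma> V s; rep \<tau> V t; rep \<rho> V r\<rbrakk> \<Longrightarrow> \<exists>u u'. rep \<upsilon> V u \<and> rep \<upsilon>' V u' \<and> u = u'"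
  shows "\<upsilon> = \<upsilon>'"
proof (rule Sh_eqI[OF assms(1,2)])
  fix x assume x: "x \<in> U"
  obtain V s t r where V: "x \<in> V" "V \<subseteq> U" "rep \<sigma> V s" "rep \<tau> V t" "rep \<rho> V r"
    by (rule common_rep[OF assms(3-5) x])
  from eq[OF V(2-5)] obtain u u' where u: "rep \<upsilon> V u" "rep \<upsilon>' V u'" "u = u'" by (elim exE conjE) (rule that)
  show "\<exists>V s. x \<in> V \<and> rep \<upsilon> V s \<and> rep \<upsilon>' V s"
    by (intro exI conjI) (rule V(1) u(1) u(2)[folded u(3)])+
qed

lemma Sh_module: assumes U: "openin X U" shows "module (sections \<O> U) (sections Sh U)"
proof -
  let ?S = "sections Sh U" and ?r = "\<lambda>V. restr \<O> U V"
  note cl = Sh_closed(1) Sh_closed(2)[OF U] Sh_closed(3)[OF U]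
  note rs = rep_smult[OF _ _ U]
  interpret U: cring "sections \<O> U" using cring_sections U by blast
  have V: "module (sections \<O> V) (sections P V)" "s \<in> \<Gamma> P V"
    "ring_hom_ring (sections \<O> U) (sections \<O> V) (?r V)"
    if "V \<subseteq> U" "rep \<sigma> V s" for V \<sigma> s
    using p_module[OF rep_open[OF that(2)]] restr_ring_hom_ring[OF U rep_open[OF that(2)] that(1)] that(2)
    by (simp_all add: rep_def)
  \<comment> \<open>Additive inverses are supplied by the scalar -1, for which closure and local
    representatives are already available.\<close>
  have neg: "(\<ominus>\<^bsub>sections \<O> U\<^esub> \<one>\<^bsub>sections \<O> U\<^esub>) \<odot>\<^bsub>?S\<^esub> \<sigma> \<oplus>\<^bsub>?S\<^esub> \<sigma> = \<zero>\<^bsub>?S\<^esub>" if \<sigma>: "\<sigma> \<in> carrier ?S" for \<sigma>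
  proof (rule Sh_eq_by_rep[OF _ _ \<sigma> \<sigma> \<sigma>], intro cl U.a_inv_closed U.one_closed \<sigma>, rule cl)
    fix V s assume s: "V \<subseteq> U" "rep \<sigma> V s"
    interpret V: module "sections \<O> V" "sections P V" by (rule V[OF s])
    interpret h: ring_hom_ring "sections \<O> U" "sections \<O> V" "?r V" by (rule V[OF s])
    show "\<exists>u u'. rep ((\<ominus>\<^bsub>sections \<O> U\<^esub> \<one>\<^bsub>sections \<O> U\<^esub>) \<odot>\<^bsub>?S\<^esub> \<sigma> \<oplus>\<^bsub>?S\<^esub> \<sigma>) V u \<and> rep \<zero>\<^bsub>?S\<^esub> V u' \<and> u = u'"
      by (intro exI conjI, rule rep_add[OF rs[OF s(2,1)] s(2,1)], simp, rule rep_zero[OF rep_open[OF s(2)] s(1) U])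
        (simp add: V(2)[OF s] V.smult_l_minus V.M.l_neg)
  qed
  show ?thesis
  proof (rule moduleI)
    show "cring (sections \<O> U)" by (rule U.is_cring)
    show "abelian_group ?S"
    proof (rule abelian_groupI)
      fix \<sigma> assume \<sigma>: "\<sigma> \<in> carrier ?S"
      show "\<zero>\<^bsub>?S\<^esub> \<oplus>\<^bsub>?S\<^esub> \<sigma> = \<sigma>"
      proof (rule Sh_eq_by_rep[OF _ _ \<sigma> \<sigma> \<sigma>])
        fix V s assume s: "V \<subseteq> U" "rep \<sigma> V s"
        interpret V: module "sections \<O> V" "sections P V" by (rule V[OF s])
        show "\<exists>u u'. rep (\<zero>\<^bsub>?S\<^esub> \<oplus>\<^bsub>?S\<^esub> \<sigma>) V u \<and> rep \<sigma> V u' \<and> u = u'"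
          by (intro exI conjI, rule rep_add[OF rep_zero[OF rep_open[OF s(2)] s(1) U] s(2,1)], rule s(2))
            (simp add: V(2)[OF s])
      qed (intro cl \<sigma>)+
      show "\<exists>\<tau>\<in>carrier ?S. \<tau> \<oplus>\<^bsub>?S\<^esub> \<sigma> = \<zero>\<^bsub>?S\<^esub>"
        by (rule bexI[where x = "(\<ominus>\<^bsub>sections \<O> U\<^esub> \<one>\<^bsub>sections \<O> U\<^esub>) \<odot>\<^bsub>?S\<^esub> \<sigma>"])
          (rule neg[OF \<sigma>], intro cl U.a_inv_closed U.one_closed \<sigma>)
      fix \<tau> assume \<tau>: "\<tau> \<in> carrier ?S"
      show "\<sigma> \<oplus>\<^bsub>?S\<^esub> \<tau> = \<tau> \<oplus>\<^bsub>?S\<^esub> \<sigma>"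
      proof (rule Sh_eq_by_rep[OF _ _ \<sigma> \<tau> \<tau>])
        fix V s t assume s: "V \<subseteq> U" "rep \<sigma> V s" and t: "rep \<tau> V t"
        interpret V: module "sections \<O> V" "sections P V" by (rule V[OF s])
        show "\<exists>u u'. rep (\<sigma> \<oplus>\<^bsub>?S\<^esub> \<tau>) V u \<and> rep (\<tau> \<oplus>\<^bsub>?S\<^esub> \<sigma>) V u' \<and> u = u'"
          by (intro exI conjI, rule rep_add[OF s(2) t s(1)], rule rep_add[OF t s(2,1)])
            (rule V.M.a_comm[OF V(2)[OF s] V(2)[OF s(1) t]])
      qed (intro cl \<sigma> \<tau>)+
      fix \<rho> assume \<rho>: "\<rho> \<in> carrier ?S"
      show "\<sigma> \<oplus>\<^bsub>?S\<^esub> \<tau> \<oplus>\<^bsub>?S\<^esub> \<rho> = \<sigma> \<oplus>\<^bsub>?S\<^esub> (\<tau> \<oplus>\<^bsub>?S\<^esub> \<rho>)"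
      proof (rule Sh_eq_by_rep[OF _ _ \<sigma> \<tau> \<rho>])
        fix V s t r assume s: "V \<subseteq> U" "rep \<sigma> V s" and t: "rep \<tau> V t" and r: "rep \<rho> V r"
        interpret V: module "sections \<O> V" "sections P V" by (rule V[OF s])
        show "\<exists>u u'. rep (\<sigma> \<oplus>\<^bsub>?S\<^esub> \<tau> \<oplus>\<^bsub>?S\<^esub> \<rho>) V u \<and> rep (\<sigma> \<oplus>\<^bsub>?S\<^esub> (\<tau> \<oplus>\<^bsub>?S\<^esub> \<rho>)) V u' \<and> u = u'"
          by (intro exI conjI, rule rep_add[OF rep_add[OF s(2) t s(1)] r s(1)],
              rule rep_add[OF s(2) rep_add[OF t r s(1)] s(1)])
            (rule V.M.a_assoc[OF V(2)[OF s] V(2)[OF s(1) t] V(2)[OF s(1) r]])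
      qed (intro cl \<sigma> \<tau> \<rho>)+
    qed (use cl in auto)
  next
    fix a \<sigma> assume "a \<in> \<Gamma> \<O> U" "\<sigma> \<in> carrier ?S"
    then show "a \<odot>\<^bsub>?S\<^esub> \<sigma> \<in> carrier ?S" by (rule cl)
  next
    fix a b \<sigma> assume ab: "a \<in> \<Gamma> \<O> U" "b \<in> \<Gamma> \<O> U" and \<sigma>: "\<sigma> \<in> carrier ?S"
    have rep: "rep ((a \<oplus>\<^bsub>sections \<O> U\<^esub> b) \<odot>\<^bsub>?S\<^esub> \<sigma>) V (?r V (a \<oplus>\<^bsub>sections \<O> U\<^esub> b) \<odot>\<^bsub>sections P V\<^esub> s)"
      "rep (a \<odot>\<^bsub>?S\<^esub> \<sigma> \<oplus>\<^bsub>?S\<^esub> b \<odot>\<^bsub>?S\<^esub> \<sigma>) V (?r V a \<odot>\<^bsub>sections P V\<^esub> s \<oplus>\<^bsub>sections P V\<^esub> ?r V b \<odot>\<^bsub>sections P V\<^esub> s)"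
      "rep ((a \<otimes>\<^bsub>sections \<O> U\<^esub> b) \<odot>\<^bsub>?S\<^esub> \<sigma>) V (?r V (a \<otimes>\<^bsub>sections \<O> U\<^esub> b) \<odot>\<^bsub>sections P V\<^esub> s)"
      "rep (a \<odot>\<^bsub>?S\<^esub> (b \<odot>\<^bsub>?S\<^esub> \<sigma>)) V (?r V a \<odot>\<^bsub>sections P V\<^esub> (?r V b \<odot>\<^bsub>sections P V\<^esub> s))"
      "?r V (a \<oplus>\<^bsub>sections \<O> U\<^esub> b) \<odot>\<^bsub>sections P V\<^esub> s = ?r V a \<odot>\<^bsub>sections P V\<^esub> s \<oplus>\<^bsub>sections P V\<^esub> ?r V b \<odot>\<^bsub>sections P V\<^esub> s"
      "?r V (a \<otimes>\<^bsub>sections \<O> U\<^esub> b) \<odot>\<^bsub>sections P V\<^esub> s = ?r V a \<odot>\<^bsub>sections P V\<^esub> (?r V b \<odot>\<^bsub>sections P V\<^esub> s)"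
      if s: "V \<subseteq> U" "rep \<sigma> V s" for V s
    proof -
      interpret V: module "sections \<O> V" "sections P V" by (rule V[OF s])
      interpret h: ring_hom_ring "sections \<O> U" "sections \<O> V" "?r V" by (rule V[OF s])
      show "?r V (a \<oplus>\<^bsub>sections \<O> U\<^esub> b) \<odot>\<^bsub>sections P V\<^esub> s = ?r V a \<odot>\<^bsub>sections P V\<^esub> s \<oplus>\<^bsub>sections P V\<^esub> ?r V b \<odot>\<^bsub>sections P V\<^esub> s"
        "?r V (a \<otimes>\<^bsub>sections \<O> U\<^esub> b) \<odot>\<^bsub>sections P V\<^esub> s = ?r V a \<odot>\<^bsub>sections P V\<^esub> (?r V b \<odot>\<^bsub>sections P V\<^esub> s)"
        using ab V(2)[OF s] by (simp_all add: V.smult_l_distr V.smult_assoc1)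
    qed (rule rs[OF s(2,1) U.a_closed[OF ab]] rep_add[OF rs[OF s(2,1) ab(1)] rs[OF s(2,1) ab(2)] s(1)]
        rs[OF s(2,1) U.m_closed[OF ab]] rs[OF rs[OF s(2,1) ab(2)] s(1) ab(1)])+
    show "(a \<oplus>\<^bsub>sections \<O> U\<^esub> b) \<odot>\<^bsub>?S\<^esub> \<sigma> = a \<odot>\<^bsub>?S\<^esub> \<sigma> \<oplus>\<^bsub>?S\<^esub> b \<odot>\<^bsub>?S\<^esub> \<sigma>"
      by (rule Sh_eq_by_rep[OF _ _ \<sigma> \<sigma> \<sigma>], (intro cl U.a_closed ab \<sigma>)+) (intro exI conjI, (rule rep; assumption)+)
    show "(a \<otimes>\<^bsub>sections \<O> U\<^esub> b) \<odot>\<^bsub>?S\<^esub> \<sigma> = a \<odot>\<^bsub>?S\<^esub> (b \<odot>\<^bsub>?S\<^esub> \<sigma>)"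
      by (rule Sh_eq_by_rep[OF _ _ \<sigma> \<sigma> \<sigma>], (intro cl U.m_closed ab \<sigma>)+) (intro exI conjI, (rule rep; assumption)+)
  next
    fix a \<sigma> \<tau> assume a: "a \<in> \<Gamma> \<O> U" and \<sigma>: "\<sigma> \<in> carrier ?S" and \<tau>: "\<tau> \<in> carrier ?S"
    show "a \<odot>\<^bsub>?S\<^esub> (\<sigma> \<oplus>\<^bsub>?S\<^esub> \<tau>) = a \<odot>\<^bsub>?S\<^esub> \<sigma> \<oplus>\<^bsub>?S\<^esub> a \<odot>\<^bsub>?S\<^esub> \<tau>"
    proof (rule Sh_eq_by_rep[OF _ _ \<sigma> \<tau> \<tau>])
      fix V s t assume s: "V \<subseteq> U" "rep \<sigma> V s" and t: "rep \<tau> V t"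
      interpret V: module "sections \<O> V" "sections P V" by (rule V[OF s])
      show "\<exists>u u'. rep (a \<odot>\<^bsub>?S\<^esub> (\<sigma> \<oplus>\<^bsub>?S\<^esub> \<tau>)) V u \<and> rep (a \<odot>\<^bsub>?S\<^esub> \<sigma> \<oplus>\<^bsub>?S\<^esub> a \<odot>\<^bsub>?S\<^esub> \<tau>) V u' \<and> u = u'"
        by (intro exI conjI, rule rs[OF rep_add[OF s(2) t s(1)] s(1) a],
            rule rep_add[OF rs[OF s(2,1) a] rs[OF t s(1) a] s(1)])
          (rule V.smult_r_distr[OF ring_restr_closed[OF U rep_open[OF s(2)] s(1) a] V(2)[OF s] V(2)[OF s(1) t]])
    qed (intro cl a \<sigma> \<tau>)+
  next
    fix \<sigma> assume \<sigma>: "\<sigma> \<in> carrier ?S"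
    show "\<one>\<^bsub>sections \<O> U\<^esub> \<odot>\<^bsub>?S\<^esub> \<sigma> = \<sigma>"
    proof (rule Sh_eq_by_rep[OF _ _ \<sigma> \<sigma> \<sigma>])
      fix V s assume s: "V \<subseteq> U" "rep \<sigma> V s"
      interpret V: module "sections \<O> V" "sections P V" by (rule V[OF s])
      interpret h: ring_hom_ring "sections \<O> U" "sections \<O> V" "?r V" by (rule V[OF s])
      show "\<exists>u u'. rep (\<one>\<^bsub>sections \<O> U\<^esub> \<odot>\<^bsub>?S\<^esub> \<sigma>) V u \<and> rep \<sigma> V u' \<and> u = u'"
        by (intro exI conjI, rule rs[OF s(2,1) U.one_closed], rule s(2)) (simp add: V(2)[OF s])
    qed (intro cl U.one_closed \<sigma>)+
  qed
qed

lemma Sh_restr_closed: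
  assumes "openin X U" "openin X V" "V \<subseteq> U" "\<sigma> \<in> \<Gamma> Sh U"
  shows "restrict \<sigma> V \<in> \<Gamma> Sh V"
  unfolding Sh_carrier
proof (intro conjI ballI)
  fix x assume x: "x \<in> V"
  with assms(3) have "x \<in> U" by blast
  then obtain W s where W: "x \<in> W" "W \<subseteq> U" "rep \<sigma> W s" by (rule obtain_rep[OF assms(4)])
  have "openin X (V \<inter> W)" using assms(2) rep_open[OF W(3)] by blast
  then have "rep (restrict \<sigma> V) (V \<inter> W) (restr P W (V \<inter> W) s)"
    using W by (intro rep_restrict rep_restr) auto
  then show "\<exists>W s. x \<in> W \<and> W \<subseteq> V \<and> rep (restrict \<sigma> V) W s" using x W by blast
qed simp

text \<open>Sections are functions on points, so equality and gluing are pointwise; being locally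
  represented passes from the members of a cover to the glued function.\<close>

lemma sheaf_Sh: "sheaf X Sh"
proof
  fix U V s assume "openin X U" "openin X V" "V \<subseteq> U" "s \<in> \<Gamma> Sh U"
  then show "restr Sh U V s \<in> \<Gamma> Sh V" by (simp add: Sh_simps Sh_restr_closed)
next
  fix U s assume "openin X U" "s \<in> \<Gamma> Sh U"
  then show "restr Sh U U s = s" by (simp add: Sh_simps Sh_carrier extensional_restrict)
next
  fix U V W s assume "openin X U" "openin X V" "openin X W" "V \<subseteq> U" "W \<subseteq> V" "s \<in> \<Gamma> Sh U"
  then show "restr Sh V W (restr Sh U V s) = restr Sh U W s"
    by (auto simp: Sh_simps restrict_def fun_eq_iff)
next
  fix \<V> U s t assume *: "\<And>V. V \<in> \<V> \<Longrightarrow> openin X V" "U = \<Union>\<V>"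
    "s \<in> \<Gamma> Sh U" "t \<in> \<Gamma> Sh U"
    "\<And>V. V \<in> \<V> \<Longrightarrow> restr Sh U V s = restr Sh U V t"
  show "s = t"
  proof (rule extensionalityI)
    show "s \<in> extensional U" "t \<in> extensional U" using *(3,4)[unfolded Sh_carrier] by simp_all
    fix x assume "x \<in> U"
    then obtain V where "V \<in> \<V>" "x \<in> V" using * by blast
    then show "s x = t x" using *(5)[of V] by (auto simp: Sh_simps restrict_def fun_eq_iff split: if_splits)
  qed
next
  fix \<V> U and \<sigma> :: "'x set \<Rightarrow> 'x \<Rightarrow> ('x set \<times> 'm) set"
  assume op: "\<And>V. V \<in> \<V> \<Longrightarrow> openin X V" and U: "U = \<Union>\<V>"
    and \<sigma>: "\<And>V. V \<in> \<V> \<Longrightarrow> \<sigma> V \<in> \<Gamma> Sh V"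
    and compat: "\<And>V W. \<lbrakk>V \<in> \<V>; W \<in> \<V>\<rbrakk> \<Longrightarrow> restr Sh V (V \<inter> W) (\<sigma> V) = restr Sh W (V \<inter> W) (\<sigma> W)"
  have eq: "\<sigma> V x = \<sigma> W x" if "V \<in> \<V>" "W \<in> \<V>" "x \<in> V" "x \<in> W" for V W x
  proof -
    have "restrict (\<sigma> V) (V \<inter> W) x = restrict (\<sigma> W) (V \<inter> W) x"
      using compat[OF that(1,2)] by (simp add: Sh_simps)
    then show ?thesis using that by simp
  qed
  \<comment> \<open>The member of the cover that contains x is chosen arbitrarily; by compatibility
    on overlaps the value does not depend on the choice.\<close>
  define s where "s = (\<lambda>x\<in>U. \<sigma> (SOME V. V \<in> \<V> \<and> x \<in> V) x)"
  have s: "s x = \<sigma> V x" if "V \<in> \<V>" "x \<in> V" for V x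
  proof -
    let ?W = "SOME V. V \<in> \<V> \<and> x \<in> V"
    have W: "?W \<in> \<V> \<and> x \<in> ?W"
      by (rule someI[of _ V]) (use that in simp)
    have "x \<in> U" using that U by blast
    then have "s x = \<sigma> ?W x" by (simp add: s_def)
    also have "\<dots> = \<sigma> V x" by (rule eq) (use W that in auto)
    finally show ?thesis .
  qed
  show "\<exists>s\<in>\<Gamma> Sh U. \<forall>V\<in>\<V>. restr Sh U V s = \<sigma> V"
  proof (intro bexI ballI)
    fix V assume V: "V \<in> \<V>"
    have "restrict s V = \<sigma> V"
    proof (rule extensionalityI)
      show "\<sigma> V \<in> extensional V" using \<sigma>[OF V, unfolded Sh_carrier] by simp
    qed (use s V in auto)
    then show "restr Sh U V s = \<sigma> V" by (simp add: Sh_simps)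
  next
    show "s \<in> \<Gamma> Sh U"
      unfolding Sh_carrier
    proof (intro conjI ballI)
      show "s \<in> extensional U" by (simp add: s_def)
      fix x assume "x \<in> U"
      then obtain V where V: "V \<in> \<V>" "x \<in> V" using U by blast
      from obtain_rep[OF \<sigma>[OF V(1)] V(2)] obtain W t where W: "x \<in> W" "W \<subseteq> V" "rep (\<sigma> V) W t" .
      have "s y = \<sigma> V y" if "y \<in> W" for y using s[OF V(1)] W(2) that by blast
      with W(3) have "rep s W t" by (simp add: rep_def)
      moreover have "W \<subseteq> U" using W(2) V(1) U by blast
      ultimately show "\<exists>V t. x \<in> V \<and> V \<subseteq> U \<and> rep s V t" using W(1) by blast
    qed
  qed
qed

lemma module_sheaf_Sh: "module_sheaf X \<O> Sh"
proof -
  have "ringed_space X \<O>" by unfold_locales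
  moreover have "module_sheaf_axioms X \<O> Sh"
  proof (rule module_sheaf_axioms.intro)
    fix U V \<sigma> \<tau> assume "openin X U" "openin X V" "V \<subseteq> U"
    then show "restr Sh U V (\<sigma> \<oplus>\<^bsub>sections Sh U\<^esub> \<tau>) = restr Sh U V \<sigma> \<oplus>\<^bsub>sections Sh V\<^esub> restr Sh U V \<tau>"
      by (auto simp: Sh_simps restrict_def fun_eq_iff)
  next
    fix U V r \<sigma>
    assume *: "openin X U" "openin X V" "V \<subseteq> U" "r \<in> \<Gamma> \<O> U" "\<sigma> \<in> \<Gamma> Sh U"
    show "restr Sh U V (r \<odot>\<^bsub>sections Sh U\<^esub> \<sigma>) = restr \<O> U V r \<odot>\<^bsub>sections Sh V\<^esub> restr Sh U V \<sigma>"
    proof (rule extensionalityI)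
      fix x assume x: "x \<in> V"
      obtain W s where W: "x \<in> W" "W \<subseteq> V" "rep (restrict \<sigma> V) W s"
        by (rule obtain_rep[OF Sh_restr_closed[OF *(1,2,3,5)] x])
      \<comment> \<open>As W lies in V, a representative of the restricted family is one of \<sigma>
        itself. Both sides of the law thereby receive the same representative over W.\<close>
      then have W': "rep \<sigma> W s" unfolding rep_def by (metis restrict_apply' subsetD)
      have "restr \<O> V W (restr \<O> U V r) = restr \<O> U W r"
        using * W rep_open by (intro ring_restr_comp) auto
      then have "rep (restr \<O> U V r \<odot>\<^bsub>sections Sh V\<^esub> restrict \<sigma> V) W (restr \<O> U W r \<odot>\<^bsub>sections P W\<^esub> s)"
        using rep_smult[OF W(3,2), of "restr \<O> U V r"] * ring_restr_closed by simp
      moreover have "rep (r \<odot>\<^bsub>sections Sh U\<^esub> \<sigma>) W (restr \<O> U W r \<odot>\<^bsub>sections P W\<^esub> s)"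
        using rep_smult[OF W'] W * by auto
      ultimately show "restr Sh U V (r \<odot>\<^bsub>sections Sh U\<^esub> \<sigma>) x = (restr \<O> U V r \<odot>\<^bsub>sections Sh V\<^esub> restr Sh U V \<sigma>) x"
        using rep_eq[OF _ _ W(1)] x unfolding Sh_simps(4) restrict_apply'[OF x] by blast
    qed (simp only: Sh_simps(4) restrict_extensional, simp only: Sh_simps(3) restrict_extensional)
  qed (rule Sh_module)
  ultimately show ?thesis by (intro module_sheaf.intro sheaf_Sh)
qed

end

section \<open>Local isomorphisms and tensor product sheaves\<close>

definition module_iso ::
  "('a, 'r) ring_scheme \<Rightarrow> ('a, 'm) module \<Rightarrow> ('a, 'n) module \<Rightarrow> ('m \<Rightarrow> 'n) \<Rightarrow> bool" where
  "module_iso R M N h \<longleftrightarrow> bij_betw h (carrier M) (carrier N) \<and>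
     (\<forall>m\<in>carrier M. \<forall>m'\<in>carrier M. h (m \<oplus>\<^bsub>M\<^esub> m') = h m \<oplus>\<^bsub>N\<^esub> h m') \<and>
     (\<forall>r\<in>carrier R. \<forall>m\<in>carrier M. h (r \<odot>\<^bsub>M\<^esub> m) = r \<odot>\<^bsub>N\<^esub> h m)"

lemma module_isoD:
  assumes "module_iso R M N h"
  shows "bij_betw h (carrier M) (carrier N)"
    and "m \<in> carrier M \<Longrightarrow> h m \<in> carrier N"
    and "\<lbrakk>m \<in> carrier M; m' \<in> carrier M\<rbrakk> \<Longrightarrow> h (m \<oplus>\<^bsub>M\<^esub> m') = h m \<oplus>\<^bsub>N\<^esub> h m'"
    and "\<lbrakk>r \<in> carrier R; m \<in> carrier M\<rbrakk> \<Longrightarrow> h (r \<odot>\<^bsub>M\<^esub> m) = r \<odot>\<^bsub>N\<^esub> h m"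
    and "\<lbrakk>m \<in> carrier M; m' \<in> carrier M; h m = h m'\<rbrakk> \<Longrightarrow> m = m'"
  using assms unfolding module_iso_def bij_betw_def inj_on_def by blast+

text \<open>An isomorphism between the restrictions to V, as a natural family of components. No
  sheaf condition is built in, so a sheaf can be compared with a presheaf.\<close>

definition local_iso ::
  "'x topology \<Rightarrow> ('x, 'a, 'r) presheaf \<Rightarrow> ('x, 'a, 'm) module_presheaf \<Rightarrow> ('x, 'a, 'n) module_presheaf
    \<Rightarrow> 'x set \<Rightarrow> ('x set \<Rightarrow> 'm \<Rightarrow> 'n) \<Rightarrow> bool" where
  "local_iso X \<O> \<M> \<N> V \<Phi> \<longleftrightarrow> (\<forall>W. openin X W \<and> W \<subseteq> V \<longrightarrow>
     module_iso (sections \<O> W) (sections \<M> W) (sections \<N> W) (\<Phi> W) \<and>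
     (\<forall>W' m. openin X W' \<and> W' \<subseteq> W \<and> m \<in> \<Gamma> \<M> W \<longrightarrow>
        restr \<N> W W' (\<Phi> W m) = \<Phi> W' (restr \<M> W W' m)))"

lemma local_isoD:
  assumes "local_iso X \<O> \<M> \<N> V \<Phi>" "openin X W" "W \<subseteq> V"
  shows "module_iso (sections \<O> W) (sections \<M> W) (sections \<N> W) (\<Phi> W)"
    and "\<lbrakk>openin X W'; W' \<subseteq> W; m \<in> \<Gamma> \<M> W\<rbrakk> \<Longrightarrow>
      restr \<N> W W' (\<Phi> W m) = \<Phi> W' (restr \<M> W W' m)"
  using assms unfolding local_iso_def by simp_all

text \<open>Over V0 the presheaf is isomorphic to a sheaf, hence already a sheaf there. Sending a
  section to its family of germs is injective by locality of \<N>; it is surjective because local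
  representatives pull back to \<N> and glue there.\<close>

lemma (in presheaf_of_modules) sheafification_local_iso:
  assumes N: "module_sheaf X \<O> \<N>" and V0: "openin X V0" and iso: "local_iso X \<O> \<N> P V0 \<phi>"
  shows "local_iso X \<O> \<N> Sh V0 (\<lambda>W n. \<lambda>x\<in>W. G x W (\<phi> W n))"
proof -
  interpret N: module_sheaf X \<O> \<N> by fact
  define \<Phi> where "\<Phi> = (\<lambda>W n. \<lambda>x\<in>W. G x W (\<phi> W n))"
  note lin = module_isoD[OF local_isoD(1)[OF iso]] and \<phi>_restr = local_isoD(2)[OF iso]
  have \<Phi>_rep: "rep (\<Phi> W n) W (\<phi> W n)" if "openin X W" "W \<subseteq> V0" "n \<in> \<Gamma> \<N> W" for W n
    using that lin(2) by (simp add: rep_def \<Phi>_def)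
  have \<Phi>_closed: "\<Phi> W n \<in> \<Gamma> Sh W"
    if "openin X W" "W \<subseteq> V0" "n \<in> \<Gamma> \<N> W" for W n
    unfolding Sh_carrier
  proof (intro conjI ballI)
    show "\<Phi> W n \<in> extensional W" by (simp add: \<Phi>_def)
    show "\<exists>V s. x \<in> V \<and> V \<subseteq> W \<and> rep (\<Phi> W n) V s" if "x \<in> W" for x
      using that \<Phi>_rep[OF \<open>openin X W\<close> \<open>W \<subseteq> V0\<close> \<open>n \<in> \<Gamma> \<N> W\<close>] by blast
  qed
  \<comment> \<open>Equal germs in \<open>P\<close> come from sections of \<N> that agree near x,
    since \<phi> is natural and injective on a common smaller neighbourhood. Injectivity and the
    compatibility needed for gluing both rest on this.\<close>
  have local_eq: "\<exists>W'. openin X W' \<and> x \<in> W' \<and> W' \<subseteq> V \<inter> W \<and> restr \<N> V W' n = restr \<N> W W' n'"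
    if V: "openin X V" "V \<subseteq> V0" "n \<in> \<Gamma> \<N> V" "x \<in> V"
      and W: "openin X W" "W \<subseteq> V0" "n' \<in> \<Gamma> \<N> W" "x \<in> W"
      and eq: "G x V (\<phi> V n) = G x W (\<phi> W n')" for V W n n' x
  proof -
    obtain W' where W': "openin X W'" "x \<in> W'" "W' \<subseteq> V" "W' \<subseteq> W"
      and eq': "restr P V W' (\<phi> V n) = restr P W W' (\<phi> W n')"
      by (rule germ_eqD[OF W(1,4) lin(2)[OF W(1,2,3)] eq])
    have "W' \<subseteq> V0" using W' V by blast
    moreover have "\<phi> W' (restr \<N> V W' n) = \<phi> W' (restr \<N> W W' n')"
      using eq' \<phi>_restr[OF V(1,2) W'(1,3) V(3)] \<phi>_restr[OF W(1,2) W'(1,4) W(3)] by simp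
    ultimately have "restr \<N> V W' n = restr \<N> W W' n'"
      using lin(5)[OF W'(1)] N.mod_restr_closed[OF V(1) W'(1,3) V(3)] N.mod_restr_closed[OF W(1) W'(1,4) W(3)]
      by simp
    then show ?thesis using W' by auto
  qed
  have inj: "inj_on (\<Phi> W) (\<Gamma> \<N> W)" if W: "openin X W" "W \<subseteq> V0" for W
  proof (rule inj_onI)
    fix n n' assume n: "n \<in> \<Gamma> \<N> W" "n' \<in> \<Gamma> \<N> W" and eq: "\<Phi> W n = \<Phi> W n'"
    show "n = n'"
    proof (rule N.mod_section_eqI[OF W(1) n])
      fix x assume x: "x \<in> W"
      then have "G x W (\<phi> W n) = G x W (\<phi> W n')" using fun_cong[OF eq, of x] by (simp add: \<Phi>_def)
      then show "\<exists>W'. openin X W' \<and> x \<in> W' \<and> W' \<subseteq> W \<and> restr \<N> W W' n = restr \<N> W W' n'"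
        using local_eq[OF W n(1) x W n(2) x] by simp
    qed
  qed
  have surj: "\<exists>n\<in>\<Gamma> \<N> W. \<sigma> = \<Phi> W n"
    if W: "openin X W" "W \<subseteq> V0" and \<sigma>: "\<sigma> \<in> \<Gamma> Sh W" for W \<sigma>
  proof -
    define \<V> where "\<V> = {V. openin X V \<and> V \<subseteq> W \<and> (\<exists>s. rep \<sigma> V s)}"
    have op: "openin X V" "V \<subseteq> V0" "V \<subseteq> W" if "V \<in> \<V>" for V using that W unfolding \<V>_def by auto
    \<comment> \<open>Each local representative of \<sigma> is pulled back through \<phi>, because
      gluing is available in \<N> and not in \<open>P\<close>.\<close>
    have "\<exists>n. n \<in> \<Gamma> \<N> V \<and> rep \<sigma> V (\<phi> V n)" if V: "V \<in> \<V>" for V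
    proof -
      obtain s where s: "rep \<sigma> V s" using V unfolding \<V>_def by blast
      then have "s \<in> \<phi> V ` \<Gamma> \<N> V"
        using lin(1)[OF op(1,2)[OF V]] unfolding bij_betw_def rep_def by simp
      with s show ?thesis by auto
    qed
    then obtain \<nu> where \<nu>: "\<And>V. V \<in> \<V> \<Longrightarrow> \<nu> V \<in> \<Gamma> \<N> V" "\<And>V. V \<in> \<V> \<Longrightarrow> rep \<sigma> V (\<phi> V (\<nu> V))"
      by metis
    have cover: "W = \<Union>\<V>"
    proof
      show "W \<subseteq> \<Union>\<V>"
      proof
        fix x assume "x \<in> W"
        from obtain_rep[OF \<sigma> this] obtain V s where V: "x \<in> V" "V \<subseteq> W" "rep \<sigma> V s" .
        then have "V \<in> \<V>" unfolding \<V>_def using rep_open[OF V(3)] by blast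
        then show "x \<in> \<Union>\<V>" using V by blast
      qed
    qed (use op in blast)
    have compat: "restr \<N> V (V \<inter> V') (\<nu> V) = restr \<N> V' (V \<inter> V') (\<nu> V')" if V: "V \<in> \<V>" "V' \<in> \<V>" for V V'
    proof -
      note opV = op[OF V(1)] op[OF V(2)]
      have VV': "openin X (V \<inter> V')" using opV by blast
      show ?thesis
      proof (rule N.mod_section_eqI[OF VV'])
        show "restr \<N> V (V \<inter> V') (\<nu> V) \<in> \<Gamma> \<N> (V \<inter> V')"
          by (rule N.mod_restr_closed[OF opV(1) VV' _ \<nu>(1)[OF V(1)]]) simp
        show "restr \<N> V' (V \<inter> V') (\<nu> V') \<in> \<Gamma> \<N> (V \<inter> V')"
          by (rule N.mod_restr_closed[OF opV(4) VV' _ \<nu>(1)[OF V(2)]]) simp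
        fix x assume x: "x \<in> V \<inter> V'"
        have "\<sigma> x = G x V (\<phi> V (\<nu> V))" "\<sigma> x = G x V' (\<phi> V' (\<nu> V'))"
          using \<nu>(2)[OF V(1)] \<nu>(2)[OF V(2)] x unfolding rep_def by blast+
        then have "G x V (\<phi> V (\<nu> V)) = G x V' (\<phi> V' (\<nu> V'))" by metis
        then obtain W' where W': "openin X W'" "x \<in> W'" "W' \<subseteq> V \<inter> V'"
          "restr \<N> V W' (\<nu> V) = restr \<N> V' W' (\<nu> V')"
          using local_eq[OF opV(1,2) \<nu>(1)[OF V(1)] _ opV(4,5) \<nu>(1)[OF V(2)], of x] x by auto
        moreover have "restr \<N> (V \<inter> V') W' (restr \<N> V (V \<inter> V') (\<nu> V)) = restr \<N> V W' (\<nu> V)"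
          by (rule N.mod_restr_comp[OF opV(1) VV' W'(1) _ W'(3) \<nu>(1)[OF V(1)]]) simp
        moreover have "restr \<N> (V \<inter> V') W' (restr \<N> V' (V \<inter> V') (\<nu> V')) = restr \<N> V' W' (\<nu> V')"
          by (rule N.mod_restr_comp[OF opV(4) VV' W'(1) _ W'(3) \<nu>(1)[OF V(2)]]) simp
        ultimately show "\<exists>W'. openin X W' \<and> x \<in> W' \<and> W' \<subseteq> V \<inter> V' \<and>
            restr \<N> (V \<inter> V') W' (restr \<N> V (V \<inter> V') (\<nu> V)) =
            restr \<N> (V \<inter> V') W' (restr \<N> V' (V \<inter> V') (\<nu> V'))"
          by auto
      qed
    qed
    obtain n where n: "n \<in> \<Gamma> \<N> W" "\<And>V. V \<in> \<V> \<Longrightarrow> restr \<N> W V n = \<nu> V"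
      using N.mod_gluing[OF op(1) cover \<nu>(1) compat] by blast
    have "\<sigma> = \<Phi> W n"
    proof (rule Sh_eqI[OF \<sigma> \<Phi>_closed[OF W n(1)]])
      fix x assume "x \<in> W"
      then obtain V where V: "V \<in> \<V>" "x \<in> V" using cover by blast
      have "rep (\<Phi> W n) V (restr P W V (\<phi> W n))"
        by (rule rep_restr[OF \<Phi>_rep[OF W n(1)] op(1,3)[OF V(1)]])
      moreover have "restr P W V (\<phi> W n) = \<phi> V (\<nu> V)"
        using \<phi>_restr[OF W op(1,3)[OF V(1)] n(1)] n(2)[OF V(1)] by simp
      ultimately show "\<exists>V s. x \<in> V \<and> rep \<sigma> V s \<and> rep (\<Phi> W n) V s"
        using V(2) \<nu>(2)[OF V(1)] by auto
    qed
    then show ?thesis using n(1) by blast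
  qed
  have "local_iso X \<O> \<N> Sh V0 \<Phi>"
    unfolding local_iso_def module_iso_def
  proof (intro allI impI conjI ballI)
    fix W assume W': "openin X W \<and> W \<subseteq> V0"
    then have W: "openin X W" "W \<subseteq> V0" by auto
    interpret NW: module "sections \<O> W" "sections \<N> W" by (rule N.module_sections[OF W(1)])
    interpret PW: module "sections \<O> W" "sections P W" by (rule p_module[OF W(1)])
    show "bij_betw (\<Phi> W) (\<Gamma> \<N> W) (\<Gamma> Sh W)"
      unfolding bij_betw_def using inj[OF W] surj[OF W] \<Phi>_closed[OF W] by auto
    show "\<Phi> W (n \<oplus>\<^bsub>sections \<N> W\<^esub> n') = \<Phi> W n \<oplus>\<^bsub>sections Sh W\<^esub> \<Phi> W n'"
      if n: "n \<in> \<Gamma> \<N> W" "n' \<in> \<Gamma> \<N> W" for n n'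
      using n lin(2,3)[OF W] by (auto simp: \<Phi>_def Sh_simps germ_add_germ[OF W(1)] intro!: restrict_ext)
    show "\<Phi> W (r \<odot>\<^bsub>sections \<N> W\<^esub> n) = r \<odot>\<^bsub>sections Sh W\<^esub> \<Phi> W n"
      if n: "r \<in> \<Gamma> \<O> W" "n \<in> \<Gamma> \<N> W" for r n
      using n lin(2,4)[OF W]
      by (auto simp: \<Phi>_def Sh_simps germ_smult_germ[OF W(1,1)] ring_restr_id[OF W(1)] intro!: restrict_ext)
  next
    fix W W' n assume "openin X W \<and> W \<subseteq> V0" "openin X W' \<and> W' \<subseteq> W \<and> n \<in> \<Gamma> \<N> W"
    then have W: "openin X W" "W \<subseteq> V0" and W': "openin X W'" "W' \<subseteq> W" "n \<in> \<Gamma> \<N> W" by auto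
    have "rep (\<Phi> W n) W' (\<phi> W' (restr \<N> W W' n))"
      using rep_restr[OF \<Phi>_rep[OF W W'(3)] W'(1,2)] \<phi>_restr[OF W W'] by simp
    moreover have "W' \<subseteq> V0" using W W' by blast
    ultimately show "restr Sh W W' (\<Phi> W n) = \<Phi> W' (restr \<N> W W' n)"
      by (auto simp: Sh_simps \<Phi>_def rep_def restrict_def fun_eq_iff)
  qed
  then show ?thesis unfolding \<Phi>_def .
qed

section \<open>The tensor product presheaf and its sheafification\<close>

locale module_sheaf_pair = M: module_sheaf X \<O> \<M> + N: module_sheaf X \<O> \<N>
  for X :: "'x topology" and \<O> :: "('x, 's, 'r) presheaf"
    and \<M> :: "('x, 's, 'm) module_presheaf" and \<N> :: "('x, 's, 'n) module_presheaf"
begin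

abbreviation TP where "TP \<equiv> tensor_presheaf \<O> \<M> \<N>"

lemma TP_sections: "sections TP U = tensor_module (sections \<O> U) (sections \<M> U) (sections \<N> U)"
  by (simp add: tensor_presheaf_def)

lemma module_pair: "openin X U \<Longrightarrow> module_pair (sections \<O> U) (sections \<M> U) (sections \<N> U)"
  by (intro module_pair.intro M.module_sections N.module_sections)

text \<open>Restriction in both factors is semilinear over restriction of the ring, so the union
  that defines restriction of a tensor is a single coset.\<close>

lemma TP_restr_cls:
  assumes "openin X U" "openin X V" "V \<subseteq> U"
  shows "restr TP U V (tensor_class (sections \<O> U) (sections \<M> U) (sections \<N> U) z) =
    tensor_class (sections \<O> V) (sections \<M> V) (sections \<N> V) (frag_map2 (restr \<M> U V) (restr \<N> U V) z)"
proof -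
  interpret U: module_pair "sections \<O> U" "sections \<M> U" "sections \<N> U" by (rule module_pair) fact
  show ?thesis
    unfolding tensor_presheaf_def presheaf.simps frag_map2_def[symmetric]
    by (rule U.UN_cls[OF module_pair[OF assms(2)], where \<rho> = "restr \<O> U V"])
      (use assms in \<open>simp_all add: M.mod_restr_closed N.mod_restr_closed M.ring_restr_closed
        M.restr_add N.restr_add M.restr_smult N.restr_smult\<close>)
qed

lemma keys_restr:
  assumes "openin X U" "openin X V" "V \<subseteq> U"
    "Poly_Mapping.keys z \<subseteq> \<Gamma> \<M> U \<times> \<Gamma> \<N> U"
  shows "Poly_Mapping.keys (frag_map2 (restr \<M> U V) (restr \<N> U V) z) \<subseteq>
    \<Gamma> \<M> V \<times> \<Gamma> \<N> V"
  by (rule keys_frag_map2[OF assms(4)]) (use assms in \<open>simp_all add: M.mod_restr_closed N.mod_restr_closed\<close>)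

text \<open>Functoriality and compatibility with scalars hold for the maps between free abelian
  groups, where they are checked on pairs, and pass to cosets.\<close>

lemma presheaf_of_modules_TP: "presheaf_of_modules X \<O> TP"
proof (intro presheaf_of_modules.intro presheaf_of_modules_axioms.intro)
  show "ringed_space X \<O>" by unfold_locales
next
  fix U assume U: "openin X U"
  interpret U: module_pair "sections \<O> U" "sections \<M> U" "sections \<N> U" by (rule module_pair[OF U])
  show "module (sections \<O> U) (sections TP U)"
    unfolding TP_sections by (rule U.module_tensor)
  fix s assume "s \<in> \<Gamma> TP U"
  then obtain z where z: "Poly_Mapping.keys z \<subseteq> \<Gamma> \<M> U \<times> \<Gamma> \<N> U"
    and s: "s = U.cls z" unfolding TP_sections by (rule U.tensor_carrierE)
  have "frag_map2 (restr \<M> U U) (restr \<N> U U) z = z"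
    using z by (induction z rule: frag_pair_induct)
      (simp_all add: M.mod_restr_id[OF U] N.mod_restr_id[OF U])
  then show "restr TP U U s = s" by (simp add: s TP_restr_cls[OF U U])
next
  fix U V s assume U: "openin X U" "openin X V" "V \<subseteq> U" and "s \<in> \<Gamma> TP U"
  interpret U: module_pair "sections \<O> U" "sections \<M> U" "sections \<N> U" by (rule module_pair[OF U(1)])
  interpret V: module_pair "sections \<O> V" "sections \<M> V" "sections \<N> V" by (rule module_pair[OF U(2)])
  obtain z where z: "Poly_Mapping.keys z \<subseteq> \<Gamma> \<M> U \<times> \<Gamma> \<N> U"
    and s: "s = U.cls z" using \<open>s \<in> _\<close> unfolding TP_sections by (rule U.tensor_carrierE)
  show "restr TP U V s \<in> \<Gamma> TP V"
    unfolding TP_sections s TP_restr_cls[OF U] by (rule V.cls_closed[OF keys_restr[OF U z]])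
  fix t assume "t \<in> \<Gamma> TP U"
  then obtain z' where z': "Poly_Mapping.keys z' \<subseteq> \<Gamma> \<M> U \<times> \<Gamma> \<N> U"
    and t: "t = U.cls z'" unfolding TP_sections by (rule U.tensor_carrierE)
  show "restr TP U V (s \<oplus>\<^bsub>sections TP U\<^esub> t) = restr TP U V s \<oplus>\<^bsub>sections TP V\<^esub> restr TP U V t"
    unfolding TP_sections s t
    by (simp add: U.tensor_add[OF z z'] TP_restr_cls[OF U] V.tensor_add[OF keys_restr[OF U z] keys_restr[OF U z']])
next
  fix U V W s assume U: "openin X U" "openin X V" "openin X W" "V \<subseteq> U" "W \<subseteq> V" and "s \<in> \<Gamma> TP U"
  interpret U: module_pair "sections \<O> U" "sections \<M> U" "sections \<N> U" by (rule module_pair[OF U(1)])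
  obtain z where z: "Poly_Mapping.keys z \<subseteq> \<Gamma> \<M> U \<times> \<Gamma> \<N> U"
    and s: "s = U.cls z" using \<open>s \<in> _\<close> unfolding TP_sections by (rule U.tensor_carrierE)
  have "frag_map2 (restr \<M> V W) (restr \<N> V W) (frag_map2 (restr \<M> U V) (restr \<N> U V) z) =
      frag_map2 (restr \<M> U W) (restr \<N> U W) z"
    using z by (induction z rule: frag_pair_induct)
      (simp_all add: M.mod_restr_comp[OF U] N.mod_restr_comp[OF U])
  moreover have "W \<subseteq> U" using U by blast
  ultimately show "restr TP V W (restr TP U V s) = restr TP U W s"
    using U by (simp add: s TP_restr_cls)
next
  fix U V r s assume U: "openin X U" "openin X V" "V \<subseteq> U" and r: "r \<in> \<Gamma> \<O> U"
    and "s \<in> \<Gamma> TP U"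
  interpret U: module_pair "sections \<O> U" "sections \<M> U" "sections \<N> U" by (rule module_pair[OF U(1)])
  interpret V: module_pair "sections \<O> V" "sections \<M> V" "sections \<N> V" by (rule module_pair[OF U(2)])
  obtain z where z: "Poly_Mapping.keys z \<subseteq> \<Gamma> \<M> U \<times> \<Gamma> \<N> U"
    and s: "s = U.cls z" using \<open>s \<in> _\<close> unfolding TP_sections by (rule U.tensor_carrierE)
  have "frag_map2 (restr \<M> U V) (restr \<N> U V) (frag_map2 (\<lambda>m. r \<odot>\<^bsub>sections \<M> U\<^esub> m) (\<lambda>n. n) z) =
      frag_map2 (\<lambda>m. restr \<O> U V r \<odot>\<^bsub>sections \<M> V\<^esub> m) (\<lambda>n. n) (frag_map2 (restr \<M> U V) (restr \<N> U V) z)"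
    using z by (induction z rule: frag_pair_induct) (simp_all add: M.restr_smult[OF U r])
  then show "restr TP U V (r \<odot>\<^bsub>sections TP U\<^esub> s) = restr \<O> U V r \<odot>\<^bsub>sections TP V\<^esub> restr TP U V s"
    unfolding TP_sections s
    by (simp add: U.smult_cls[OF r] TP_restr_cls[OF U] V.smult_cls[OF M.ring_restr_closed[OF U r]])
qed

abbreviation pure_on where
  "pure_on U m n \<equiv> module_pair.pure (sections \<O> U) (sections \<M> U) (sections \<N> U) m n"

lemma TP_restr_pure:
  assumes "openin X U" "openin X V" "V \<subseteq> U"
  shows "restr TP U V (pure_on U m n) = pure_on V (restr \<M> U V m) (restr \<N> U V n)"
  using assms by (simp add: module_pair.pure_def module_pair TP_restr_cls)

text \<open>Over W the component is n to e \<otimes> n with e restricted to W. The generator has to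
  stay free over all smaller opens, because every component must be bijective.\<close>

lemma cyclic_left_local_iso:
  assumes V: "openin X V" and e: "e \<in> \<Gamma> \<M> V"
    and bij: "\<And>W. \<lbrakk>openin X W; W \<subseteq> V\<rbrakk> \<Longrightarrow>
      free_generator (sections \<O> W) (sections \<M> W) (restr \<M> V W e)"
  shows "local_iso X \<O> \<N> TP V (\<lambda>W n. pure_on W (restr \<M> V W e) n)"
  unfolding local_iso_def module_iso_def TP_sections
proof (intro allI impI conjI ballI)
  fix W assume "openin X W \<and> W \<subseteq> V"
  then have W: "openin X W" "W \<subseteq> V" by auto
  interpret W: module_pair "sections \<O> W" "sections \<M> W" "sections \<N> W" by (rule module_pair[OF W(1)])
  note eW = M.mod_restr_closed[OF V W e]
  show "bij_betw (W.pure (restr \<M> V W e)) (\<Gamma> \<N> W) (carrier W.T)"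
    by (rule W.cyclic_tensor_bij[OF eW bij[OF W]])
  show "W.pure (restr \<M> V W e) (n \<oplus>\<^bsub>sections \<N> W\<^esub> n') =
      W.pure (restr \<M> V W e) n \<oplus>\<^bsub>W.T\<^esub> W.pure (restr \<M> V W e) n'"
    if "n \<in> \<Gamma> \<N> W" "n' \<in> \<Gamma> \<N> W" for n n'
    by (rule W.pure_addR[OF eW that])
  show "W.pure (restr \<M> V W e) (r \<odot>\<^bsub>sections \<N> W\<^esub> n) = r \<odot>\<^bsub>W.T\<^esub> W.pure (restr \<M> V W e) n"
    if "r \<in> \<Gamma> \<O> W" "n \<in> \<Gamma> \<N> W" for r n
    by (rule W.pure_smultR[OF that(1) eW that(2)])
next
  fix W W' n assume "openin X W \<and> W \<subseteq> V" "openin X W' \<and> W' \<subseteq> W \<and> n \<in> \<Gamma> \<N> W"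
  then show "restr TP W W' (pure_on W (restr \<M> V W e) n) = pure_on W' (restr \<M> V W' e) (restr \<N> W W' n)"
    using V e by (simp add: TP_restr_pure M.mod_restr_comp)
qed

lemma cyclic_right_local_iso:
  assumes V: "openin X V" and e: "e \<in> \<Gamma> \<N> V"
    and bij: "\<And>W. \<lbrakk>openin X W; W \<subseteq> V\<rbrakk> \<Longrightarrow>
      free_generator (sections \<O> W) (sections \<N> W) (restr \<N> V W e)"
  shows "local_iso X \<O> \<M> TP V (\<lambda>W m. pure_on W m (restr \<N> V W e))"
  unfolding local_iso_def module_iso_def TP_sections
proof (intro allI impI conjI ballI)
  fix W assume "openin X W \<and> W \<subseteq> V"
  then have W: "openin X W" "W \<subseteq> V" by auto
  interpret W: module_pair "sections \<O> W" "sections \<M> W" "sections \<N> W" by (rule module_pair[OF W(1)])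
  note eW = N.mod_restr_closed[OF V W e]
  show "bij_betw (\<lambda>m. W.pure m (restr \<N> V W e)) (\<Gamma> \<M> W) (carrier W.T)"
    by (rule cyclic_tensor_bij'[OF module_pair[OF W(1)] eW bij[OF W]])
  show "W.pure (m \<oplus>\<^bsub>sections \<M> W\<^esub> m') (restr \<N> V W e) =
      W.pure m (restr \<N> V W e) \<oplus>\<^bsub>W.T\<^esub> W.pure m' (restr \<N> V W e)"
    if "m \<in> \<Gamma> \<M> W" "m' \<in> \<Gamma> \<M> W" for m m'
    by (rule W.pure_addL[OF that eW])
  show "W.pure (r \<odot>\<^bsub>sections \<M> W\<^esub> m) (restr \<N> V W e) = r \<odot>\<^bsub>W.T\<^esub> W.pure m (restr \<N> V W e)"
    if "r \<in> \<Gamma> \<O> W" "m \<in> \<Gamma> \<M> W" for r m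
    by (rule W.pure_smultL[OF that eW])
next
  fix W W' m assume "openin X W \<and> W \<subseteq> V" "openin X W' \<and> W' \<subseteq> W \<and> m \<in> \<Gamma> \<M> W"
  then show "restr TP W W' (pure_on W m (restr \<N> V W e)) = pure_on W' (restr \<M> W W' m) (restr \<N> V W' e)"
    using V e by (simp add: TP_restr_pure N.mod_restr_comp)
qed

lemma module_sheaf_tensor: "module_sheaf X \<O> (tensor_sheaf X \<O> \<M> \<N>)"
  unfolding tensor_sheaf_def by (rule presheaf_of_modules.module_sheaf_Sh[OF presheaf_of_modules_TP])

lemma tensor_local_iso_left:
  assumes "openin X V" "e \<in> \<Gamma> \<M> V"
    and "\<And>W. \<lbrakk>openin X W; W \<subseteq> V\<rbrakk> \<Longrightarrow>
      free_generator (sections \<O> W) (sections \<M> W) (restr \<M> V W e)"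
  shows "\<exists>\<Phi>. local_iso X \<O> \<N> (tensor_sheaf X \<O> \<M> \<N>) V \<Phi>"
  unfolding tensor_sheaf_def
  by (rule exI, rule presheaf_of_modules.sheafification_local_iso[OF presheaf_of_modules_TP _ assms(1)
      cyclic_left_local_iso[OF assms]]) unfold_locales

lemma tensor_local_iso_right:
  assumes "openin X V" "e \<in> \<Gamma> \<N> V"
    and "\<And>W. \<lbrakk>openin X W; W \<subseteq> V\<rbrakk> \<Longrightarrow>
      free_generator (sections \<O> W) (sections \<N> W) (restr \<N> V W e)"
  shows "\<exists>\<Phi>. local_iso X \<O> \<M> (tensor_sheaf X \<O> \<M> \<N>) V \<Phi>"
  unfolding tensor_sheaf_def
  by (rule exI, rule presheaf_of_modules.sheafification_local_iso[OF presheaf_of_modules_TP _ assms(1)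
      cyclic_right_local_iso[OF assms]]) unfold_locales

end

section \<open>Points of affine open sets\<close>

context cring begin

section \<open>Fractions at a prime ideal\<close>

context
  fixes p assumes p: "primeideal p R"
begin

lemma prime_compl:
  "\<lbrakk>s \<in> carrier R - p; t \<in> carrier R - p\<rbrakk> \<Longrightarrow> s \<otimes> t \<in> carrier R - p" "\<one> \<in> carrier R - p"
proof -
  interpret p: primeideal p R by (rule p)
  show "s \<otimes> t \<in> carrier R - p" if "s \<in> carrier R - p" "t \<in> carrier R - p"
    using that p.I_prime by auto
  show "\<one> \<in> carrier R - p" using p.one_imp_carrier p.I_notcarr by auto
qed

text \<open>Trades the subtraction in the definition for an equation between products, where
  associativity and commutativity suffice.\<close>

lemma mem_fraction:
  assumes "a \<in> carrier R" "s \<in> carrier R - p"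
  shows "(b, t) \<in> fraction R p a s \<longleftrightarrow> b \<in> carrier R \<and> t \<in> carrier R - p \<and>
    (\<exists>u\<in>carrier R - p. u \<otimes> (t \<otimes> a) = u \<otimes> (s \<otimes> b))"
proof -
  have "u \<otimes> (t \<otimes> a \<ominus> s \<otimes> b) = \<zero> \<longleftrightarrow> u \<otimes> (t \<otimes> a) = u \<otimes> (s \<otimes> b)"
    if [simp]: "u \<in> carrier R" "b \<in> carrier R" "t \<in> carrier R" for u
  proof -
    have [simp]: "s \<in> carrier R" "a \<in> carrier R" using assms by auto
    show ?thesis by (simp add: mult_diff_distrib diff_eq_iff)
  qed
  then show ?thesis unfolding fraction_def by auto
qed

lemma fraction_eqI:
  assumes a: "a \<in> carrier R" "s \<in> carrier R - p" and b: "b \<in> carrier R" "t \<in> carrier R - p"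
    and u: "u \<in> carrier R - p" "u \<otimes> (t \<otimes> a) = u \<otimes> (s \<otimes> b)"
  shows "fraction R p a s = fraction R p b t"
proof -
  have *: "x \<in> fraction R p b t" if x: "x \<in> fraction R p a s"
    and a: "a \<in> carrier R" "s \<in> carrier R - p" and b: "b \<in> carrier R" "t \<in> carrier R - p"
    and u: "u \<in> carrier R - p" "u \<otimes> (t \<otimes> a) = u \<otimes> (s \<otimes> b)" for a s b t u x
  proof -
    obtain c v w where xcv: "x = (c, v)" and c: "c \<in> carrier R" "v \<in> carrier R - p" "w \<in> carrier R - p"
      and w: "w \<otimes> (v \<otimes> a) = w \<otimes> (s \<otimes> c)"
      using x a by (cases x) (auto simp: mem_fraction)
    have [simp]: "a \<in> carrier R" "s \<in> carrier R" "b \<in> carrier R" "t \<in> carrier R" "u \<in> carrier R"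
      "c \<in> carrier R" "v \<in> carrier R" "w \<in> carrier R" using a b c u by auto
    \<comment> \<open>The multiplier is s u w: the multipliers of the two given equalities, together
      with the denominator s of the middle fraction a/s that is eliminated.\<close>
    have "(s \<otimes> (u \<otimes> w)) \<otimes> (v \<otimes> b) = (w \<otimes> v) \<otimes> (u \<otimes> (s \<otimes> b))" by (simp add: m_ac)
    also have "\<dots> = (u \<otimes> t) \<otimes> (w \<otimes> (v \<otimes> a))" unfolding u(2)[symmetric] by (simp add: m_ac)
    also have "\<dots> = (s \<otimes> (u \<otimes> w)) \<otimes> (t \<otimes> c)" unfolding w by (simp add: m_ac)
    finally have "(s \<otimes> (u \<otimes> w)) \<otimes> (v \<otimes> b) = (s \<otimes> (u \<otimes> w)) \<otimes> (t \<otimes> c)" .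
    moreover have "s \<otimes> (u \<otimes> w) \<in> carrier R - p" using a u c by (intro prime_compl)
    ultimately show ?thesis unfolding xcv using b c by (auto simp: mem_fraction)
  qed
  show ?thesis using *[OF _ a b u] *[OF _ b a u(1) u(2)[symmetric]] by blast
qed

lemma fraction_eqD:
  assumes a: "a \<in> carrier R" "s \<in> carrier R - p" and b: "b \<in> carrier R" "t \<in> carrier R - p"
    and eq: "fraction R p a s = fraction R p b t"
  obtains u where "u \<in> carrier R - p" "u \<otimes> (t \<otimes> a) = u \<otimes> (s \<otimes> b)"
proof -
  have "(b, t) \<in> fraction R p b t" using b prime_compl(2) by (auto simp: mem_fraction)
  then have "(b, t) \<in> fraction R p a s" by (simp only: eq)
  then show ?thesis using that unfolding mem_fraction[OF a] by blast
qed

text \<open>The fractions with numerator in p form the maximal ideal of the localisation. The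
  condition does not depend on the fraction chosen, as u, s and t lie outside the prime p.\<close>

lemma fraction_numerator_mem:
  assumes a: "a \<in> carrier R" "s \<in> carrier R - p" and b: "b \<in> carrier R" "t \<in> carrier R - p"
    and eq: "fraction R p a s = fraction R p b t"
  shows "a \<in> p \<longleftrightarrow> b \<in> p"
proof -
  interpret p: primeideal p R by (rule p)
  obtain u where u: "u \<in> carrier R - p" "u \<otimes> (t \<otimes> a) = u \<otimes> (s \<otimes> b)"
    by (rule fraction_eqD[OF a b eq])
  have "u \<otimes> (t \<otimes> a) \<in> p \<longleftrightarrow> a \<in> p" if "t \<in> carrier R - p" "a \<in> carrier R" for t a
    using that u(1) p.I_prime p.I_l_closed by (metis DiffE m_closed)
  then show ?thesis using u a b by metis
qed

text \<open>Treats sum and product at once. The assumption \<open>op\<close> compares numerators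
  after cross-multiplication, with the product u w of the multipliers of both arguments; it is an
  identity in the ring, and the prime enters only through closure of its complement under
  products.\<close>

lemma UN_fraction_eq:
  assumes a: "a \<in> carrier R" "s \<in> carrier R - p" and b: "b \<in> carrier R" "t \<in> carrier R - p"
    and op: "\<And>a s a' s' b t b' t' u w. \<lbrakk>{a, a', b, b'} \<subseteq> carrier R; {s, s', t, t', u, w} \<subseteq> carrier R;
      u \<otimes> (s' \<otimes> a) = u \<otimes> (s \<otimes> a'); w \<otimes> (t' \<otimes> b) = w \<otimes> (t \<otimes> b')\<rbrakk> \<Longrightarrow>
      op a s b t \<in> carrier R \<and>
      (u \<otimes> w) \<otimes> ((s' \<otimes> t') \<otimes> op a s b t) = (u \<otimes> w) \<otimes> ((s \<otimes> t) \<otimes> op a' s' b' t')"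
  shows "(\<Union>(a, s)\<in>fraction R p a s. \<Union>(b, t)\<in>fraction R p b t. fraction R p (op a s b t) (s \<otimes> t)) =
    fraction R p (op a s b t) (s \<otimes> t)"
proof -
  have *: "fraction R p (op a' s' b' t') (s' \<otimes> t') = fraction R p (op a s b t) (s \<otimes> t)"
    if as: "(a', s') \<in> fraction R p a s" and bt: "(b', t') \<in> fraction R p b t" for a' s' b' t'
  proof -
    obtain u where a': "a' \<in> carrier R" "s' \<in> carrier R - p" and u: "u \<in> carrier R - p"
      and ueq: "u \<otimes> (s' \<otimes> a) = u \<otimes> (s \<otimes> a')" using as a by (auto simp: mem_fraction)
    obtain w where b': "b' \<in> carrier R" "t' \<in> carrier R - p" and w: "w \<in> carrier R - p"
      and weq: "w \<otimes> (t' \<otimes> b) = w \<otimes> (t \<otimes> b')" using bt b by (auto simp: mem_fraction)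
    have 1: "op a s b t \<in> carrier R"
      "(u \<otimes> w) \<otimes> ((s' \<otimes> t') \<otimes> op a s b t) = (u \<otimes> w) \<otimes> ((s \<otimes> t) \<otimes> op a' s' b' t')"
      using op[OF _ _ ueq weq] a b a' b' u w by simp_all
    have 2: "op a' s' b' t' \<in> carrier R"
      using op[OF _ _ ueq[symmetric] weq[symmetric]] a b a' b' u w by simp
    show ?thesis
      by (rule fraction_eqI[where u = "u \<otimes> w", symmetric]; (intro 1 2 prime_compl(1) a b a' b' u w)?)
  qed
  have "(a, s) \<in> fraction R p a s" "(b, t) \<in> fraction R p b t"
    using a b prime_compl(2) by (auto simp: mem_fraction)
  then show ?thesis using * by fast
qed

lemma fraction_add_fraction:
  assumes "a \<in> carrier R" "s \<in> carrier R - p" "b \<in> carrier R" "t \<in> carrier R - p"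
  shows "fraction_add R p (fraction R p a s) (fraction R p b t) = fraction R p (a \<otimes> t \<oplus> b \<otimes> s) (s \<otimes> t)"
  unfolding fraction_add_def
proof (rule UN_fraction_eq[OF assms, where op = "\<lambda>a s b t. a \<otimes> t \<oplus> b \<otimes> s"], intro conjI)
  fix a s a' s' b t b' t' u w
  assume "{a, a', b, b'} \<subseteq> carrier R" "{s, s', t, t', u, w} \<subseteq> carrier R"
    and eq: "u \<otimes> (s' \<otimes> a) = u \<otimes> (s \<otimes> a')" "w \<otimes> (t' \<otimes> b) = w \<otimes> (t \<otimes> b')"
  then have [simp]: "a \<in> carrier R" "s \<in> carrier R" "b \<in> carrier R" "t \<in> carrier R" "u \<in> carrier R"
    "a' \<in> carrier R" "s' \<in> carrier R" "b' \<in> carrier R" "t' \<in> carrier R" "w \<in> carrier R" by auto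
  show "a \<otimes> t \<oplus> b \<otimes> s \<in> carrier R" by simp
  have "(u \<otimes> w) \<otimes> ((s' \<otimes> t') \<otimes> (a \<otimes> t \<oplus> b \<otimes> s)) =
      (w \<otimes> t' \<otimes> t) \<otimes> (u \<otimes> (s' \<otimes> a)) \<oplus> (u \<otimes> s' \<otimes> s) \<otimes> (w \<otimes> (t' \<otimes> b))"
    by (simp add: r_distr m_ac)
  also have "\<dots> = (u \<otimes> w) \<otimes> ((s \<otimes> t) \<otimes> (a' \<otimes> t' \<oplus> b' \<otimes> s'))"
    unfolding eq by (simp add: r_distr m_ac)
  finally show "(u \<otimes> w) \<otimes> ((s' \<otimes> t') \<otimes> (a \<otimes> t \<oplus> b \<otimes> s)) = (u \<otimes> w) \<otimes> ((s \<otimes> t) \<otimes> (a' \<otimes> t' \<oplus> b' \<otimes> s'))" .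
qed

lemma fraction_mult_fraction:
  assumes "a \<in> carrier R" "s \<in> carrier R - p" "b \<in> carrier R" "t \<in> carrier R - p"
  shows "fraction_mult R p (fraction R p a s) (fraction R p b t) = fraction R p (a \<otimes> b) (s \<otimes> t)"
  unfolding fraction_mult_def
proof (rule UN_fraction_eq[OF assms, where op = "\<lambda>a s b t. a \<otimes> b"], intro conjI)
  fix a s a' s' b t b' t' u w
  assume "{a, a', b, b'} \<subseteq> carrier R" "{s, s', t, t', u, w} \<subseteq> carrier R"
    and eq: "u \<otimes> (s' \<otimes> a) = u \<otimes> (s \<otimes> a')" "w \<otimes> (t' \<otimes> b) = w \<otimes> (t \<otimes> b')"
  then have [simp]: "a \<in> carrier R" "s \<in> carrier R" "b \<in> carrier R" "t \<in> carrier R" "u \<in> carrier R"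
    "a' \<in> carrier R" "s' \<in> carrier R" "b' \<in> carrier R" "t' \<in> carrier R" "w \<in> carrier R" by auto
  show "a \<otimes> b \<in> carrier R" by simp
  have "(u \<otimes> w) \<otimes> ((s' \<otimes> t') \<otimes> (a \<otimes> b)) = (u \<otimes> (s' \<otimes> a)) \<otimes> (w \<otimes> (t' \<otimes> b))"
    by (simp add: m_ac)
  also have "\<dots> = (u \<otimes> w) \<otimes> ((s \<otimes> t) \<otimes> (a' \<otimes> b'))"
    unfolding eq by (simp add: m_ac)
  finally show "(u \<otimes> w) \<otimes> ((s' \<otimes> t') \<otimes> (a \<otimes> b)) = (u \<otimes> w) \<otimes> ((s \<otimes> t) \<otimes> (a' \<otimes> b'))" .
qed

end

section \<open>Sections over open sets of the spectrum\<close>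

lemma Spec_basic_open: "f \<in> carrier R \<Longrightarrow> openin (Spec R) {p. primeideal p R \<and> f \<notin> p}"
  unfolding Spec_def by (rule topology_generated_by_Basis) blast

lemma Spec_prime: "openin (Spec R) V \<Longrightarrow> q \<in> V \<Longrightarrow> primeideal q R"
  using openin_subset[of "Spec R" V] unfolding Spec_def topology_generated_by_topspace by blast

text \<open>Where the arguments are a/f and b/g on two neighbourhoods of a prime, the result is a
  single fraction with denominator f g on their intersection; \<open>num\<close> stands for the
  numerator of the sum or of the product.\<close>

lemma Spec_sections_pointwise:
  assumes \<sigma>: "\<sigma> \<in> Spec_sections R W" and \<tau>: "\<tau> \<in> Spec_sections R W"
    and op: "\<And>q a f b g. \<lbrakk>primeideal q R; a \<in> carrier R; f \<in> carrier R - q; b \<in> carrier R; g \<in> carrier R - q\<rbrakk> \<Longrightarrow>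
      F q (fraction R q a f) (fraction R q b g) = fraction R q (num a f b g) (f \<otimes> g)"
    and num: "\<And>a f b g. \<lbrakk>a \<in> carrier R; f \<in> carrier R; b \<in> carrier R; g \<in> carrier R\<rbrakk> \<Longrightarrow> num a f b g \<in> carrier R"
  shows "(\<lambda>p\<in>W. F p (\<sigma> p) (\<tau> p)) \<in> Spec_sections R W"
  unfolding Spec_sections_def
proof (intro CollectI conjI ballI)
  fix p assume p: "p \<in> W"
  obtain V a f where V: "openin (Spec R) V" "p \<in> V" "V \<subseteq> W" "a \<in> carrier R" "f \<in> carrier R"
    and \<sigma>V: "\<forall>q\<in>V. f \<notin> q \<and> \<sigma> q = fraction R q a f"
    using \<sigma> p unfolding Spec_sections_def by blast
  obtain V' b g where V': "openin (Spec R) V'" "p \<in> V'" "V' \<subseteq> W" "b \<in> carrier R" "g \<in> carrier R"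
    and \<tau>V: "\<forall>q\<in>V'. g \<notin> q \<and> \<tau> q = fraction R q b g"
    using \<tau> p unfolding Spec_sections_def by blast
  have "f \<otimes> g \<notin> q \<and> (\<lambda>p\<in>W. F p (\<sigma> p) (\<tau> p)) q = fraction R q (num a f b g) (f \<otimes> g)"
    if q: "q \<in> V \<inter> V'" for q
  proof -
    have prime: "primeideal q R" using Spec_prime V(1) q by blast
    have fg: "f \<in> carrier R - q" "g \<in> carrier R - q" using q \<sigma>V \<tau>V V V' by auto
    show ?thesis
      using prime_compl(1)[OF prime fg] op[OF prime V(4) fg(1) V'(4) fg(2)] q \<sigma>V \<tau>V V by auto
  qed
  moreover have "openin (Spec R) (V \<inter> V')" using V V' by blast
  ultimately show "\<exists>V a f. openin (Spec R) V \<and> p \<in> V \<and> V \<subseteq> W \<and> a \<in> carrier R \<and> f \<in> carrier R \<and>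
      (\<forall>q\<in>V. f \<notin> q \<and> (\<lambda>p\<in>W. F p (\<sigma> p) (\<tau> p)) q = fraction R q a f)"
    using V V' num by (intro exI[of _ "V \<inter> V'"] exI[of _ "num a f b g"] exI[of _ "f \<otimes> g"]) auto
qed simp

lemma Spec_sections_add:
  assumes "\<sigma> \<in> Spec_sections R W" "\<tau> \<in> Spec_sections R W"
  shows "(\<lambda>p\<in>W. fraction_add R p (\<sigma> p) (\<tau> p)) \<in> Spec_sections R W"
  by (rule Spec_sections_pointwise[OF assms fraction_add_fraction]) auto

lemma Spec_sections_mult:
  assumes "\<sigma> \<in> Spec_sections R W" "\<tau> \<in> Spec_sections R W"
  shows "(\<lambda>p\<in>W. fraction_mult R p (\<sigma> p) (\<tau> p)) \<in> Spec_sections R W"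
  by (rule Spec_sections_pointwise[OF assms fraction_mult_fraction]) auto

lemma Spec_sections_fraction:
  assumes W: "openin (Spec R) W" and a: "a \<in> carrier R" and f: "f \<in> carrier R" "\<And>q. q \<in> W \<Longrightarrow> f \<notin> q"
  shows "(\<lambda>q\<in>W. fraction R q a f) \<in> Spec_sections R W"
  unfolding Spec_sections_def using assms by auto

lemma Spec_sections_restrict:
  assumes \<sigma>: "\<sigma> \<in> Spec_sections R W" and V: "openin (Spec R) V" "V \<subseteq> W"
  shows "restrict \<sigma> V \<in> Spec_sections R V"
  unfolding Spec_sections_def
proof (intro CollectI conjI ballI)
  fix p assume p: "p \<in> V"
  then have "p \<in> W" using V by blast
  then obtain V' a f where V': "openin (Spec R) V'" "p \<in> V'" "V' \<subseteq> W" "a \<in> carrier R" "f \<in> carrier R"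
    and \<sigma>V: "\<forall>q\<in>V'. f \<notin> q \<and> \<sigma> q = fraction R q a f"
    using \<sigma> unfolding Spec_sections_def by blast
  have "openin (Spec R) (V \<inter> V')" using V V' by blast
  then show "\<exists>V' a f. openin (Spec R) V' \<and> p \<in> V' \<and> V' \<subseteq> V \<and> a \<in> carrier R \<and> f \<in> carrier R \<and>
      (\<forall>q\<in>V'. f \<notin> q \<and> restrict \<sigma> V q = fraction R q a f)"
    using V' \<sigma>V p by (intro exI[of _ "V \<inter> V'"] exI[of _ a] exI[of _ f]) auto
qed simp

end

lemma Spec_sheaf_simps:
  "\<Gamma> (Spec_sheaf R) W = Spec_sections R W"
  "\<sigma> \<otimes>\<^bsub>sections (Spec_sheaf R) W\<^esub> \<tau> = (\<lambda>p\<in>W. fraction_mult R p (\<sigma> p) (\<tau> p))"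
  "\<sigma> \<oplus>\<^bsub>sections (Spec_sheaf R) W\<^esub> \<tau> = (\<lambda>p\<in>W. fraction_add R p (\<sigma> p) (\<tau> p))"
  "\<one>\<^bsub>sections (Spec_sheaf R) W\<^esub> = (\<lambda>p\<in>W. fraction R p \<one>\<^bsub>R\<^esub> \<one>\<^bsub>R\<^esub>)"
  "restr (Spec_sheaf R) W V \<sigma> = restrict \<sigma> V"
  by (simp_all add: Spec_sheaf_def)

text \<open>The ideal consists of the sections that vanish in the residue field at \<open>x\<close>.\<close>

lemma affine_point_prime:
  fixes X :: "'x topology" and \<O> :: "('x, 'a) ring_presheaf"
  assumes rs: "ringed_space X \<O>" and aff: "affine_open X \<O> U" and x: "x \<in> U"
  obtains \<nn> where "primeideal \<nn> (sections \<O> U)"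
    "\<forall>f\<in>\<Gamma> \<O> U - \<nn>.
      \<exists>V. openin X V \<and> x \<in> V \<and> V \<subseteq> U \<and> restr \<O> U V f \<in> Units (sections \<O> V)"
proof -
  interpret ringed_space X \<O> by (rule rs)
  have U: "openin X U" using aff by (simp add: affine_open_def)
  from aff obtain R :: "'a ring" and g \<psi> where R: "cring R"
    and g: "homeomorphic_map (subtopology X U) (Spec R) g"
    and \<psi>': "\<forall>W. openin (Spec R) W \<longrightarrow>
          \<psi> W \<in> ring_iso (sections (Spec_sheaf R) W) (sections \<O> {x \<in> U. g x \<in> W})"
    and nat': "\<forall>W V. openin (Spec R) W \<and> openin (Spec R) V \<and> V \<subseteq> W \<longrightarrow>
          (\<forall>\<sigma>\<in>\<Gamma> (Spec_sheaf R) W.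
             \<psi> V (restr (Spec_sheaf R) W V \<sigma>)
             = restr \<O> {x \<in> U. g x \<in> W} {x \<in> U. g x \<in> V} (\<psi> W \<sigma>))"
    unfolding affine_open_def by (elim exE conjE) (rule that)
  have \<psi>: "\<psi> W \<in> ring_iso (sections (Spec_sheaf R) W) (sections \<O> {x \<in> U. g x \<in> W})"
    if "openin (Spec R) W" for W
    by (rule \<psi>'[rule_format, OF that])
  have nat: "\<psi> V (restr (Spec_sheaf R) W V \<sigma>) = restr \<O> {x \<in> U. g x \<in> W} {x \<in> U. g x \<in> V} (\<psi> W \<sigma>)"
    if "openin (Spec R) W" "openin (Spec R) V" "V \<subseteq> W" "\<sigma> \<in> \<Gamma> (Spec_sheaf R) W" for W V \<sigma>
    using nat' that by simp
  interpret R: cring R by (rule R)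
  interpret OU: cring "sections \<O> U" by (rule cring_sections[OF U])
  define W0 where "W0 = topspace (Spec R)"
  have W0: "openin (Spec R) W0" by (simp add: W0_def)
  have topU: "topspace (subtopology X U) = U" using openin_subset[OF U] by auto
  have g_top: "g y \<in> W0" if "y \<in> U" for y
    using homeomorphic_imp_surjective_map[OF g] that unfolding topU W0_def by blast
  have pre_W0: "{y \<in> U. g y \<in> W0} = U" using g_top by auto
  have pre_open: "openin X {y \<in> U. g y \<in> W}" if "openin (Spec R) W" for W
  proof -
    have "openin (subtopology X U) {y \<in> topspace (subtopology X U). g y \<in> W}"
      by (rule openin_continuous_map_preimage[OF homeomorphic_imp_continuous_map[OF g] that])
    then show ?thesis unfolding topU openin_open_subtopology[OF U] by (rule conjunct1)
  qed
  define p where "p = g x"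
  have pW0: "p \<in> W0" using g_top x by (simp add: p_def)
  then have prime: "primeideal p R" by (rule R.Spec_prime[OF W0])
  interpret p: primeideal p R by (rule prime)
  define \<psi>0 where "\<psi>0 = \<psi> W0"
  have iso: "\<psi>0 \<in> ring_iso (sections (Spec_sheaf R) W0) (sections \<O> U)"
    using \<psi>[OF W0] by (simp add: \<psi>0_def pre_W0)
  have bij: "bij_betw \<psi>0 (Spec_sections R W0) (\<Gamma> \<O> U)"
    using iso by (simp add: ring_iso_def Spec_sheaf_simps)
  \<comment> \<open>Sections over U are read as sections over the whole spectrum, so that they
    acquire a value in the localisation at p.\<close>
  define \<theta> where "\<theta> = inv_into (Spec_sections R W0) \<psi>0"
  have \<theta>: "\<theta> f \<in> Spec_sections R W0" "\<psi>0 (\<theta> f) = f" if "f \<in> \<Gamma> \<O> U" for f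
    using bij that unfolding \<theta>_def by (metis bij_betw_def inv_into_into, metis bij_betw_inv_into_right)
  have \<theta>I: "\<theta> f = \<sigma>" if "\<sigma> \<in> Spec_sections R W0" "\<psi>0 \<sigma> = f" for f \<sigma>
    using bij that unfolding \<theta>_def by (metis bij_betw_inv_into_left)
  have hom: "\<psi>0 (\<sigma> \<otimes>\<^bsub>sections (Spec_sheaf R) W0\<^esub> \<tau>) = \<psi>0 \<sigma> \<otimes>\<^bsub>sections \<O> U\<^esub> \<psi>0 \<tau>"
    "\<psi>0 (\<sigma> \<oplus>\<^bsub>sections (Spec_sheaf R) W0\<^esub> \<tau>) = \<psi>0 \<sigma> \<oplus>\<^bsub>sections \<O> U\<^esub> \<psi>0 \<tau>"
    if "\<sigma> \<in> Spec_sections R W0" "\<tau> \<in> Spec_sections R W0" for \<sigma> \<tau>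
    using iso that by (auto simp: ring_iso_def ring_hom_def Spec_sheaf_simps(1))
  have hom_one: "\<psi>0 (\<lambda>q\<in>W0. fraction R q \<one>\<^bsub>R\<^esub> \<one>\<^bsub>R\<^esub>) = \<one>\<^bsub>sections \<O> U\<^esub>"
    using iso by (simp add: ring_iso_def ring_hom_def Spec_sheaf_simps(4))
  have one_notin: "\<one>\<^bsub>R\<^esub> \<notin> q" if "q \<in> W0" for q
    using R.prime_compl(2)[OF R.Spec_prime[OF W0 that]] by blast
  have \<theta>_add: "\<theta> (f \<oplus>\<^bsub>sections \<O> U\<^esub> h) p = fraction_add R p (\<theta> f p) (\<theta> h p)"
    and \<theta>_mult: "\<theta> (f \<otimes>\<^bsub>sections \<O> U\<^esub> h) p = fraction_mult R p (\<theta> f p) (\<theta> h p)"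
    if fh: "f \<in> \<Gamma> \<O> U" "h \<in> \<Gamma> \<O> U" for f h
  proof -
    note t = \<theta>[OF fh(1)] \<theta>[OF fh(2)]
    have "\<theta> (f \<oplus>\<^bsub>sections \<O> U\<^esub> h) = (\<lambda>p\<in>W0. fraction_add R p (\<theta> f p) (\<theta> h p))"
      by (rule \<theta>I[OF R.Spec_sections_add[OF t(1,3)]])
        (use hom(2)[OF t(1,3)] t in \<open>simp add: Spec_sheaf_simps\<close>)
    then show "\<theta> (f \<oplus>\<^bsub>sections \<O> U\<^esub> h) p = fraction_add R p (\<theta> f p) (\<theta> h p)" using pW0 by simp
    have "\<theta> (f \<otimes>\<^bsub>sections \<O> U\<^esub> h) = (\<lambda>p\<in>W0. fraction_mult R p (\<theta> f p) (\<theta> h p))"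
      by (rule \<theta>I[OF R.Spec_sections_mult[OF t(1,3)]])
        (use hom(1)[OF t(1,3)] t in \<open>simp add: Spec_sheaf_simps\<close>)
    then show "\<theta> (f \<otimes>\<^bsub>sections \<O> U\<^esub> h) p = fraction_mult R p (\<theta> f p) (\<theta> h p)" using pW0 by simp
  qed
  have \<theta>_one: "\<theta> \<one>\<^bsub>sections \<O> U\<^esub> p = fraction R p \<one>\<^bsub>R\<^esub> \<one>\<^bsub>R\<^esub>"
    using \<theta>I[OF R.Spec_sections_fraction[OF W0 R.one_closed R.one_closed one_notin] hom_one] pW0 by simp
  \<comment> \<open>Membership in \<open>ring_hom\<close> does not state what happens to zero. The
    zero family satisfies z + z = z, and in the ring of sections over U this forces its image to be
    zero.\<close>
  have \<theta>_zero: "\<theta> \<zero>\<^bsub>sections \<O> U\<^esub> p = fraction R p \<zero>\<^bsub>R\<^esub> \<one>\<^bsub>R\<^esub>"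
  proof -
    let ?z = "\<lambda>q\<in>W0. fraction R q \<zero>\<^bsub>R\<^esub> \<one>\<^bsub>R\<^esub>"
    have z: "?z \<in> Spec_sections R W0"
      by (rule R.Spec_sections_fraction[OF W0 R.zero_closed R.one_closed one_notin])
    have "?z \<oplus>\<^bsub>sections (Spec_sheaf R) W0\<^esub> ?z = ?z"
    proof (rule extensionalityI)
      fix q assume q: "q \<in> W0"
      have "fraction_add R q (fraction R q \<zero>\<^bsub>R\<^esub> \<one>\<^bsub>R\<^esub>) (fraction R q \<zero>\<^bsub>R\<^esub> \<one>\<^bsub>R\<^esub>) = fraction R q \<zero>\<^bsub>R\<^esub> \<one>\<^bsub>R\<^esub>"
        using R.fraction_add_fraction[OF R.Spec_prime[OF W0 q], of "\<zero>\<^bsub>R\<^esub>" "\<one>\<^bsub>R\<^esub>" "\<zero>\<^bsub>R\<^esub>" "\<one>\<^bsub>R\<^esub>"] one_notin[OF q]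
        by simp
      then show "(?z \<oplus>\<^bsub>sections (Spec_sheaf R) W0\<^esub> ?z) q = ?z q" using q by (simp add: Spec_sheaf_simps)
    qed (simp_all add: Spec_sheaf_simps)
    then have "\<psi>0 ?z \<oplus>\<^bsub>sections \<O> U\<^esub> \<psi>0 ?z = \<psi>0 ?z" using hom(2)[OF z z] by simp
    moreover have "\<psi>0 ?z \<in> \<Gamma> \<O> U" using bij z unfolding bij_betw_def by blast
    ultimately have "\<psi>0 ?z = \<zero>\<^bsub>sections \<O> U\<^esub>" using OU.add.r_cancel_one' by metis
    then show ?thesis using \<theta>I[OF z] pW0 by simp
  qed
  define \<nn> where "\<nn> = {f \<in> \<Gamma> \<O> U. \<exists>a\<in>p. \<exists>s\<in>carrier R - p. \<theta> f p = fraction R p a s}"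
  have rep: "\<exists>V a s. openin (Spec R) V \<and> p \<in> V \<and> V \<subseteq> W0 \<and> a \<in> carrier R \<and> s \<in> carrier R \<and>
      (\<forall>q\<in>V. s \<notin> q \<and> \<theta> f q = fraction R q a s)" if "f \<in> \<Gamma> \<O> U" for f
    using \<theta>(1)[OF that] pW0 unfolding Spec_sections_def by blast
  have val: "\<exists>a s. a \<in> carrier R \<and> s \<in> carrier R - p \<and> \<theta> f p = fraction R p a s"
    if "f \<in> \<Gamma> \<O> U" for f
    using rep[OF that] by blast
  \<comment> \<open>Membership may be tested on any fraction that represents the value at p, because
    all of them agree on whether the numerator lies in p.\<close>
  have mem: "f \<in> \<nn> \<longleftrightarrow> a \<in> p"
    if f: "f \<in> \<Gamma> \<O> U" and a: "a \<in> carrier R" "s \<in> carrier R - p" "\<theta> f p = fraction R p a s" for f a s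
  proof
    assume "f \<in> \<nn>"
    then obtain b t where bt: "b \<in> p" "t \<in> carrier R - p" "\<theta> f p = fraction R p b t" unfolding \<nn>_def by blast
    have "b \<in> carrier R" using bt p.Icarr by blast
    from R.fraction_numerator_mem[OF prime a(1,2) this bt(2)] show "a \<in> p" using a(3) bt by simp
  next
    assume "a \<in> p"
    then show "f \<in> \<nn>" unfolding \<nn>_def using f a by blast
  qed
  have mult_mem: "f \<otimes>\<^bsub>sections \<O> U\<^esub> h \<in> \<nn> \<longleftrightarrow> f \<in> \<nn> \<or> h \<in> \<nn>"
    if fh: "f \<in> \<Gamma> \<O> U" "h \<in> \<Gamma> \<O> U" for f h
  proof -
    obtain a s where a: "a \<in> carrier R" "s \<in> carrier R - p" "\<theta> f p = fraction R p a s"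
      using val[OF fh(1)] by blast
    obtain b t where b: "b \<in> carrier R" "t \<in> carrier R - p" "\<theta> h p = fraction R p b t"
      using val[OF fh(2)] by blast
    have "\<theta> (f \<otimes>\<^bsub>sections \<O> U\<^esub> h) p = fraction R p (a \<otimes>\<^bsub>R\<^esub> b) (s \<otimes>\<^bsub>R\<^esub> t)"
      unfolding \<theta>_mult[OF fh] a(3) b(3) by (rule R.fraction_mult_fraction[OF prime a(1,2) b(1,2)])
    then have "f \<otimes>\<^bsub>sections \<O> U\<^esub> h \<in> \<nn> \<longleftrightarrow> a \<otimes>\<^bsub>R\<^esub> b \<in> p"
      by (rule mem[OF OU.m_closed[OF fh] R.m_closed[OF a(1) b(1)] R.prime_compl(1)[OF prime a(2) b(2)]])
    also have "\<dots> \<longleftrightarrow> a \<in> p \<or> b \<in> p"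
      using p.I_prime[OF a(1) b(1)] p.I_l_closed[OF _ a(1), of b] p.I_r_closed[OF _ b(1), of a] by blast
    finally show ?thesis using mem[OF fh(1) a] mem[OF fh(2) b] by simp
  qed
  have add_mem: "f \<oplus>\<^bsub>sections \<O> U\<^esub> h \<in> \<nn>" if fh: "f \<in> \<nn>" "h \<in> \<nn>" for f h
  proof -
    have fhc: "f \<in> \<Gamma> \<O> U" "h \<in> \<Gamma> \<O> U" using fh unfolding \<nn>_def by auto
    obtain a s where a: "a \<in> p" "s \<in> carrier R - p" "\<theta> f p = fraction R p a s"
      using fh unfolding \<nn>_def by blast
    obtain b t where b: "b \<in> p" "t \<in> carrier R - p" "\<theta> h p = fraction R p b t"
      using fh unfolding \<nn>_def by blast
    have ab: "a \<in> carrier R" "b \<in> carrier R" using a b p.Icarr by auto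
    have "\<theta> (f \<oplus>\<^bsub>sections \<O> U\<^esub> h) p = fraction R p (a \<otimes>\<^bsub>R\<^esub> t \<oplus>\<^bsub>R\<^esub> b \<otimes>\<^bsub>R\<^esub> s) (s \<otimes>\<^bsub>R\<^esub> t)"
      unfolding \<theta>_add[OF fhc] a(3) b(3) by (rule R.fraction_add_fraction[OF prime ab(1) a(2) ab(2) b(2)])
    from mem[OF OU.a_closed[OF fhc] _ R.prime_compl(1)[OF prime a(2) b(2)] this] show ?thesis
      using ab a b p.I_r_closed p.a_closed by auto
  qed
  have one_nmem: "\<one>\<^bsub>sections \<O> U\<^esub> \<notin> \<nn>"
    using mem[OF OU.one_closed R.one_closed _ \<theta>_one] one_notin[OF pW0] by simp
  have zero_mem: "\<zero>\<^bsub>sections \<O> U\<^esub> \<in> \<nn>"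
    using mem[OF OU.zero_closed R.zero_closed _ \<theta>_zero] one_notin[OF pW0] p.zero_closed by simp
  have sub: "\<nn> \<subseteq> \<Gamma> \<O> U" unfolding \<nn>_def by blast
  have "ideal \<nn> (sections \<O> U)"
  proof (rule idealI)
    show "ring (sections \<O> U)" by (rule OU.ring_axioms)
    show "subgroup \<nn> (add_monoid (sections \<O> U))"
    proof (rule subgroup.intro)
      fix f assume f: "f \<in> \<nn>"
      then have fc: "f \<in> \<Gamma> \<O> U" using sub by blast
      \<comment> \<open>Negation is multiplication by -1, so closure under negatives is an instance
        of \<open>mult_mem\<close>.\<close>
      have "\<ominus>\<^bsub>sections \<O> U\<^esub> f = (\<ominus>\<^bsub>sections \<O> U\<^esub> \<one>\<^bsub>sections \<O> U\<^esub>) \<otimes>\<^bsub>sections \<O> U\<^esub> f"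
        using fc by (simp add: OU.l_minus)
      then have "\<ominus>\<^bsub>sections \<O> U\<^esub> f \<in> \<nn>"
        using mult_mem[of "\<ominus>\<^bsub>sections \<O> U\<^esub> \<one>\<^bsub>sections \<O> U\<^esub>" f] f fc by simp
      then show "inv\<^bsub>add_monoid (sections \<O> U)\<^esub> f \<in> \<nn>" by (simp only: a_inv_def)
    qed (use sub add_mem zero_mem in auto)
  qed (use mult_mem sub in auto)
  then have "primeideal \<nn> (sections \<O> U)"
    by (rule primeidealI) (use OU.is_cring one_nmem mult_mem in auto)
  moreover have "\<exists>V. openin X V \<and> x \<in> V \<and> V \<subseteq> U \<and> restr \<O> U V f \<in> Units (sections \<O> V)"
    if f: "f \<in> \<Gamma> \<O> U" "f \<notin> \<nn>" for f
  proof -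
    obtain V a s where V: "openin (Spec R) V" "p \<in> V" "V \<subseteq> W0" and as: "a \<in> carrier R" "s \<in> carrier R"
      and fV: "\<And>q. q \<in> V \<Longrightarrow> s \<notin> q \<and> \<theta> f q = fraction R q a s"
      using rep[OF f(1)] by blast
    \<comment> \<open>Near p the section is the fraction a/s, and its value at p lies outside the
      maximal ideal. On the part of V where a avoids every prime, s/a is an inverse.\<close>
    have "a \<notin> p" using mem[OF f(1) as(1)] as(2) fV[OF V(2)] f(2) by blast
    define W where "W = V \<inter> {q. primeideal q R \<and> a \<notin> q}"
    have W: "openin (Spec R) W" "p \<in> W" "W \<subseteq> V" "W \<subseteq> W0"
      using V R.Spec_basic_open[OF as(1)] prime \<open>a \<notin> p\<close> by (auto simp: W_def)
    have fW: "\<theta> f q = fraction R q a s" "a \<notin> q" "s \<notin> q" "primeideal q R" if "q \<in> W" for q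
      using that fV unfolding W_def by auto
    define Y where "Y = {y \<in> U. g y \<in> W}"
    have Y: "openin X Y" "x \<in> Y" "Y \<subseteq> U" using pre_open[OF W(1)] W(2) x by (auto simp: Y_def p_def)
    interpret OY: cring "sections \<O> Y" by (rule cring_sections[OF Y(1)])
    have isoW: "\<psi> W \<in> ring_iso (sections (Spec_sheaf R) W) (sections \<O> Y)"
      using \<psi>[OF W(1)] by (simp add: Y_def)
    let ?\<sigma> = "restrict (\<theta> f) W" and ?\<tau> = "\<lambda>q\<in>W. fraction R q s a"
    have \<sigma>: "?\<sigma> \<in> Spec_sections R W" by (rule R.Spec_sections_restrict[OF \<theta>(1)[OF f(1)] W(1,4)])
    have \<tau>: "?\<tau> \<in> Spec_sections R W" by (rule R.Spec_sections_fraction[OF W(1) as(2,1) fW(2)])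
    have "?\<sigma> \<otimes>\<^bsub>sections (Spec_sheaf R) W\<^esub> ?\<tau> = \<one>\<^bsub>sections (Spec_sheaf R) W\<^esub>"
    proof (rule extensionalityI)
      fix q assume q: "q \<in> W"
      have cs: "a \<in> carrier R - q" "s \<in> carrier R - q" "\<one>\<^bsub>R\<^esub> \<in> carrier R - q"
        using fW[OF q] as R.prime_compl(2) by auto
      have "fraction_mult R q (fraction R q a s) (fraction R q s a) = fraction R q (a \<otimes>\<^bsub>R\<^esub> s) (s \<otimes>\<^bsub>R\<^esub> a)"
        using R.fraction_mult_fraction[OF fW(4)[OF q]] cs by auto
      also have "\<dots> = fraction R q \<one>\<^bsub>R\<^esub> \<one>\<^bsub>R\<^esub>"
        by (rule R.fraction_eqI[OF fW(4)[OF q], where u = "\<one>\<^bsub>R\<^esub>"])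
          (use cs R.prime_compl(1)[OF fW(4)[OF q]] as in \<open>auto simp: R.m_comm\<close>)
      finally show "(?\<sigma> \<otimes>\<^bsub>sections (Spec_sheaf R) W\<^esub> ?\<tau>) q = \<one>\<^bsub>sections (Spec_sheaf R) W\<^esub> q"
        using q fW(1) by (simp add: Spec_sheaf_simps)
    qed (simp_all add: Spec_sheaf_simps)
    moreover have "\<psi> W (?\<sigma> \<otimes>\<^bsub>sections (Spec_sheaf R) W\<^esub> ?\<tau>) = \<psi> W ?\<sigma> \<otimes>\<^bsub>sections \<O> Y\<^esub> \<psi> W ?\<tau>"
      "\<psi> W \<one>\<^bsub>sections (Spec_sheaf R) W\<^esub> = \<one>\<^bsub>sections \<O> Y\<^esub>"
      using isoW \<sigma> \<tau> by (auto simp: ring_iso_def ring_hom_def Spec_sheaf_simps(1))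
    ultimately have one: "\<psi> W ?\<sigma> \<otimes>\<^bsub>sections \<O> Y\<^esub> \<psi> W ?\<tau> = \<one>\<^bsub>sections \<O> Y\<^esub>" by simp
    have cl: "\<psi> W ?\<sigma> \<in> \<Gamma> \<O> Y" "\<psi> W ?\<tau> \<in> \<Gamma> \<O> Y"
      using isoW \<sigma> \<tau> by (auto simp: ring_iso_def ring_hom_def Spec_sheaf_simps(1))
    \<comment> \<open>Naturality of the isomorphism turns restriction in the spectrum into
      restriction from U to Y.\<close>
    have "\<psi> W ?\<sigma> = restr \<O> U Y f"
      using nat[OF W0 W(1,4), of "\<theta> f"] \<theta>[OF f(1)] by (simp add: Spec_sheaf_simps pre_W0 Y_def \<psi>0_def)
    moreover have "\<psi> W ?\<sigma> \<in> Units (sections \<O> Y)"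
      unfolding Units_def
      by (intro CollectI conjI cl(1) bexI[OF _ cl(2)] one) (simp only: OY.m_comm[OF cl(2,1)] one)
    ultimately show ?thesis using Y by auto
  qed
  ultimately show ?thesis by (intro that[of \<nn>]) auto
qed

section \<open>Restriction of scalars\<close>

lemma restrict_scalars_simps [simp]:
  "carrier (restrict_scalars S M) = carrier M"
  "\<zero>\<^bsub>restrict_scalars S M\<^esub> = \<zero>\<^bsub>M\<^esub>"
  "x \<oplus>\<^bsub>restrict_scalars S M\<^esub> y = x \<oplus>\<^bsub>M\<^esub> y"
  "r \<odot>\<^bsub>restrict_scalars S M\<^esub> x = (r \<odot>\<^bsub>S\<^esub> \<one>\<^bsub>S\<^esub>) \<odot>\<^bsub>M\<^esub> x"
  by (simp_all add: restrict_scalars_def)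

lemma restrict_scalars_sheaf_simps [simp]:
  "sections (restrict_scalars_sheaf \<A> \<M>) U = restrict_scalars (sections \<A> U) (sections \<M> U)"
  "restr (restrict_scalars_sheaf \<A> \<M>) = restr \<M>"
  by (simp_all add: restrict_scalars_sheaf_def)

lemma restrict_scalars_a_inv [simp]: "\<ominus>\<^bsub>restrict_scalars S M\<^esub> x = \<ominus>\<^bsub>M\<^esub> x"
  by (simp add: a_inv_def m_inv_def)

lemma algebra_scalar_mult:
  assumes "algebra R S" "r \<in> carrier R" "s \<in> carrier R"
  shows "r \<odot>\<^bsub>S\<^esub> \<one>\<^bsub>S\<^esub> \<in> carrier S" "(r \<otimes>\<^bsub>R\<^esub> s) \<odot>\<^bsub>S\<^esub> \<one>\<^bsub>S\<^esub> = (r \<odot>\<^bsub>S\<^esub> \<one>\<^bsub>S\<^esub>) \<otimes>\<^bsub>S\<^esub> (s \<odot>\<^bsub>S\<^esub> \<one>\<^bsub>S\<^esub>)"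
    "x \<in> carrier S \<Longrightarrow> (r \<odot>\<^bsub>S\<^esub> \<one>\<^bsub>S\<^esub>) \<otimes>\<^bsub>S\<^esub> x = r \<odot>\<^bsub>S\<^esub> x"
proof -
  interpret algebra R S by fact
  interpret S: cring S by (rule M_cring)
  show "r \<odot>\<^bsub>S\<^esub> \<one>\<^bsub>S\<^esub> \<in> carrier S" using assms(2) by simp
  show "(r \<otimes>\<^bsub>R\<^esub> s) \<odot>\<^bsub>S\<^esub> \<one>\<^bsub>S\<^esub> = (r \<odot>\<^bsub>S\<^esub> \<one>\<^bsub>S\<^esub>) \<otimes>\<^bsub>S\<^esub> (s \<odot>\<^bsub>S\<^esub> \<one>\<^bsub>S\<^esub>)"
    using assms by (simp add: smult_assoc1 smult_assoc2)
  show "(r \<odot>\<^bsub>S\<^esub> \<one>\<^bsub>S\<^esub>) \<otimes>\<^bsub>S\<^esub> x = r \<odot>\<^bsub>S\<^esub> x" if "x \<in> carrier S"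
    using assms that by (simp add: smult_assoc2)
qed

lemma module_restrict_scalars:
  assumes alg: "algebra R S" and "module S M"
  shows "module R (restrict_scalars S M)"
proof -
  interpret S: algebra R S by fact
  interpret M: module S M by fact
  note cl = algebra_scalar_mult(1)[OF alg _ S.R.one_closed]
  show ?thesis
  proof (rule moduleI)
    show "cring R" by (rule S.R_cring)
    show "abelian_group (restrict_scalars S M)"
      by (rule abelian_groupI) (auto simp: M.M.a_ac intro: M.M.l_neg M.M.a_inv_closed)
  qed (simp_all add: cl S.smult_l_distr M.smult_l_distr M.smult_r_distr algebra_scalar_mult(2)[OF alg] M.smult_assoc1)
qed

lemma basis2_module_iso:
  assumes iso: "module_iso R M N h" and "module R M" "module R N" and e: "basis2 R M e1 e2"
  shows "basis2 R N (h e1) (h e2)"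
proof -
  interpret M: module R M by fact
  interpret N: module R N by fact
  note [simp] = M.basis2_closed[OF e] module_isoD(2)[OF iso]
  have lin: "h (lin_comb M r e1 s e2) = r \<odot>\<^bsub>N\<^esub> h e1 \<oplus>\<^bsub>N\<^esub> s \<odot>\<^bsub>N\<^esub> h e2"
    if "r \<in> carrier R" "s \<in> carrier R" for r s
    using that by (simp add: module_isoD(3,4)[OF iso])
  show ?thesis
  proof (rule N.basis2I)
    fix n assume "n \<in> carrier N"
    then obtain m where m: "m \<in> carrier M" "n = h m"
      using module_isoD(1)[OF iso] unfolding bij_betw_def by blast
    obtain r s where "r \<in> carrier R" "s \<in> carrier R" "m = lin_comb M r e1 s e2"
      by (rule M.basis2_obtain[OF e m(1)])
    then show "\<exists>r s. r \<in> carrier R \<and> s \<in> carrier R \<and> n = r \<odot>\<^bsub>N\<^esub> h e1 \<oplus>\<^bsub>N\<^esub> s \<odot>\<^bsub>N\<^esub> h e2"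
      using m(2) lin by blast
  next
    fix r s r' s' assume rs: "r \<in> carrier R" "s \<in> carrier R" "r' \<in> carrier R" "s' \<in> carrier R"
      and "r \<odot>\<^bsub>N\<^esub> h e1 \<oplus>\<^bsub>N\<^esub> s \<odot>\<^bsub>N\<^esub> h e2 = r' \<odot>\<^bsub>N\<^esub> h e1 \<oplus>\<^bsub>N\<^esub> s' \<odot>\<^bsub>N\<^esub> h e2"
    then have "h (lin_comb M r e1 s e2) = h (lin_comb M r' e1 s' e2)"
      by (simp add: lin)
    then have "lin_comb M r e1 s e2 = lin_comb M r' e1 s' e2"
      by (rule module_isoD(5)[OF iso, rotated 2]) (use rs in simp_all)
    then show "r = r' \<and> s = s'" using M.basis2_unique[OF e rs] by blast
  qed simp_all
qed

lemma is_charpoly_wrt_module_iso: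
  assumes iso: "module_iso R M N h" and "module R M" and e: "e1 \<in> carrier M" "e2 \<in> carrier M"
    and \<phi>: "\<psi> (h e1) = h (\<phi> e1)" "\<psi> (h e2) = h (\<phi> e2)"
    and p: "is_charpoly_wrt R M e1 e2 \<phi> p"
  shows "is_charpoly_wrt R N (h e1) (h e2) \<psi> p"
proof -
  interpret M: module R M by fact
  have lin: "h (lin_comb M r e1 s e2) = r \<odot>\<^bsub>N\<^esub> h e1 \<oplus>\<^bsub>N\<^esub> s \<odot>\<^bsub>N\<^esub> h e2"
    if "r \<in> carrier R" "s \<in> carrier R" for r s
    using that e by (simp add: module_isoD(3,4)[OF iso])
  obtain a b c d where *: "a \<in> carrier R" "b \<in> carrier R" "c \<in> carrier R" "d \<in> carrier R"
      "\<phi> e1 = lin_comb M a e1 c e2" "\<phi> e2 = lin_comb M b e1 d e2"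
      "p = charpoly_matrix2 R a b c d"
    using p unfolding is_charpoly_wrt_def by blast
  show ?thesis
    unfolding is_charpoly_wrt_def \<phi>
    by (rule bexI[OF _ *(1)], rule bexI[OF _ *(2)], rule bexI[OF _ *(3)], rule bexI[OF _ *(4)])
      (simp add: * lin)
qed

lemma module_iso_restrict_scalars:
  assumes "module_iso S M N h" "algebra R S"
  shows "module_iso R (restrict_scalars S M) (restrict_scalars S N) h"
proof -
  interpret algebra R S by fact
  interpret S: cring S by (rule M_cring)
  show ?thesis
    using assms(1) unfolding module_iso_def by simp
qed

text \<open>Acting on e matches coordinates in the basis 1, \<alpha> of S with coordinates in the
  basis e, \<alpha>e of M, because (r + s\<alpha>)e = re + s(\<alpha>e). Uniqueness and existence of
  coordinates become injectivity and surjectivity.\<close>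

lemma cyclic_of_basis2:
  assumes alg: "algebra R S" and "module S M" and \<alpha>: "basis2 R S \<one>\<^bsub>S\<^esub> \<alpha>"
    and e: "basis2 R (restrict_scalars S M) e (\<alpha> \<odot>\<^bsub>M\<^esub> e)"
  shows "free_generator S M e"
proof -
  interpret S: algebra R S by fact
  interpret M: module S M by fact
  interpret N: module R "restrict_scalars S M" by (rule module_restrict_scalars) fact+
  have [simp]: "\<alpha> \<in> carrier S" "e \<in> carrier M"
    using S.basis2_closed[OF \<alpha>] N.basis2_closed[OF e] by auto
  note cl [simp] = algebra_scalar_mult(1)[OF alg _ S.R.one_closed]
  have act: "(lin_comb S r \<one>\<^bsub>S\<^esub> s \<alpha>) \<odot>\<^bsub>M\<^esub> e =
      lin_comb (restrict_scalars S M) r e s (\<alpha> \<odot>\<^bsub>M\<^esub> e)"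
    if "r \<in> carrier R" "s \<in> carrier R" for r s
    using that algebra_scalar_mult(3)[OF alg that(2,2), of \<alpha>]
    by (simp add: M.smult_l_distr flip: M.smult_assoc1)
  show ?thesis
    unfolding bij_betw_def
  proof (intro conjI inj_onI)
    fix x y assume xy: "x \<in> carrier S" "y \<in> carrier S" "x \<odot>\<^bsub>M\<^esub> e = y \<odot>\<^bsub>M\<^esub> e"
    obtain r s where rs: "r \<in> carrier R" "s \<in> carrier R" "x = lin_comb S r \<one>\<^bsub>S\<^esub> s \<alpha>"
      by (rule S.basis2_obtain[OF \<alpha> xy(1)])
    obtain r' s' where rs': "r' \<in> carrier R" "s' \<in> carrier R" "y = lin_comb S r' \<one>\<^bsub>S\<^esub> s' \<alpha>"
      by (rule S.basis2_obtain[OF \<alpha> xy(2)])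
    have "r = r'" "s = s'"
      using N.basis2_unique[OF e rs(1,2) rs'(1,2)] xy(3)
      unfolding rs(3) rs'(3) act[OF rs(1,2)] act[OF rs'(1,2)] by blast+
    then show "x = y" using rs(3) rs'(3) by simp
  next
    show "(\<lambda>s. s \<odot>\<^bsub>M\<^esub> e) ` carrier S = carrier M"
    proof
      show "carrier M \<subseteq> (\<lambda>s. s \<odot>\<^bsub>M\<^esub> e) ` carrier S"
      proof
        fix m assume "m \<in> carrier M"
        then have "m \<in> carrier (restrict_scalars S M)" by simp
        then obtain r s where rs: "r \<in> carrier R" "s \<in> carrier R"
          "m = lin_comb (restrict_scalars S M) r e s (\<alpha> \<odot>\<^bsub>M\<^esub> e)"
          by (rule N.basis2_obtain[OF e])
        then have "m = (lin_comb S r \<one>\<^bsub>S\<^esub> s \<alpha>) \<odot>\<^bsub>M\<^esub> e" by (simp only: act)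
        moreover have "lin_comb S r \<one>\<^bsub>S\<^esub> s \<alpha> \<in> carrier S" using rs by simp
        ultimately show "m \<in> (\<lambda>s. s \<odot>\<^bsub>M\<^esub> e) ` carrier S" by (rule image_eqI)
      qed
    qed auto
  qed
qed

section \<open>Sheaves of modules over an algebra and multiplication by a section\<close>

lemma algebra_sheafD:
  assumes "algebra_sheaf X \<O> \<A>"
  shows "ringed_space X \<O>" "ringed_space X \<A>" "module_sheaf X \<O> \<A>"
    "openin X U \<Longrightarrow> algebra (sections \<O> U) (sections \<A> U)"
  using assms unfolding algebra_sheaf_def module_sheaf_def algebra_sheaf_axioms_def by auto

lemma base_module_sheaf_restrict_scalars:
  fixes \<O> :: "('x, 'a) ring_presheaf"
  assumes alg: "algebra_sheaf X \<O> \<A>" and M: "module_sheaf X \<A> \<M>"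
  shows "base_module_sheaf X \<O> (restrict_scalars_sheaf \<A> \<M>)"
proof -
  interpret O: ringed_space X \<O> by (rule algebra_sheafD(1)[OF alg])
  interpret S: ringed_space X \<A> by (rule algebra_sheafD(2)[OF alg])
  interpret A: module_sheaf X \<O> \<A> by (rule algebra_sheafD(3)[OF alg])
  interpret M: module_sheaf X \<A> \<M> by (rule M)
  \<comment> \<open>The structure map from \<O> to \<A> commutes with restriction, since restriction
    on \<A> is compatible with scalars from \<O> and preserves the unit.\<close>
  have scalar: "restr \<A> U V (r \<odot>\<^bsub>sections \<A> U\<^esub> \<one>\<^bsub>sections \<A> U\<^esub>) =
      restr \<O> U V r \<odot>\<^bsub>sections \<A> V\<^esub> \<one>\<^bsub>sections \<A> V\<^esub>"
    if "openin X U" "openin X V" "V \<subseteq> U" "r \<in> \<Gamma> \<O> U" for U V r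
  proof -
    interpret h: ring_hom_ring "sections \<A> U" "sections \<A> V" "restr \<A> U V"
      by (rule S.restr_ring_hom_ring[OF that(1-3)])
    show ?thesis using A.restr_smult[OF that(1-4), of "\<one>\<^bsub>sections \<A> U\<^esub>"] by simp
  qed
  have "sheaf X (restrict_scalars_sheaf \<A> \<M>)"
  proof (rule sheaf.intro)
    show "s = t" if "\<And>V. V \<in> \<V> \<Longrightarrow> openin X V" "U = \<Union>\<V>"
      "s \<in> \<Gamma> (restrict_scalars_sheaf \<A> \<M>) U" "t \<in> \<Gamma> (restrict_scalars_sheaf \<A> \<M>) U"
      "\<And>V. V \<in> \<V> \<Longrightarrow> restr (restrict_scalars_sheaf \<A> \<M>) U V s = restr (restrict_scalars_sheaf \<A> \<M>) U V t" for \<V> U s t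
      by (rule M.M.locality[OF that(1,2)]) (use that in simp_all)
    show "\<exists>s\<in>\<Gamma> (restrict_scalars_sheaf \<A> \<M>) U. \<forall>V\<in>\<V>. restr (restrict_scalars_sheaf \<A> \<M>) U V s = \<sigma> V"
      if "\<And>V. V \<in> \<V> \<Longrightarrow> openin X V" "U = \<Union>\<V>"
      "\<And>V. V \<in> \<V> \<Longrightarrow> \<sigma> V \<in> \<Gamma> (restrict_scalars_sheaf \<A> \<M>) V"
      "\<And>V W. \<lbrakk>V \<in> \<V>; W \<in> \<V>\<rbrakk> \<Longrightarrow> restr (restrict_scalars_sheaf \<A> \<M>) V (V \<inter> W) (\<sigma> V) =
        restr (restrict_scalars_sheaf \<A> \<M>) W (V \<inter> W) (\<sigma> W)" for \<V> U \<sigma>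
      unfolding restrict_scalars_sheaf_simps restrict_scalars_simps
      by (rule M.mod_gluing[OF that(1,2)]) (use that(3,4) in simp_all)
  qed (simp_all add: M.mod_restr_closed M.mod_restr_id M.mod_restr_comp)
  moreover have "module_sheaf_axioms X \<O> (restrict_scalars_sheaf \<A> \<M>)"
  proof (rule module_sheaf_axioms.intro)
    show "module (sections \<O> U) (sections (restrict_scalars_sheaf \<A> \<M>) U)" if "openin X U" for U
      unfolding restrict_scalars_sheaf_simps
      by (rule module_restrict_scalars[OF algebra_sheafD(4)[OF alg that] M.module_sections[OF that]])
    fix U V assume UV: "openin X U" "openin X V" "V \<subseteq> U"
    show "restr (restrict_scalars_sheaf \<A> \<M>) U V (m \<oplus>\<^bsub>sections (restrict_scalars_sheaf \<A> \<M>) U\<^esub> n) =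
        restr (restrict_scalars_sheaf \<A> \<M>) U V m \<oplus>\<^bsub>sections (restrict_scalars_sheaf \<A> \<M>) V\<^esub>
        restr (restrict_scalars_sheaf \<A> \<M>) U V n"
      if "m \<in> \<Gamma> (restrict_scalars_sheaf \<A> \<M>) U" "n \<in> \<Gamma> (restrict_scalars_sheaf \<A> \<M>) U" for m n
      using that by (simp add: M.restr_add[OF UV])
    show "restr (restrict_scalars_sheaf \<A> \<M>) U V (r \<odot>\<^bsub>sections (restrict_scalars_sheaf \<A> \<M>) U\<^esub> m) =
        restr \<O> U V r \<odot>\<^bsub>sections (restrict_scalars_sheaf \<A> \<M>) V\<^esub> restr (restrict_scalars_sheaf \<A> \<M>) U V m"
      if "r \<in> \<Gamma> \<O> U" "m \<in> \<Gamma> (restrict_scalars_sheaf \<A> \<M>) U" for r m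
    proof -
      interpret AU: algebra "sections \<O> U" "sections \<A> U" by (rule algebra_sheafD(4)[OF alg UV(1)])
      have "r \<odot>\<^bsub>sections \<A> U\<^esub> \<one>\<^bsub>sections \<A> U\<^esub> \<in> \<Gamma> \<A> U"
        by (rule algebra_scalar_mult(1)[OF algebra_sheafD(4)[OF alg UV(1)] that(1,1)])
      then show ?thesis using that by (simp add: M.restr_smult[OF UV] scalar[OF UV])
    qed
  qed
  ultimately show ?thesis
    by (intro base_module_sheaf.intro module_sheaf.intro algebra_sheafD(1)[OF alg])
qed

lemma sheaf_endo_mult:
  fixes \<O> :: "('x, 'a) ring_presheaf"
  assumes alg: "algebra_sheaf X \<O> \<A>" and U: "openin X U" and \<alpha>: "\<alpha> \<in> \<Gamma> \<A> U"
  shows "sheaf_endo X \<O> \<A> U (mult_endo \<A> U \<alpha>)"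
proof (intro sheaf_endo.intro sheaf_endo_axioms.intro base_module_sheaf.intro)
  show "module_sheaf X \<O> \<A>" by (rule algebra_sheafD(3)[OF alg])
  show "openin X U" by (rule U)
  interpret S: ringed_space X \<A> by (rule algebra_sheafD(2)[OF alg])
  fix V assume V: "openin X V" "V \<subseteq> U"
  interpret SV: cring "sections \<A> V" by (rule S.cring_sections[OF V(1)])
  interpret V: algebra "sections \<O> V" "sections \<A> V" by (rule algebra_sheafD(4)[OF alg V(1)])
  have \<alpha>V [simp]: "restr \<A> U V \<alpha> \<in> \<Gamma> \<A> V" by (rule S.ring_restr_closed[OF U V \<alpha>])
  fix m assume m: "m \<in> \<Gamma> \<A> V"
  then show "restr \<A> U V \<alpha> \<otimes>\<^bsub>sections \<A> V\<^esub> m \<in> \<Gamma> \<A> V" by simp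
  show "restr \<A> U V \<alpha> \<otimes>\<^bsub>sections \<A> V\<^esub> (m \<oplus>\<^bsub>sections \<A> V\<^esub> m') =
      restr \<A> U V \<alpha> \<otimes>\<^bsub>sections \<A> V\<^esub> m \<oplus>\<^bsub>sections \<A> V\<^esub> restr \<A> U V \<alpha> \<otimes>\<^bsub>sections \<A> V\<^esub> m'"
    if "m' \<in> \<Gamma> \<A> V" for m'
    by (rule SV.r_distr[OF m that \<alpha>V])
  show "restr \<A> U V \<alpha> \<otimes>\<^bsub>sections \<A> V\<^esub> (r \<odot>\<^bsub>sections \<A> V\<^esub> m) =
      r \<odot>\<^bsub>sections \<A> V\<^esub> (restr \<A> U V \<alpha> \<otimes>\<^bsub>sections \<A> V\<^esub> m)" if "r \<in> \<Gamma> \<O> V" for r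
    using V.smult_assoc2[OF that m \<alpha>V] that m by (simp add: SV.m_comm)
  fix W assume W: "openin X W" "W \<subseteq> V"
  interpret h: ring_hom_ring "sections \<A> V" "sections \<A> W" "restr \<A> V W"
    by (rule S.restr_ring_hom_ring[OF V(1) W])
  show "restr \<A> V W (restr \<A> U V \<alpha> \<otimes>\<^bsub>sections \<A> V\<^esub> m) =
      restr \<A> U W \<alpha> \<otimes>\<^bsub>sections \<A> W\<^esub> restr \<A> V W m"
    using m by (simp add: S.ring_restr_comp[OF U V(1) W(1) V(2) W(2) \<alpha>])
qed

text \<open>Multiplication by \<alpha> is linear over \<O> because scalars from \<O> act through
  \<A>, which is commutative.\<close>

lemma sheaf_endo_smult:
  fixes \<O> :: "('x, 'a) ring_presheaf"
  assumes alg: "algebra_sheaf X \<O> \<A>" and M: "module_sheaf X \<A> \<M>"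
    and U: "openin X U" and \<alpha>: "\<alpha> \<in> \<Gamma> \<A> U"
  shows "sheaf_endo X \<O> (restrict_scalars_sheaf \<A> \<M>) U (smult_endo \<A> \<M> U \<alpha>)"
proof (intro sheaf_endo.intro sheaf_endo_axioms.intro)
  show "base_module_sheaf X \<O> (restrict_scalars_sheaf \<A> \<M>)"
    by (rule base_module_sheaf_restrict_scalars[OF alg M])
  show "openin X U" by (rule U)
  interpret M: module_sheaf X \<A> \<M> by (rule M)
  fix V assume V: "openin X V" "V \<subseteq> U"
  interpret V: module "sections \<A> V" "sections \<M> V" by (rule M.module_sections[OF V(1)])
  have \<alpha>V [simp]: "restr \<A> U V \<alpha> \<in> \<Gamma> \<A> V" by (rule M.ring_restr_closed[OF U V \<alpha>])
  fix m assume "m \<in> \<Gamma> (restrict_scalars_sheaf \<A> \<M>) V"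
  then have m: "m \<in> \<Gamma> \<M> V" by simp
  then show "restr \<A> U V \<alpha> \<odot>\<^bsub>sections \<M> V\<^esub> m \<in> \<Gamma> (restrict_scalars_sheaf \<A> \<M>) V" by simp
  show "restr \<A> U V \<alpha> \<odot>\<^bsub>sections \<M> V\<^esub> (m \<oplus>\<^bsub>sections (restrict_scalars_sheaf \<A> \<M>) V\<^esub> m') =
      restr \<A> U V \<alpha> \<odot>\<^bsub>sections \<M> V\<^esub> m \<oplus>\<^bsub>sections (restrict_scalars_sheaf \<A> \<M>) V\<^esub> restr \<A> U V \<alpha> \<odot>\<^bsub>sections \<M> V\<^esub> m'"
    if "m' \<in> \<Gamma> (restrict_scalars_sheaf \<A> \<M>) V" for m'
    using that m by (simp add: V.smult_r_distr)
  show "restr \<A> U V \<alpha> \<odot>\<^bsub>sections \<M> V\<^esub> (r \<odot>\<^bsub>sections (restrict_scalars_sheaf \<A> \<M>) V\<^esub> m) =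
      r \<odot>\<^bsub>sections (restrict_scalars_sheaf \<A> \<M>) V\<^esub> (restr \<A> U V \<alpha> \<odot>\<^bsub>sections \<M> V\<^esub> m)"
    if r: "r \<in> \<Gamma> \<O> V" for r
  proof -
    have "r \<odot>\<^bsub>sections \<A> V\<^esub> \<one>\<^bsub>sections \<A> V\<^esub> \<in> \<Gamma> \<A> V"
      by (rule algebra_scalar_mult(1)[OF algebra_sheafD(4)[OF alg V(1)] r r])
    then show ?thesis using m by (simp add: V.R.m_comm flip: V.smult_assoc1)
  qed
  fix W assume W: "openin X W" "W \<subseteq> V"
  show "restr (restrict_scalars_sheaf \<A> \<M>) V W (restr \<A> U V \<alpha> \<odot>\<^bsub>sections \<M> V\<^esub> m) =
      restr \<A> U W \<alpha> \<odot>\<^bsub>sections \<M> W\<^esub> restr (restrict_scalars_sheaf \<A> \<M>) V W m"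
    using m by (simp add: M.restr_smult[OF V(1) W \<alpha>V] M.ring_restr_comp[OF U V(1) W(1) V(2) W(2) \<alpha>])
qed

section \<open>Pseudoregular and coprimitive modules\<close>

text \<open>Puts the frame into the shape of a matrix with columns (b, -a) and (c, 0), from which
  the trace b and the determinant ac can be read off.\<close>

lemma good_frame_action:
  assumes alg: "algebra R S" and M: "module S M" and gf: "good_frame R S M \<alpha> e1 e2 a b c"
  shows "\<alpha> \<odot>\<^bsub>M\<^esub> e1 = lin_comb (restrict_scalars S M) b e1 (\<ominus>\<^bsub>R\<^esub> a) e2"
    "\<alpha> \<odot>\<^bsub>M\<^esub> e2 = lin_comb (restrict_scalars S M) c e1 \<zero>\<^bsub>R\<^esub> e2"
proof -
  let ?N = "restrict_scalars S M"
  interpret N: module R ?N by (rule module_restrict_scalars[OF alg M])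
  have e: "basis2 R ?N e1 e2" and [simp]: "a \<in> carrier R" "b \<in> carrier R" "c \<in> carrier R"
    and \<alpha>1: "\<alpha> \<odot>\<^bsub>M\<^esub> e1 = b \<odot>\<^bsub>?N\<^esub> e1 \<ominus>\<^bsub>M\<^esub> a \<odot>\<^bsub>?N\<^esub> e2" and \<alpha>2: "\<alpha> \<odot>\<^bsub>M\<^esub> e2 = c \<odot>\<^bsub>?N\<^esub> e1"
    using gf unfolding good_frame_def Let_def by blast+
  note ecl = N.basis2_closed[OF e]
  have "(\<ominus>\<^bsub>R\<^esub> a) \<odot>\<^bsub>?N\<^esub> e2 = \<ominus>\<^bsub>M\<^esub> (a \<odot>\<^bsub>?N\<^esub> e2)"
    using N.smult_l_minus[of a e2] ecl by (simp only: \<open>a \<in> carrier R\<close> restrict_scalars_a_inv)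
  then show "\<alpha> \<odot>\<^bsub>M\<^esub> e1 = lin_comb ?N b e1 (\<ominus>\<^bsub>R\<^esub> a) e2"
    by (simp only: \<alpha>1 a_minus_def restrict_scalars_simps(3))
  have "\<zero>\<^bsub>R\<^esub> \<odot>\<^bsub>?N\<^esub> e2 = \<zero>\<^bsub>?N\<^esub>" by (rule N.smult_l_null[OF ecl(2)])
  moreover have "c \<odot>\<^bsub>?N\<^esub> e1 \<oplus>\<^bsub>?N\<^esub> \<zero>\<^bsub>?N\<^esub> = c \<odot>\<^bsub>?N\<^esub> e1"
    by (rule N.M.r_zero[OF N.smult_closed[OF \<open>c \<in> carrier R\<close> ecl(1)]])
  ultimately show "\<alpha> \<odot>\<^bsub>M\<^esub> e2 = lin_comb ?N c e1 \<zero>\<^bsub>R\<^esub> e2"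
    by (simp only: \<alpha>2)
qed

text \<open>The frame shows that \<alpha> has polynomial T^2 - bT + ac on the module, and
  pseudoregularity, applied over the affine open U, transfers it to the algebra. There the matrix of
  \<alpha> in the basis 1, \<alpha> is a companion matrix, whose trace and determinant are, up to
  sign, the coordinates of \<alpha>^2. The freeness assumptions turn both bases over U into bases of
  sheaves.\<close>

lemma good_frame_relation:
  fixes \<O> :: "('x, 'a) ring_presheaf"
  assumes alg: "algebra_sheaf X \<O> \<A>" and lfA: "locally_free_rank2 X \<O> \<A>"
    and pr: "pseudoregular X \<O> \<A> \<M>" and aff: "affine_open X \<O> U"
    and frA: "free_rank2_on X \<O> \<A> U" and frM: "free_rank2_on X \<O> (restrict_scalars_sheaf \<A> \<M>) U"
    and gf: "good_frame (sections \<O> U) (sections \<A> U) (sections \<M> U) \<alpha> e1 e2 a b c"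
  shows "\<alpha> \<otimes>\<^bsub>sections \<A> U\<^esub> \<alpha> = (\<ominus>\<^bsub>sections \<O> U\<^esub> (a \<otimes>\<^bsub>sections \<O> U\<^esub> c)) \<odot>\<^bsub>sections \<A> U\<^esub> \<one>\<^bsub>sections \<A> U\<^esub>
    \<oplus>\<^bsub>sections \<A> U\<^esub> b \<odot>\<^bsub>sections \<A> U\<^esub> \<alpha>"
proof -
  let ?R = "sections \<O> U" and ?S = "sections \<A> U" and ?M = "sections \<M> U"
  let ?N = "restrict_scalars ?S ?M"
  have U: "openin X U" using aff by (simp add: affine_open_def)
  have M: "module_sheaf X \<A> \<M>" and lfM: "locally_free_rank2 X \<O> (restrict_scalars_sheaf \<A> \<M>)"
    using pr unfolding pseudoregular_def by blast+
  have algU: "algebra ?R ?S" by (rule algebra_sheafD(4)[OF alg U])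
  interpret S: cring ?S by (rule ringed_space.cring_sections[OF algebra_sheafD(2)[OF alg] U])
  interpret R: cring ?R by (rule ringed_space.cring_sections[OF algebra_sheafD(1)[OF alg] U])
  interpret A: algebra ?R ?S by (rule algU)
  have \<alpha>b: "basis2 ?R ?S \<one>\<^bsub>?S\<^esub> \<alpha>" and eb: "basis2 ?R ?N e1 e2"
    and [simp]: "a \<in> carrier ?R" "b \<in> carrier ?R" "c \<in> carrier ?R"
    using gf unfolding good_frame_def Let_def by blast+
  have \<alpha>[simp]: "\<alpha> \<in> carrier ?S" using A.basis2_closed[OF \<alpha>b] by blast
  have \<alpha>U: "restr \<A> U U \<alpha> = \<alpha>" by (rule module_sheaf.mod_restr_id[OF algebra_sheafD(3)[OF alg] U \<alpha>])
  interpret E1: sheaf_endo X \<O> \<A> U "mult_endo \<A> U \<alpha>"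
    by (rule sheaf_endo_mult[OF alg U \<alpha>])
  interpret E2: sheaf_endo X \<O> "restrict_scalars_sheaf \<A> \<M>" U "smult_endo \<A> \<M> U \<alpha>"
    by (rule sheaf_endo_smult[OF alg M U \<alpha>])
  have cp: "charpoly X \<O> \<A> U (mult_endo \<A> U \<alpha>) =
      charpoly X \<O> (restrict_scalars_sheaf \<A> \<M>) U (smult_endo \<A> \<M> U \<alpha>)"
    using pr aff \<alpha> unfolding pseudoregular_def by blast
  have b1: "sheaf_basis2 X \<O> \<A> U \<one>\<^bsub>?S\<^esub> \<alpha>"
    using frA unfolding free_rank2_on_def by (elim exE) (rule E1.sheaf_basis2_change[OF U _ \<alpha>b])
  have b2: "sheaf_basis2 X \<O> (restrict_scalars_sheaf \<A> \<M>) U e1 e2"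
    using frM unfolding free_rank2_on_def
    by (elim exE) (rule E2.sheaf_basis2_change[OF U], assumption, simp add: eb)
  obtain t n where tn: "E1.td U \<one>\<^bsub>?S\<^esub> \<alpha> t n"
    and q1: "restr \<O> U U \<circ> charpoly X \<O> \<A> U (mult_endo \<A> U \<alpha>) = quad_poly ?R t n"
    using E1.charpoly_spec(2)[OF lfA U order_refl b1] unfolding E1.charpoly_on_iff[OF U] by blast
  obtain t' n' where tn': "E2.td U e1 e2 t' n'"
    and q2: "restr \<O> U U \<circ> charpoly X \<O> \<A> U (mult_endo \<A> U \<alpha>) = quad_poly ?R t' n'"
    using E2.charpoly_spec(2)[OF lfM U order_refl b2] unfolding E2.charpoly_on_iff[OF U] cp by blast
  have tt': "t = t'" "n = n'"
    using R.quad_poly_inject[OF q1[symmetric, unfolded q2, symmetric]] E1.td_closed[OF U tn] E2.td_closed[OF U tn']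
    by blast+
  \<comment> \<open>The witnesses are the entries of the frame's matrix, and the determinant is b 0
    - c (-a) = ac.\<close>
  have "E2.td U e1 e2 b (a \<otimes>\<^bsub>?R\<^esub> c)"
    unfolding E2.td_def trace_det_def \<alpha>U restrict_scalars_sheaf_simps
    by (rule bexI[of _ b], rule bexI[of _ c], rule bexI[of _ "\<ominus>\<^bsub>?R\<^esub> a"], rule bexI[of _ "\<zero>\<^bsub>?R\<^esub>"])
      (simp_all only: good_frame_action[OF algU module_sheaf.module_sections[OF M U] gf],
        simp_all add: R.ring_diff_simps)
  with tt' have t: "t = b" and n: "n = a \<otimes>\<^bsub>?R\<^esub> c"
    using E2.td_unique[OF U order_refl b2 b2 tn'] by blast+
  obtain A B C D where [simp]: "A \<in> carrier ?R" "B \<in> carrier ?R" "C \<in> carrier ?R" "D \<in> carrier ?R"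
    and AC: "\<alpha> \<otimes>\<^bsub>?S\<^esub> \<one>\<^bsub>?S\<^esub> = lin_comb ?S A \<one>\<^bsub>?S\<^esub> C \<alpha>"
    and BD: "\<alpha> \<otimes>\<^bsub>?S\<^esub> \<alpha> = lin_comb ?S B \<one>\<^bsub>?S\<^esub> D \<alpha>"
    and tnABCD: "t = A \<oplus>\<^bsub>?R\<^esub> D" "n = A \<otimes>\<^bsub>?R\<^esub> D \<ominus>\<^bsub>?R\<^esub> B \<otimes>\<^bsub>?R\<^esub> C"
    using tn unfolding E1.td_def trace_det_def \<alpha>U by blast
  \<comment> \<open>The first column of the companion matrix is forced by \<alpha> 1 = \<alpha>;
    hence t = D and n = -B.\<close>
  have "lin_comb ?S A \<one>\<^bsub>?S\<^esub> C \<alpha> = lin_comb ?S \<zero>\<^bsub>?R\<^esub> \<one>\<^bsub>?S\<^esub> \<one>\<^bsub>?R\<^esub> \<alpha>"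
    unfolding AC[symmetric] using \<alpha> by simp
  then have AC': "A = \<zero>\<^bsub>?R\<^esub>" "C = \<one>\<^bsub>?R\<^esub>"
    using A.basis2_unique[OF \<alpha>b, of A C "\<zero>\<^bsub>?R\<^esub>" "\<one>\<^bsub>?R\<^esub>"] by simp_all
  have "D = b" using tnABCD(1) t AC' by simp
  moreover have "B = \<ominus>\<^bsub>?R\<^esub> (a \<otimes>\<^bsub>?R\<^esub> c)"
    using tnABCD(2) n AC' by (simp add: a_minus_def)
  ultimately show ?thesis using BD by simp
qed

text \<open>The unit is the determinant of e, \<alpha>e in the basis e1, e2, for e = x e1 + y e2,
  left in the unexpanded form in which the coordinates of \<alpha>e arise. That e generates over
  every smaller W, as the comparison of tensor products demands, comes from upgrading e, \<alpha>e
  to a basis of the sheaf over V.\<close>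

lemma local_cyclic_generator:
  fixes \<O> :: "('x, 'a) ring_presheaf"
  assumes alg: "algebra_sheaf X \<O> \<A>" and M: "module_sheaf X \<A> \<M>" and U: "openin X U"
    and frA: "free_rank2_on X \<O> \<A> U" and frM: "free_rank2_on X \<O> (restrict_scalars_sheaf \<A> \<M>) U"
    and gf: "good_frame (sections \<O> U) (sections \<A> U) (sections \<M> U) \<alpha> e1 e2 a b c"
    and xy: "x \<in> \<Gamma> \<O> U" "y \<in> \<Gamma> \<O> U" and V: "openin X V" "V \<subseteq> U"
    and unit: "restr \<O> U V
        (x \<otimes>\<^bsub>sections \<O> U\<^esub> (x \<otimes>\<^bsub>sections \<O> U\<^esub> (\<ominus>\<^bsub>sections \<O> U\<^esub> a) \<oplus>\<^bsub>sections \<O> U\<^esub> y \<otimes>\<^bsub>sections \<O> U\<^esub> \<zero>\<^bsub>sections \<O> U\<^esub>)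
        \<ominus>\<^bsub>sections \<O> U\<^esub> y \<otimes>\<^bsub>sections \<O> U\<^esub> (x \<otimes>\<^bsub>sections \<O> U\<^esub> b \<oplus>\<^bsub>sections \<O> U\<^esub> y \<otimes>\<^bsub>sections \<O> U\<^esub> c))
      \<in> Units (sections \<O> V)"
  shows "\<exists>e\<in>\<Gamma> \<M> V. \<forall>W. openin X W \<and> W \<subseteq> V \<longrightarrow>
    free_generator (sections \<A> W) (sections \<M> W) (restr \<M> V W e)"
proof -
  let ?R = "sections \<O> U" and ?S = "sections \<A> U" and ?M = "sections \<M> U"
  let ?N = "restrict_scalars ?S ?M"
  have algU: "algebra ?R ?S" by (rule algebra_sheafD(4)[OF alg U])
  interpret R: cring ?R by (rule ringed_space.cring_sections[OF algebra_sheafD(1)[OF alg] U])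
  interpret h: ring_hom_ring ?R "sections \<O> V" "restr \<O> U V"
    by (rule ringed_space.restr_ring_hom_ring[OF algebra_sheafD(1)[OF alg] U V])
  interpret A: algebra ?R ?S by (rule algU)
  have \<alpha>b: "basis2 ?R ?S \<one>\<^bsub>?S\<^esub> \<alpha>" and eb: "basis2 ?R ?N e1 e2"
    and [simp]: "a \<in> carrier ?R" "b \<in> carrier ?R" "c \<in> carrier ?R"
    using gf unfolding good_frame_def Let_def by blast+
  note [simp] = xy
  have \<alpha>[simp]: "\<alpha> \<in> carrier ?S" using A.basis2_closed[OF \<alpha>b] by blast
  have \<alpha>U: "restr \<A> U U \<alpha> = \<alpha>" by (rule module_sheaf.mod_restr_id[OF algebra_sheafD(3)[OF alg] U \<alpha>])
  interpret SX: ringed_space X \<A> by (rule algebra_sheafD(2)[OF alg])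
  interpret MX: module_sheaf X \<A> \<M> by (rule M)
  interpret E1: sheaf_endo X \<O> \<A> U "mult_endo \<A> U \<alpha>"
    by (rule sheaf_endo_mult[OF alg U \<alpha>])
  interpret E2: sheaf_endo X \<O> "restrict_scalars_sheaf \<A> \<M>" U "smult_endo \<A> \<M> U \<alpha>"
    by (rule sheaf_endo_smult[OF alg M U \<alpha>])
  interpret N: module ?R ?N by (rule module_restrict_scalars[OF algU MX.module_sections[OF U]])
  have b1: "sheaf_basis2 X \<O> \<A> U \<one>\<^bsub>?S\<^esub> \<alpha>"
    using frA unfolding free_rank2_on_def by (elim exE) (rule E1.sheaf_basis2_change[OF U _ \<alpha>b])
  have b2: "sheaf_basis2 X \<O> (restrict_scalars_sheaf \<A> \<M>) U e1 e2"
    using frM unfolding free_rank2_on_def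
    by (elim exE) (rule E2.sheaf_basis2_change[OF U], assumption, simp add: eb)
  note ecl = N.basis2_closed[OF eb]
  define e where "e = lin_comb ?N x e1 y e2"
  have e: "e \<in> carrier ?N" unfolding e_def by (intro N.M.a_closed N.smult_closed xy ecl)
  \<comment> \<open>The pair u, v consists of the coordinates of \<alpha>e, computed from the matrix
    of the good frame.\<close>
  define u where "u = x \<otimes>\<^bsub>?R\<^esub> b \<oplus>\<^bsub>?R\<^esub> y \<otimes>\<^bsub>?R\<^esub> c"
  define v where "v = x \<otimes>\<^bsub>?R\<^esub> (\<ominus>\<^bsub>?R\<^esub> a) \<oplus>\<^bsub>?R\<^esub> y \<otimes>\<^bsub>?R\<^esub> \<zero>\<^bsub>?R\<^esub>"
  have uv: "u \<in> carrier ?R" "v \<in> carrier ?R" by (simp_all add: u_def v_def)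
  have "\<alpha> \<odot>\<^bsub>?M\<^esub> e = lin_comb ?N x (\<alpha> \<odot>\<^bsub>?M\<^esub> e1) y (\<alpha> \<odot>\<^bsub>?M\<^esub> e2)"
    unfolding e_def
    using E2.endo_add[OF U order_refl, of "x \<odot>\<^bsub>?N\<^esub> e1" "y \<odot>\<^bsub>?N\<^esub> e2"]
      E2.endo_smult[OF U order_refl xy(1), of e1] E2.endo_smult[OF U order_refl xy(2), of e2]
      N.smult_closed[OF xy(1) ecl(1)] N.smult_closed[OF xy(2) ecl(2)] ecl
    unfolding \<alpha>U restrict_scalars_sheaf_simps by simp
  also have "\<dots> = lin_comb ?N u e1 v e2"
    unfolding good_frame_action[OF algU MX.module_sections[OF U] gf] u_def v_def
    by (rule N.lin_comb_lin_comb) (use ecl in simp_all)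
  finally have \<alpha>e: "\<alpha> \<odot>\<^bsub>?M\<^esub> e = lin_comb ?N u e1 v e2" .
  let ?NV = "restrict_scalars (sections \<A> V) (sections \<M> V)" and ?r = "restr \<O> U V"
  interpret NV: module "sections \<O> V" ?NV
    by (rule module_restrict_scalars[OF algebra_sheafD(4)[OF alg V(1)] MX.module_sections[OF V(1)]])
  have b2V: "sheaf_basis2 X \<O> (restrict_scalars_sheaf \<A> \<M>) V (restr \<M> U V e1) (restr \<M> U V e2)"
    using E2.sheaf_basis2_restr[OF U V b2] by simp
  have restr_lin: "restr \<M> U V (lin_comb ?N r e1 s e2) =
      ?r r \<odot>\<^bsub>?NV\<^esub> restr \<M> U V e1 \<oplus>\<^bsub>?NV\<^esub> ?r s \<odot>\<^bsub>?NV\<^esub> restr \<M> U V e2"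
    if "r \<in> carrier ?R" "s \<in> carrier ?R" for r s
    using E2.restr_lin_comb[OF U V that, of e1 e2] ecl unfolding restrict_scalars_sheaf_simps by simp
  have "?r x \<otimes>\<^bsub>sections \<O> V\<^esub> ?r v \<ominus>\<^bsub>sections \<O> V\<^esub> ?r y \<otimes>\<^bsub>sections \<O> V\<^esub> ?r u =
      ?r (x \<otimes>\<^bsub>?R\<^esub> v \<ominus>\<^bsub>?R\<^esub> y \<otimes>\<^bsub>?R\<^esub> u)"
    using uv by (simp add: a_minus_def)
  also have "\<dots> \<in> Units (sections \<O> V)" using unit unfolding u_def v_def .
  finally have "basis2 (sections \<O> V) ?NV (restr \<M> U V e) (restr \<M> U V (\<alpha> \<odot>\<^bsub>?M\<^esub> e))"
    unfolding \<alpha>e unfolding e_def restr_lin[OF xy] restr_lin[OF uv]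
    by (intro NV.basis2_change[OF E2.sheaf_basis2_basis2[OF V(1) b2V, unfolded restrict_scalars_sheaf_simps]])
      (use uv in simp_all)
  then have bV: "sheaf_basis2 X \<O> (restrict_scalars_sheaf \<A> \<M>) V (restr \<M> U V e) (restr \<M> U V (\<alpha> \<odot>\<^bsub>?M\<^esub> e))"
    by (intro E2.sheaf_basis2_change[OF V(1) b2V]) simp
  have eM: "e \<in> carrier ?M" using e by simp
  show ?thesis
  proof (intro bexI[of _ "restr \<M> U V e"] allI impI)
    show eV: "restr \<M> U V e \<in> \<Gamma> \<M> V" by (rule MX.mod_restr_closed[OF U V eM])
    fix W assume "openin X W \<and> W \<subseteq> V"
    then have W: "openin X W" "W \<subseteq> V" "W \<subseteq> U" using V by auto
    have "restr \<M> V W (restr \<M> U V (\<alpha> \<odot>\<^bsub>?M\<^esub> e)) = restr \<M> U W (\<alpha> \<odot>\<^bsub>?M\<^esub> e)"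
      by (rule MX.mod_restr_comp[OF U V(1) W(1) V(2) W(2)])
        (rule module.smult_closed[OF MX.module_sections[OF U] \<alpha> eM])
    also have "\<dots> = restr \<A> U W \<alpha> \<odot>\<^bsub>sections \<M> W\<^esub> restr \<M> U W e"
      by (rule MX.restr_smult[OF U W(1,3) \<alpha> eM])
    also have "restr \<M> U W e = restr \<M> V W (restr \<M> U V e)"
      by (rule MX.mod_restr_comp[OF U V(1) W(1) V(2) W(2) eM, symmetric])
    finally have \<alpha>eW: "restr \<M> V W (restr \<M> U V (\<alpha> \<odot>\<^bsub>?M\<^esub> e)) =
        restr \<A> U W \<alpha> \<odot>\<^bsub>sections \<M> W\<^esub> restr \<M> V W (restr \<M> U V e)" .
    have 1: "basis2 (sections \<O> W) (restrict_scalars (sections \<A> W) (sections \<M> W))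
        (restr \<M> V W (restr \<M> U V e)) (restr \<A> U W \<alpha> \<odot>\<^bsub>sections \<M> W\<^esub> restr \<M> V W (restr \<M> U V e))"
      using bV W unfolding sheaf_basis2_def \<alpha>eW[symmetric] by simp
    interpret hA: ring_hom_ring ?S "sections \<A> W" "restr \<A> U W"
      by (rule SX.restr_ring_hom_ring[OF U W(1,3)])
    have 2: "basis2 (sections \<O> W) (sections \<A> W) \<one>\<^bsub>sections \<A> W\<^esub> (restr \<A> U W \<alpha>)"
      by (rule b1[unfolded sheaf_basis2_def, THEN conjunct2, THEN conjunct2, rule_format,
          OF conjI[OF W(1,3)], unfolded hA.hom_one])
    show "free_generator (sections \<A> W) (sections \<M> W) (restr \<M> V W (restr \<M> U V e))"
      by (rule cyclic_of_basis2[OF algebra_sheafD(4)[OF alg W(1)] MX.module_sections[OF W(1)] 2 1])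
  qed
qed

text \<open>The values of \<open>- ax\<^sup>2 - bxy - cy\<^sup>2\<close> at \<open>(1, 0)\<close>, \<open>(0, 1)\<close> and \<open>(1, 1)\<close> generate the ideal
  \<open>\<langle>a, b, c\<rangle>\<close>.\<close>

lemma quadratic_form_value_notin:
  assumes "primeideal \<nn> R" and [simp]: "a \<in> carrier R" "b \<in> carrier R" "c \<in> carrier R"
    and "\<not> {a, b, c} \<subseteq> \<nn>"
  obtains x y where "x \<in> carrier R" "y \<in> carrier R"
    "x \<otimes>\<^bsub>R\<^esub> (x \<otimes>\<^bsub>R\<^esub> (\<ominus>\<^bsub>R\<^esub> a) \<oplus>\<^bsub>R\<^esub> y \<otimes>\<^bsub>R\<^esub> \<zero>\<^bsub>R\<^esub>) \<ominus>\<^bsub>R\<^esub> y \<otimes>\<^bsub>R\<^esub> (x \<otimes>\<^bsub>R\<^esub> b \<oplus>\<^bsub>R\<^esub> y \<otimes>\<^bsub>R\<^esub> c) \<notin> \<nn>"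
proof -
  interpret primeideal \<nn> R by fact
  let ?D = "\<lambda>x y. x \<otimes>\<^bsub>R\<^esub> (x \<otimes>\<^bsub>R\<^esub> (\<ominus>\<^bsub>R\<^esub> a) \<oplus>\<^bsub>R\<^esub> y \<otimes>\<^bsub>R\<^esub> \<zero>\<^bsub>R\<^esub>) \<ominus>\<^bsub>R\<^esub> y \<otimes>\<^bsub>R\<^esub> (x \<otimes>\<^bsub>R\<^esub> b \<oplus>\<^bsub>R\<^esub> y \<otimes>\<^bsub>R\<^esub> c)"
  have D10: "?D \<one>\<^bsub>R\<^esub> \<zero>\<^bsub>R\<^esub> = \<ominus>\<^bsub>R\<^esub> a" by (simp add: a_minus_def)
  have D01: "?D \<zero>\<^bsub>R\<^esub> \<one>\<^bsub>R\<^esub> = \<ominus>\<^bsub>R\<^esub> c" by (simp add: a_minus_def)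
  \<comment> \<open>The value at (1, 1) is -a - b - c, so b is recovered from it once a and c are
    known to lie in the ideal.\<close>
  have D11: "\<ominus>\<^bsub>R\<^esub> (a \<oplus>\<^bsub>R\<^esub> c) \<ominus>\<^bsub>R\<^esub> ?D \<one>\<^bsub>R\<^esub> \<one>\<^bsub>R\<^esub> = b" by (simp add: ring_diff_simps)
  have neg: "r \<in> \<nn>" if "\<ominus>\<^bsub>R\<^esub> r \<in> \<nn>" "r \<in> carrier R" for r
    using additive_subgroup.a_inv_closed[OF is_additive_subgroup that(1)] that(2) by simp
  show ?thesis
  proof (rule ccontr)
    assume no: "\<not> thesis"
    note witness = that
    have *: "?D x y \<in> \<nn>" if xy: "x \<in> carrier R" "y \<in> carrier R" for x y
    proof (rule ccontr)
      assume "?D x y \<notin> \<nn>"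
      from witness[OF xy this] no show False by (rule notE[rotated])
    qed
    have a: "a \<in> \<nn>" by (rule neg[OF *[of "\<one>\<^bsub>R\<^esub>" "\<zero>\<^bsub>R\<^esub>", unfolded D10]]) simp_all
    have c: "c \<in> \<nn>" by (rule neg[OF *[of "\<zero>\<^bsub>R\<^esub>" "\<one>\<^bsub>R\<^esub>", unfolded D01]]) simp_all
    have "\<ominus>\<^bsub>R\<^esub> (a \<oplus>\<^bsub>R\<^esub> c) \<ominus>\<^bsub>R\<^esub> ?D \<one>\<^bsub>R\<^esub> \<one>\<^bsub>R\<^esub> \<in> \<nn>"
      unfolding a_minus_def[of R "\<ominus>\<^bsub>R\<^esub> (a \<oplus>\<^bsub>R\<^esub> c)"]
      by (intro additive_subgroup.a_closed[OF is_additive_subgroup]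
          additive_subgroup.a_inv_closed[OF is_additive_subgroup] a c *) simp_all
    with a c D11 assms(5) show False by simp
  qed
qed

text \<open>A value of the quadratic form outside \<nn> becomes a unit on a neighbourhood of x, and
  there the vector with the coordinates y, z at which it is attained is a free generator.\<close>

lemma cyclic_near_point:
  fixes \<O> :: "('x, 'a) ring_presheaf"
  assumes alg: "algebra_sheaf X \<O> \<A>" and M: "module_sheaf X \<A> \<M>" and U: "openin X U"
    and frA: "free_rank2_on X \<O> \<A> U" and frM: "free_rank2_on X \<O> (restrict_scalars_sheaf \<A> \<M>) U"
    and gf: "good_frame (sections \<O> U) (sections \<A> U) (sections \<M> U) \<alpha> e1 e2 a b c"
    and \<nn>: "primeideal \<nn> (sections \<O> U)"
    and unit: "\<forall>f\<in>\<Gamma> \<O> U - \<nn>.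
        \<exists>V. openin X V \<and> x \<in> V \<and> V \<subseteq> U \<and> restr \<O> U V f \<in> Units (sections \<O> V)"
    and abc: "\<not> {a, b, c} \<subseteq> \<nn>"
  obtains V e where "openin X V" "x \<in> V" "e \<in> \<Gamma> \<M> V"
    "\<forall>W. openin X W \<and> W \<subseteq> V \<longrightarrow>
      free_generator (sections \<A> W) (sections \<M> W) (restr \<M> V W e)"
proof -
  let ?R = "sections \<O> U"
  interpret R: cring ?R by (rule ringed_space.cring_sections[OF algebra_sheafD(1)[OF alg] U])
  have abc_closed: "a \<in> carrier ?R" "b \<in> carrier ?R" "c \<in> carrier ?R"
    using gf unfolding good_frame_def by blast+
  let ?D = "\<lambda>y z. y \<otimes>\<^bsub>?R\<^esub> (y \<otimes>\<^bsub>?R\<^esub> (\<ominus>\<^bsub>?R\<^esub> a) \<oplus>\<^bsub>?R\<^esub> z \<otimes>\<^bsub>?R\<^esub> \<zero>\<^bsub>?R\<^esub>) \<ominus>\<^bsub>?R\<^esub> z \<otimes>\<^bsub>?R\<^esub> (y \<otimes>\<^bsub>?R\<^esub> b \<oplus>\<^bsub>?R\<^esub> z \<otimes>\<^bsub>?R\<^esub> c)"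
  obtain y z where yz: "y \<in> carrier ?R" "z \<in> carrier ?R" and D: "?D y z \<notin> \<nn>"
    by (rule quadratic_form_value_notin[OF \<nn> abc_closed abc])
  have "?D y z \<in> carrier ?R" using abc_closed yz by simp
  from unit[rule_format, OF DiffI[OF this D]] obtain V where V: "openin X V" "V \<subseteq> U" "x \<in> V"
    and u: "restr \<O> U V (?D y z) \<in> Units (sections \<O> V)" by (elim exE conjE) (rule that)
  from local_cyclic_generator[OF alg M U frA frM gf yz V(1,2) u] show ?thesis
    by (elim bexE) (rule that[OF V(1,3)])
qed

text \<open>The neighbourhood and the basis are fixed before U and \<alpha> are given, so one local
  computation serves every affine open. The reference is the polynomial of \<alpha> on the algebra
  over U, restricted to pieces W of U \<inter> V, so \<open>charpoly\<close> of the module itself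
  does not occur.\<close>

definition pseudoregular_at ::
  "'x topology \<Rightarrow> ('x, 'a) ring_presheaf \<Rightarrow> ('x, 'a, 's) module_presheaf
    \<Rightarrow> ('x, 's, 'm) module_presheaf \<Rightarrow> 'x \<Rightarrow> bool" where
  "pseudoregular_at X \<O> \<A> \<T> x \<longleftrightarrow> (\<exists>V f1 f2. openin X V \<and> x \<in> V \<and>
      sheaf_basis2 X \<O> (restrict_scalars_sheaf \<A> \<T>) V f1 f2 \<and>
      (\<forall>U \<alpha> W. affine_open X \<O> U \<and> \<alpha> \<in> \<Gamma> \<A> U \<and> openin X W \<and> W \<subseteq> U \<inter> V \<longrightarrow>
        is_charpoly_wrt (sections \<O> W) (restrict_scalars (sections \<A> W) (sections \<T> W))
          (restr \<T> V W f1) (restr \<T> V W f2) (\<lambda>m. restr \<A> U W \<alpha> \<odot>\<^bsub>sections \<T> W\<^esub> m)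
          (restr \<O> U W \<circ> charpoly X \<O> \<A> U (mult_endo \<A> U \<alpha>))))"

text \<open>The polynomial of \<alpha> on the algebra has its coefficients in the sections over U,
  and by assumption it is correct for one basis of \<T> near each point of U. By the criterion
  \<open>charpoly_eqI\<close> it is then the polynomial of \<alpha> on \<T>.\<close>

lemma pseudoregularI_local:
  fixes \<O> :: "('x, 'a) ring_presheaf"
  assumes alg: "algebra_sheaf X \<O> \<A>" and lfA: "locally_free_rank2 X \<O> \<A>" and T: "module_sheaf X \<A> \<T>"
    and loc: "\<And>x. x \<in> topspace X \<Longrightarrow> pseudoregular_at X \<O> \<A> \<T> x"
  shows "pseudoregular X \<O> \<A> \<T>"
  unfolding pseudoregular_def
proof (intro conjI allI impI)
  show "module_sheaf X \<A> \<T>" by (rule T)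
  show "locally_free_rank2 X \<O> (restrict_scalars_sheaf \<A> \<T>)"
    unfolding locally_free_rank2_def free_rank2_on_def
  proof
    fix x assume "x \<in> topspace X"
    from loc[OF this, unfolded pseudoregular_at_def] show "\<exists>U. openin X U \<and> x \<in> U \<and> (\<exists>e1 e2. sheaf_basis2 X \<O> (restrict_scalars_sheaf \<A> \<T>) U e1 e2)"
      by (elim exE conjE) (intro exI conjI; assumption)
  qed
  fix U \<alpha> assume "affine_open X \<O> U \<and> \<alpha> \<in> \<Gamma> \<A> U"
  then have aff: "affine_open X \<O> U" and \<alpha>: "\<alpha> \<in> \<Gamma> \<A> U" by auto
  have U: "openin X U" using aff by (simp add: affine_open_def)
  interpret E1: sheaf_endo X \<O> \<A> U "mult_endo \<A> U \<alpha>"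
    by (rule sheaf_endo_mult[OF alg U \<alpha>])
  interpret E2: sheaf_endo X \<O> "restrict_scalars_sheaf \<A> \<T>" U "smult_endo \<A> \<T> U \<alpha>"
    by (rule sheaf_endo_smult[OF alg T U \<alpha>])
  have "charpoly X \<O> (restrict_scalars_sheaf \<A> \<T>) U (smult_endo \<A> \<T> U \<alpha>) =
      charpoly X \<O> \<A> U (mult_endo \<A> U \<alpha>)"
  proof (rule E2.charpoly_eqI[OF E1.charpoly_spec(1)[OF lfA]])
    fix x assume x: "x \<in> U"
    then have "x \<in> topspace X" using openin_subset[OF U] by blast
    from loc[OF this, unfolded pseudoregular_at_def] obtain V f1 f2 where V: "openin X V" "x \<in> V"
      and f: "sheaf_basis2 X \<O> (restrict_scalars_sheaf \<A> \<T>) V f1 f2"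
      and cp: "\<forall>U \<alpha> W. affine_open X \<O> U \<and> \<alpha> \<in> \<Gamma> \<A> U \<and> openin X W \<and> W \<subseteq> U \<inter> V \<longrightarrow>
        is_charpoly_wrt (sections \<O> W) (restrict_scalars (sections \<A> W) (sections \<T> W))
          (restr \<T> V W f1) (restr \<T> V W f2) (\<lambda>m. restr \<A> U W \<alpha> \<odot>\<^bsub>sections \<T> W\<^esub> m)
          (restr \<O> U W \<circ> charpoly X \<O> \<A> U (mult_endo \<A> U \<alpha>))"
      by (elim exE conjE) (rule that)
    \<comment> \<open>The neighbourhood V need not lie in the affine open U under test; restricting
      the basis to U \<inter> V meets the criterion.\<close>
    have W: "openin X (U \<inter> V)" using U V by blast
    have "sheaf_basis2 X \<O> (restrict_scalars_sheaf \<A> \<T>) (U \<inter> V) (restr \<T> V (U \<inter> V) f1) (restr \<T> V (U \<inter> V) f2)"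
      using E2.sheaf_basis2_restr[OF V(1) W _ f] by simp
    moreover have "E2.charpoly_on (U \<inter> V) (restr \<T> V (U \<inter> V) f1) (restr \<T> V (U \<inter> V) f2)
        (restr \<O> U (U \<inter> V) \<circ> charpoly X \<O> \<A> U (mult_endo \<A> U \<alpha>))"
      unfolding E2.charpoly_on_def restrict_scalars_sheaf_simps
      by (rule cp[rule_format]) (use aff \<alpha> W in simp)
    ultimately show "\<exists>W e1 e2. openin X W \<and> x \<in> W \<and> W \<subseteq> U \<and>
        sheaf_basis2 X \<O> (restrict_scalars_sheaf \<A> \<T>) W e1 e2 \<and>
        E2.charpoly_on W e1 e2 (restr \<O> U W \<circ> charpoly X \<O> \<A> U (mult_endo \<A> U \<alpha>))"
      using W x V(2) by (intro exI[of _ "U \<inter> V"] exI conjI) (simp, simp, simp, assumption, assumption)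
  qed
  then show "charpoly X \<O> \<A> U (mult_endo \<A> U \<alpha>) =
      charpoly X \<O> (restrict_scalars_sheaf \<A> \<T>) U (smult_endo \<A> \<T> U \<alpha>)"
    by (rule sym)
qed

text \<open>A basis of \<M> near x is carried to \<T> by the isomorphism. Since the isomorphism is
  linear over \<A>, and not merely over \<O>, the matrix of every \<alpha> is carried along
  unchanged.\<close>

lemma pseudoregular_local_iso:
  fixes \<O> :: "('x, 'a) ring_presheaf"
  assumes alg: "algebra_sheaf X \<O> \<A>" and pr: "pseudoregular X \<O> \<A> \<M>" and T: "module_sheaf X \<A> \<T>"
    and V0: "openin X V0" "x \<in> V0" and iso: "local_iso X \<A> \<M> \<T> V0 \<Phi>"
  shows "pseudoregular_at X \<O> \<A> \<T> x"
proof -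
  have M: "module_sheaf X \<A> \<M>" and lfM: "locally_free_rank2 X \<O> (restrict_scalars_sheaf \<A> \<M>)"
    using pr unfolding pseudoregular_def by blast+
  interpret MX: module_sheaf X \<A> \<M> by (rule M)
  interpret TX: module_sheaf X \<A> \<T> by (rule T)
  interpret B: base_module_sheaf X \<O> "restrict_scalars_sheaf \<A> \<M>"
    by (rule base_module_sheaf_restrict_scalars[OF alg M])
  have "x \<in> topspace X" using V0 openin_subset by blast
  then obtain V1 g1 g2 where V1: "openin X V1" "x \<in> V1"
    and g: "sheaf_basis2 X \<O> (restrict_scalars_sheaf \<A> \<M>) V1 g1 g2"
    using lfM unfolding locally_free_rank2_def free_rank2_on_def by blast
  \<comment> \<open>The isomorphism and the basis are given on unrelated neighbourhoods of
    x.\<close>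
  define V where "V = V0 \<inter> V1"
  have V: "openin X V" "x \<in> V" "V \<subseteq> V0" "V \<subseteq> V1" using V0 V1 by (auto simp: V_def)
  define f1 f2 where "f1 = restr \<M> V1 V g1" and "f2 = restr \<M> V1 V g2"
  have f: "sheaf_basis2 X \<O> (restrict_scalars_sheaf \<A> \<M>) V f1 f2"
    using B.sheaf_basis2_restr[OF V1(1) V(1,4) g] by (simp add: f1_def f2_def)
  have fcl: "f1 \<in> \<Gamma> \<M> V" "f2 \<in> \<Gamma> \<M> V"
    using f by (simp_all add: sheaf_basis2_def)
  have isoW: "module_iso (sections \<A> W) (sections \<M> W) (sections \<T> W) (\<Phi> W)" if "openin X W" "W \<subseteq> V" for W
    using local_isoD(1)[OF iso that(1)] that(2) V(3) by blast
  have \<Phi>_restr: "restr \<T> V W (\<Phi> V m) = \<Phi> W (restr \<M> V W m)"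
    if "openin X W" "W \<subseteq> V" "m \<in> \<Gamma> \<M> V" for W m
    by (rule local_isoD(2)[OF iso V(1,3) that])
  have modM: "module (sections \<O> W) (restrict_scalars (sections \<A> W) (sections \<M> W))"
    and modT: "module (sections \<O> W) (restrict_scalars (sections \<A> W) (sections \<T> W))" if "openin X W" for W
    by (rule module_restrict_scalars[OF algebra_sheafD(4)[OF alg that]],
        rule MX.module_sections[OF that] TX.module_sections[OF that])+
  have "sheaf_basis2 X \<O> (restrict_scalars_sheaf \<A> \<T>) V (\<Phi> V f1) (\<Phi> V f2)"
    unfolding sheaf_basis2_def restrict_scalars_sheaf_simps
  proof (intro conjI allI impI)
    show "\<Phi> V f1 \<in> carrier (restrict_scalars (sections \<A> V) (sections \<T> V))"
      "\<Phi> V f2 \<in> carrier (restrict_scalars (sections \<A> V) (sections \<T> V))"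
      using module_isoD(2)[OF isoW[OF V(1) order_refl]] fcl by simp_all
    fix W assume "openin X W \<and> W \<subseteq> V"
    then have W: "openin X W" "W \<subseteq> V" by auto
    have "basis2 (sections \<O> W) (restrict_scalars (sections \<A> W) (sections \<M> W)) (restr \<M> V W f1) (restr \<M> V W f2)"
      using f W unfolding sheaf_basis2_def by simp
    then show "basis2 (sections \<O> W) (restrict_scalars (sections \<A> W) (sections \<T> W))
        (restr \<T> V W (\<Phi> V f1)) (restr \<T> V W (\<Phi> V f2))"
      unfolding \<Phi>_restr[OF W fcl(1)] \<Phi>_restr[OF W fcl(2)]
      by (rule basis2_module_iso[OF module_iso_restrict_scalars[OF isoW[OF W] algebra_sheafD(4)[OF alg W(1)]]
          modM[OF W(1)] modT[OF W(1)]])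
  qed
  moreover have "is_charpoly_wrt (sections \<O> W) (restrict_scalars (sections \<A> W) (sections \<T> W))
      (restr \<T> V W (\<Phi> V f1)) (restr \<T> V W (\<Phi> V f2)) (\<lambda>m. restr \<A> U W \<alpha> \<odot>\<^bsub>sections \<T> W\<^esub> m)
      (restr \<O> U W \<circ> charpoly X \<O> \<A> U (mult_endo \<A> U \<alpha>))"
    if aff: "affine_open X \<O> U" and \<alpha>: "\<alpha> \<in> \<Gamma> \<A> U" and W: "openin X W" "W \<subseteq> U \<inter> V" for U \<alpha> W
  proof -
    have U: "openin X U" using aff by (simp add: affine_open_def)
    have WV: "W \<subseteq> V" and WU: "W \<subseteq> U" using W by auto
    interpret E2: sheaf_endo X \<O> "restrict_scalars_sheaf \<A> \<M>" U "smult_endo \<A> \<M> U \<alpha>"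
      by (rule sheaf_endo_smult[OF alg M U \<alpha>])
    \<comment> \<open>By pseudoregularity of \<M> the reference polynomial is also the polynomial of
      \<alpha> on \<M>, which is correct for every basis of \<M>.\<close>
    have cp: "charpoly X \<O> \<A> U (mult_endo \<A> U \<alpha>) =
        charpoly X \<O> (restrict_scalars_sheaf \<A> \<M>) U (smult_endo \<A> \<M> U \<alpha>)"
      using pr aff \<alpha> unfolding pseudoregular_def by blast
    have fW: "sheaf_basis2 X \<O> (restrict_scalars_sheaf \<A> \<M>) W (restr \<M> V W f1) (restr \<M> V W f2)"
      using B.sheaf_basis2_restr[OF V(1) W(1) WV f] by simp
    have fWcl: "restr \<M> V W f1 \<in> \<Gamma> \<M> W" "restr \<M> V W f2 \<in> \<Gamma> \<M> W"
      by (rule MX.mod_restr_closed[OF V(1) W(1) WV fcl(1)], rule MX.mod_restr_closed[OF V(1) W(1) WV fcl(2)])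
    have \<alpha>W: "restr \<A> U W \<alpha> \<in> \<Gamma> \<A> W"
      by (rule MX.ring_restr_closed[OF U W(1) WU \<alpha>])
    have "is_charpoly_wrt (sections \<O> W) (restrict_scalars (sections \<A> W) (sections \<M> W))
        (restr \<M> V W f1) (restr \<M> V W f2) (\<lambda>m. restr \<A> U W \<alpha> \<odot>\<^bsub>sections \<M> W\<^esub> m)
        (restr \<O> U W \<circ> charpoly X \<O> \<A> U (mult_endo \<A> U \<alpha>))"
      unfolding cp
      by (rule E2.charpoly_spec(2)[OF lfM W(1) WU fW, unfolded E2.charpoly_on_def restrict_scalars_sheaf_simps])
    \<comment> \<open>The basis of \<T> is the image of that of \<M>, and the isomorphism commutes
      with multiplication by \<alpha>.\<close>
    then show ?thesis
      unfolding \<Phi>_restr[OF W(1) WV fcl(1)] \<Phi>_restr[OF W(1) WV fcl(2)]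
      by (rule is_charpoly_wrt_module_iso[OF module_iso_restrict_scalars[OF isoW[OF W(1) WV] algebra_sheafD(4)[OF alg W(1)]]
          modM[OF W(1)], rotated 4])
        (simp_all add: fWcl module_isoD(4)[OF isoW[OF W(1) WV] \<alpha>W])
  qed
  ultimately show ?thesis
    unfolding pseudoregular_at_def
    using V(1,2) by (intro exI[of _ V] exI[of _ "\<Phi> V f1"] exI[of _ "\<Phi> V f2"] conjI allI impI) auto
qed

text \<open>Comparing \<open>\<alpha>'\<^sup>2 = b'\<alpha>' - a'c'\<close> with \<open>\<alpha>\<^sup>2 = b\<alpha> - ac\<close> for \<open>\<alpha>' = \<alpha> + r\<close> expresses \<open>r\<^sup>2\<close> through the
  other generators of the coprimitivity ideal, so that \<open>r\<close> is redundant up to radicals.\<close>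

lemma unital_pair_relation:
  assumes alg: "algebra R S" and basis: "basis2 R S \<one>\<^bsub>S\<^esub> \<alpha>"
    and [simp]: "a \<in> carrier R" "b \<in> carrier R" "c \<in> carrier R" "a' \<in> carrier R" "b' \<in> carrier R" "c' \<in> carrier R" "r \<in> carrier R"
    and \<alpha>': "\<alpha>' = \<alpha> \<oplus>\<^bsub>S\<^esub> r \<odot>\<^bsub>S\<^esub> \<one>\<^bsub>S\<^esub>"
    and rel: "\<alpha> \<otimes>\<^bsub>S\<^esub> \<alpha> = lin_comb S (\<ominus>\<^bsub>R\<^esub> (a \<otimes>\<^bsub>R\<^esub> c)) \<one>\<^bsub>S\<^esub> b \<alpha>"
    and rel': "\<alpha>' \<otimes>\<^bsub>S\<^esub> \<alpha>' = lin_comb S (\<ominus>\<^bsub>R\<^esub> (a' \<otimes>\<^bsub>R\<^esub> c')) \<one>\<^bsub>S\<^esub> b' \<alpha>'"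
  shows "r \<otimes>\<^bsub>R\<^esub> r = a \<otimes>\<^bsub>R\<^esub> c \<oplus>\<^bsub>R\<^esub> b' \<otimes>\<^bsub>R\<^esub> r \<ominus>\<^bsub>R\<^esub> a' \<otimes>\<^bsub>R\<^esub> c'"
proof -
  interpret R: cring R using alg by (simp add: algebra_def module_def)
  interpret S: cring S by (rule algebra.M_cring[OF alg])
  interpret A: algebra R S by (rule alg)
  have [simp]: "\<alpha> \<in> carrier S" using A.basis2_closed[OF basis] by blast
  have sq: "r \<odot>\<^bsub>S\<^esub> \<one>\<^bsub>S\<^esub> \<otimes>\<^bsub>S\<^esub> \<alpha> = r \<odot>\<^bsub>S\<^esub> \<alpha>" "\<alpha> \<otimes>\<^bsub>S\<^esub> (r \<odot>\<^bsub>S\<^esub> \<one>\<^bsub>S\<^esub>) = r \<odot>\<^bsub>S\<^esub> \<alpha>"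
    "r \<odot>\<^bsub>S\<^esub> \<one>\<^bsub>S\<^esub> \<otimes>\<^bsub>S\<^esub> (r \<odot>\<^bsub>S\<^esub> \<one>\<^bsub>S\<^esub>) = (r \<otimes>\<^bsub>R\<^esub> r) \<odot>\<^bsub>S\<^esub> \<one>\<^bsub>S\<^esub>"
    using algebra_scalar_mult(2,3)[OF alg, of r r] S.m_comm[of \<alpha> "r \<odot>\<^bsub>S\<^esub> \<one>\<^bsub>S\<^esub>"] by simp_all
  have "\<alpha>' \<otimes>\<^bsub>S\<^esub> \<alpha>' = \<alpha> \<otimes>\<^bsub>S\<^esub> \<alpha> \<oplus>\<^bsub>S\<^esub> (lin_comb S (r \<otimes>\<^bsub>R\<^esub> r) \<one>\<^bsub>S\<^esub> (r \<oplus>\<^bsub>R\<^esub> r) \<alpha>)"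
    unfolding \<alpha>' by (simp add: S.l_distr S.r_distr sq A.smult_l_distr S.a_ac)
  also have "\<dots> = lin_comb S (\<ominus>\<^bsub>R\<^esub> (a \<otimes>\<^bsub>R\<^esub> c) \<oplus>\<^bsub>R\<^esub> r \<otimes>\<^bsub>R\<^esub> r) \<one>\<^bsub>S\<^esub> (b \<oplus>\<^bsub>R\<^esub> (r \<oplus>\<^bsub>R\<^esub> r)) \<alpha>"
    unfolding rel by (rule A.lin_comb_add) simp_all
  finally have 1: "\<alpha>' \<otimes>\<^bsub>S\<^esub> \<alpha>' = lin_comb S (\<ominus>\<^bsub>R\<^esub> (a \<otimes>\<^bsub>R\<^esub> c) \<oplus>\<^bsub>R\<^esub> r \<otimes>\<^bsub>R\<^esub> r) \<one>\<^bsub>S\<^esub> (b \<oplus>\<^bsub>R\<^esub> (r \<oplus>\<^bsub>R\<^esub> r)) \<alpha>" .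
  have "\<alpha>' \<otimes>\<^bsub>S\<^esub> \<alpha>' = lin_comb S (\<ominus>\<^bsub>R\<^esub> (a' \<otimes>\<^bsub>R\<^esub> c') \<oplus>\<^bsub>R\<^esub> b' \<otimes>\<^bsub>R\<^esub> r) \<one>\<^bsub>S\<^esub> b' \<alpha>"
    unfolding rel' unfolding \<alpha>' by (simp add: A.smult_l_distr A.smult_r_distr A.smult_assoc1 S.a_ac)
  with 1 have "\<ominus>\<^bsub>R\<^esub> (a \<otimes>\<^bsub>R\<^esub> c) \<oplus>\<^bsub>R\<^esub> r \<otimes>\<^bsub>R\<^esub> r = \<ominus>\<^bsub>R\<^esub> (a' \<otimes>\<^bsub>R\<^esub> c') \<oplus>\<^bsub>R\<^esub> b' \<otimes>\<^bsub>R\<^esub> r"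
    by (intro A.basis2_unique(1)[OF basis, of _ "b \<oplus>\<^bsub>R\<^esub> (r \<oplus>\<^bsub>R\<^esub> r)" _ b']) simp_all
  then show ?thesis by (simp add: R.ring_diff_simps)
qed

lemma coprimitive_prime:
  assumes "primeideal \<nn> R" and alg: "algebra R S"
    and gf: "good_frame R S M \<alpha> e1 e2 a b c" and gf': "good_frame R S M' \<alpha>' e1' e2' a' b' c'"
    and r: "r \<in> carrier R" and \<alpha>': "\<alpha>' = \<alpha> \<oplus>\<^bsub>S\<^esub> r \<odot>\<^bsub>S\<^esub> \<one>\<^bsub>S\<^esub>"
    and gen: "genideal R {a, b, c, a', b', c', r} = carrier R"
    and rel: "\<alpha> \<otimes>\<^bsub>S\<^esub> \<alpha> = lin_comb S (\<ominus>\<^bsub>R\<^esub> (a \<otimes>\<^bsub>R\<^esub> c)) \<one>\<^bsub>S\<^esub> b \<alpha>"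
    and rel': "\<alpha>' \<otimes>\<^bsub>S\<^esub> \<alpha>' = lin_comb S (\<ominus>\<^bsub>R\<^esub> (a' \<otimes>\<^bsub>R\<^esub> c')) \<one>\<^bsub>S\<^esub> b' \<alpha>'"
  shows "\<not> {a, b, c} \<subseteq> \<nn> \<or> \<not> {a', b', c'} \<subseteq> \<nn>"
proof (rule ccontr)
  interpret primeideal \<nn> R by fact
  assume "\<not> ?thesis"
  then have \<nn>: "a \<in> \<nn>" "b \<in> \<nn>" "c \<in> \<nn>" "a' \<in> \<nn>" "b' \<in> \<nn>" "c' \<in> \<nn>" by auto
  note cl = \<nn>[THEN Icarr]
  have basis: "basis2 R S \<one>\<^bsub>S\<^esub> \<alpha>" using gf by (simp add: good_frame_def)
  have "r \<otimes>\<^bsub>R\<^esub> r = a \<otimes>\<^bsub>R\<^esub> c \<oplus>\<^bsub>R\<^esub> b' \<otimes>\<^bsub>R\<^esub> r \<ominus>\<^bsub>R\<^esub> a' \<otimes>\<^bsub>R\<^esub> c'"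
    by (rule unital_pair_relation[OF alg basis cl r \<alpha>' rel rel'])
  \<comment> \<open>Every term on the right has one of the six coefficients as a factor.\<close>
  also have "\<dots> \<in> \<nn>"
    unfolding a_minus_def
    by (intro additive_subgroup.a_closed[OF is_additive_subgroup]
        additive_subgroup.a_inv_closed[OF is_additive_subgroup] I_r_closed \<nn> cl r)
  finally have "r \<in> \<nn>" using I_prime[OF r r] by blast
  \<comment> \<open>Now all seven generators lie in the proper ideal \<nn>, although they generate
    the whole ring.\<close>
  then have "genideal R {a, b, c, a', b', c', r} \<subseteq> \<nn>"
    using \<nn> by (intro genideal_minimal[OF is_ideal]) auto
  then show False using gen I_notcarr a_subset by blast
qed

theorem theorem6p2p3:
  fixes X :: "'x topology"
    and \<O>X :: "('x, 'a) ring_presheaf"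
    and \<O>Y :: "('x, 'a, 's) module_presheaf"
    and \<I> :: "('x, 's, 'm) module_presheaf"
    and \<I>' :: "('x, 's, 'n) module_presheaf"
  assumes "scheme X \<O>X"
    and "quadratic_algebra X \<O>X \<O>Y"
    and "pseudoregular X \<O>X \<O>Y \<I>"
    and "pseudoregular X \<O>X \<O>Y \<I>'"
    and "coprimitive X \<O>X \<O>Y \<I> \<I>'"
  shows "pseudoregular X \<O>X \<O>Y (tensor_sheaf X \<O>Y \<I> \<I>')"
proof -
  have alg: "algebra_sheaf X \<O>X \<O>Y" and lfY: "locally_free_rank2 X \<O>X \<O>Y"
    using assms(2) unfolding quadratic_algebra_def by auto
  have I: "module_sheaf X \<O>Y \<I>" and I': "module_sheaf X \<O>Y \<I>'"
    using assms(3,4) unfolding pseudoregular_def by auto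
  have rs: "ringed_space X \<O>X" by (rule algebra_sheafD(1)[OF alg])
  interpret T: module_sheaf_pair X \<O>Y \<I> \<I>' by (intro module_sheaf_pair.intro I I')
  have T: "module_sheaf X \<O>Y (tensor_sheaf X \<O>Y \<I> \<I>')" by (rule T.module_sheaf_tensor)
  obtain \<U> where cover: "\<Union>\<U> = topspace X"
    and \<U>: "\<forall>U\<in>\<U>. affine_open X \<O>X U \<and>
           free_rank2_on X \<O>X \<O>Y U \<and>
           free_rank2_on X \<O>X (restrict_scalars_sheaf \<O>Y \<I>) U \<and>
           free_rank2_on X \<O>X (restrict_scalars_sheaf \<O>Y \<I>') U \<and>
           coprimitive_modules (sections \<O>X U) (sections \<O>Y U) (sections \<I> U) (sections \<I>' U)"
    using assms(5) unfolding coprimitive_def by (elim exE conjE) (rule that)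
  show ?thesis
  proof (rule pseudoregularI_local[OF alg lfY T])
    fix x assume "x \<in> topspace X"
    then obtain U where "U \<in> \<U>" and x: "x \<in> U" using cover by blast
    from \<U>[rule_format, OF \<open>U \<in> \<U>\<close>] have aff: "affine_open X \<O>X U" and frY: "free_rank2_on X \<O>X \<O>Y U"
      and frI: "free_rank2_on X \<O>X (restrict_scalars_sheaf \<O>Y \<I>) U"
      and frI': "free_rank2_on X \<O>X (restrict_scalars_sheaf \<O>Y \<I>') U"
      and cop: "coprimitive_modules (sections \<O>X U) (sections \<O>Y U) (sections \<I> U) (sections \<I>' U)"
      by auto
    have U: "openin X U" using aff by (simp add: affine_open_def)
    obtain \<alpha> e1 e2 a b c \<alpha>' e1' e2' a' b' c' r where
      gf: "good_frame (sections \<O>X U) (sections \<O>Y U) (sections \<I> U) \<alpha> e1 e2 a b c"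
      and gf': "good_frame (sections \<O>X U) (sections \<O>Y U) (sections \<I>' U) \<alpha>' e1' e2' a' b' c'"
      and r: "r \<in> \<Gamma> \<O>X U"
      and \<alpha>': "\<alpha>' = \<alpha> \<oplus>\<^bsub>sections \<O>Y U\<^esub> r \<odot>\<^bsub>sections \<O>Y U\<^esub> \<one>\<^bsub>sections \<O>Y U\<^esub>"
      and gen: "genideal (sections \<O>X U) {a, b, c, a', b', c', r} = \<Gamma> \<O>X U"
      using cop unfolding coprimitive_modules_def by (elim exE conjE) (rule that)
    \<comment> \<open>The prime depends on x; which of the two factors is generated by one element
      may change from point to point.\<close>
    obtain \<nn> where \<nn>: "primeideal \<nn> (sections \<O>X U)"
      and unit: "\<forall>f\<in>\<Gamma> \<O>X U - \<nn>.
        \<exists>V. openin X V \<and> x \<in> V \<and> V \<subseteq> U \<and> restr \<O>X U V f \<in> Units (sections \<O>X V)"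
      by (rule affine_point_prime[OF rs aff x])
    have "\<not> {a, b, c} \<subseteq> \<nn> \<or> \<not> {a', b', c'} \<subseteq> \<nn>"
      by (rule coprimitive_prime[OF \<nn> algebra_sheafD(4)[OF alg U] gf gf' r \<alpha>' gen
          good_frame_relation[OF alg lfY assms(3) aff frY frI gf]
          good_frame_relation[OF alg lfY assms(4) aff frY frI' gf']])
    then show "pseudoregular_at X \<O>X \<O>Y (tensor_sheaf X \<O>Y \<I> \<I>') x"
    proof
      assume "\<not> {a, b, c} \<subseteq> \<nn>"
      then obtain V e where V: "openin X V" "x \<in> V" and e: "e \<in> \<Gamma> \<I> V"
        and bij: "\<forall>W. openin X W \<and> W \<subseteq> V \<longrightarrow>
          free_generator (sections \<O>Y W) (sections \<I> W) (restr \<I> V W e)"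
        by (rule cyclic_near_point[OF alg I U frY frI gf \<nn> unit])
      obtain \<Phi> where "local_iso X \<O>Y \<I>' (tensor_sheaf X \<O>Y \<I> \<I>') V \<Phi>"
        using T.tensor_local_iso_left[OF V(1) e] bij by blast
      \<comment> \<open>With \<I> generated by e the tensor product becomes \<I>' near x, so it is
        the pseudoregularity of the other factor that is inherited.\<close>
      then show ?thesis by (rule pseudoregular_local_iso[OF alg assms(4) T V])
    next
      assume "\<not> {a', b', c'} \<subseteq> \<nn>"
      then obtain V e where V: "openin X V" "x \<in> V" and e: "e \<in> \<Gamma> \<I>' V"
        and bij: "\<forall>W. openin X W \<and> W \<subseteq> V \<longrightarrow>
          free_generator (sections \<O>Y W) (sections \<I>' W) (restr \<I>' V W e)"
        by (rule cyclic_near_point[OF alg I' U frY frI' gf' \<nn> unit])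
      obtain \<Phi> where "local_iso X \<O>Y \<I> (tensor_sheaf X \<O>Y \<I> \<I>') V \<Phi>"
        using T.tensor_local_iso_right[OF V(1) e] bij by blast
      then show ?thesis by (rule pseudoregular_local_iso[OF alg assms(3) T V])
    qed
  qed
qed

end
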